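(* Let $d\ge 2$ be an integer, let $L\subset\mathbb{F}$ be a curve of bidegree $(1,0)$, and let $A$ be a general element of $\mathcal{T}(d+2,L)$. Then $h^0(\mathcal{I}_A(1,d))\ge d$ and the general $S\in|\mathcal{I}_A(1,d)|$ is irreducible.
   Context: Work over $\mathbb{C}$. For $p,\ell\in\mathbb{P}^2$ write $p\ell=p_0\ell_0+p_1\ell_1+p_2\ell_2$. The flag threefold is $\mathbb{F}=\{(p,\ell)\in\mathbb{P}^2\times\mathbb{P}^2 : p\ell=0\}$, with projections $\pi_1(p,\ell)=p$, $\pi_2(p,\ell)=\ell$, and $\mathcal{O}_{\mathbb{F}}(a,b)$ is the restriction of $\mathcal{O}_{\mathbb{P}^2\times\mathbb{P}^2}(a,b)$. For a closed subscheme $A\subset\mathbb{F}$ with ideal sheaf $\mathcal{I}_A$, $\mathcal{I}_A(a,b)=\mathcal{I}_A\otimes\mathcal{O}_{\mathbb{F}}(a,b)$, $h^i$ denotes $\dim_{\mathbb{C}} H^i(\mathbb{F},\cdot)$, and $|\mathcal{I}_A(a,b)|$ is the linear system of members of $|\mathcal{O}_{\mathbb{F}}(a,b)|$ containing $A$. Curves of bidegree $(1,0)$ are the fibers of $\pi_2$. A twistor fiber is a curve $\{(p,\ell)\in\mathbb{F} : p\bar q=0,\ q\ell=0\}$ with $q\in\mathbb{P}^2$ (bar is complex conjugation of coordinates); equivalently, a fiber of $\pi:\mathbb{F}\to\mathbb{P}^2$, $\pi(p,\ell)=\bar p\times\ell$ (formal cross product). $\mathcal{T}(n,L)$ denotes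 the set of all unions of $n$ pairwise disjoint twistor fibers each of which meets $L$; since exactly one twistor fiber passes through each point of $\mathbb{F}$, it is identified, as a real algebraic variety, with the (irreducible) set of subsets of $L$ of cardinality $n$. "General $A$" means $A$ outside a proper closed real algebraic subset of $\mathcal{T}(d+2,L)$. *)

theory Defs
  imports "HOL-Analysis.Analysis" "HOL-Library.Function_Algebras"
begin

section \<open>The projective plane and the flag threefold\<close>

definition dot3 :: "complex^3 \<Rightarrow> complex^3 \<Rightarrow> complex"
  where "dot3 x y = (\<Sum>i\<in>UNIV. x $ i * y $ i)"

definition cnj3 :: "complex^3 \<Rightarrow> complex^3"
  where "cnj3 x = (\<chi> i. cnj (x $ i))"

definition proportional :: "complex^3 \<Rightarrow> complex^3 \<Rightarrow> bool"
  where "proportional x y \<longleftrightarrow> x \<noteq> 0 \<and> y \<noteq> 0 \<and> (\<exists>c. c \<noteq> 0 \<and> y = c *s x)"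

quotient_type cp2 = "complex^3" / partial: proportional
proof (rule part_equivpI)
  show "\<exists>x. proportional x x"
    by (rule exI[of _ "axis 1 1"]) (auto simp: proportional_def intro: exI[of _ 1])
  show "symp proportional"
  proof (rule sympI)
    fix x y assume "proportional x y"
    then obtain c where c: "x \<noteq> 0" "y \<noteq> 0" "c \<noteq> 0" "y = c *s x"
      by (auto simp: proportional_def)
    then have "x = inverse c *s y" by (simp add: vector_smult_assoc)
    with c show "proportional y x"
      unfolding proportional_def by (metis nonzero_imp_inverse_nonzero)
  qed
  show "transp proportional"
  proof (rule transpI)
    fix x y z assume "proportional x y" "proportional y z"
    then obtain b c where "x \<noteq> 0" "z \<noteq> 0" "b \<noteq> 0" "c \<noteq> 0" "y = b *s x" "z = c *s y"
      by (auto simp: proportional_def)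
    then show "proportional x z"
      unfolding proportional_def by (metis mult_eq_0_iff vector_smult_assoc)
  qed
qed

lift_definition incident :: "cp2 \<Rightarrow> cp2 \<Rightarrow> bool" is "\<lambda>x y. dot3 x y = 0"
proof -
  fix x x' y y' assume "proportional x x'" "proportional y y'"
  then obtain b c where bc: "b \<noteq> 0" "c \<noteq> 0" "x' = b *s x" "y' = c *s y"
    by (auto simp: proportional_def)
  have "dot3 x' y' = b * c * dot3 x y"
    by (simp add: bc dot3_def sum_distrib_left algebra_simps)
  with bc show "(dot3 x y = 0) = (dot3 x' y' = 0)" by simp
qed

lift_definition cnj_cp2 :: "cp2 \<Rightarrow> cp2" is cnj3
proof -
  fix x y assume "proportional x y"
  then obtain c where c: "x \<noteq> 0" "y \<noteq> 0" "c \<noteq> 0" "y = c *s x"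
    by (auto simp: proportional_def)
  have "cnj3 y = cnj c *s cnj3 x" by (simp add: c cnj3_def vec_eq_iff)
  moreover have "cnj3 x \<noteq> 0" "cnj3 y \<noteq> 0"
    using c by (auto simp: cnj3_def vec_eq_iff)
  ultimately show "proportional (cnj3 x) (cnj3 y)"
    unfolding proportional_def using c by (metis complex_cnj_zero_iff)
qed

definition flag :: "(cp2 \<times> cp2) set"
  where "flag = {(p, l). incident p l}"

text \<open>Homogeneous coordinates: \<open>flag_cone\<close> is the set of all pairs of coordinate vectors of
  points of \<open>flag\<close>, and \<open>pt\<close> sends such a pair to the point it represents.\<close>

definition flag_cone :: "((complex^3) \<times> (complex^3)) set"
  where "flag_cone = {(x, y). x \<noteq> 0 \<and> y \<noteq> 0 \<and> dot3 x y = 0}"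

definition pt :: "(complex^3) \<times> (complex^3) \<Rightarrow> cp2 \<times> cp2"
  where "pt = map_prod abs_cp2 abs_cp2"

definition bidegree_1_0_curve :: "(cp2 \<times> cp2) set \<Rightarrow> bool"
  where "bidegree_1_0_curve L \<longleftrightarrow> (\<exists>m. L = {z \<in> flag. snd z = m})"

section \<open>Polynomials, the Zariski topology and irreducibility\<close>

definition bihomogeneous :: "nat \<Rightarrow> nat \<Rightarrow> ((complex^3) \<times> (complex^3) \<Rightarrow> complex) \<Rightarrow> bool"
  where "bihomogeneous a b P \<longleftrightarrow>
    (\<exists>c :: (3 \<Rightarrow> nat) \<Rightarrow> (3 \<Rightarrow> nat) \<Rightarrow> complex. \<forall>x y.
      P (x, y) = (\<Sum>\<alpha> | sum \<alpha> UNIV = a. \<Sum>\<beta> | sum \<beta> UNIV = b.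
        c \<alpha> \<beta> * (\<Prod>i\<in>UNIV. x $ i ^ \<alpha> i) * (\<Prod>i\<in>UNIV. y $ i ^ \<beta> i)))"

definition zero_locus :: "((complex^3) \<times> (complex^3) \<Rightarrow> complex) \<Rightarrow> (cp2 \<times> cp2) set"
  where "zero_locus f = pt ` {z \<in> flag_cone. f z = 0}"

definition zariski_closed :: "(cp2 \<times> cp2) set \<Rightarrow> bool"
  where "zariski_closed X \<longleftrightarrow>
    (\<exists>\<P>. (\<forall>P\<in>\<P>. \<exists>a b. bihomogeneous a b P) \<and> X = flag \<inter> (\<Inter>P\<in>\<P>. zero_locus P))"

definition irreducible_set :: "(cp2 \<times> cp2) set \<Rightarrow> bool"
  where "irreducible_set X \<longleftrightarrow> X \<noteq> {} \<and>
    (\<forall>Y Z. zariski_closed Y \<and> zariski_closed Z \<and> X \<subseteq> Y \<union> Z \<longrightarrow> X \<subseteq> Y \<or> X \<subseteq> Z)"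

section \<open>Sections of line bundles and linear systems\<close>

text \<open>A global section of \<open>\<O>(a,b)\<close> on the flag threefold, seen as a function of the homogeneous
  coordinates, is locally a quotient of bihomogeneous polynomials whose bidegrees differ by
  \<open>(a,b)\<close>. The value 0 outside \<open>flag_cone\<close> is a convention making the function unique.\<close>

definition sections :: "nat \<Rightarrow> nat \<Rightarrow> ((complex^3) \<times> (complex^3) \<Rightarrow> complex) set"
  where "sections a b = {f. (\<forall>z. z \<notin> flag_cone \<longrightarrow> f z = 0) \<and>
    (\<forall>z\<in>flag_cone. \<exists>m n P Q. bihomogeneous (a + m) (b + n) P \<and> bihomogeneous m n Q \<and> Q z \<noteq> 0 \<and>
      (\<forall>w\<in>flag_cone. Q w \<noteq> 0 \<longrightarrow> f w = P w / Q w))}"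

text \<open>For a reduced closed subscheme \<open>A\<close>, given by its set of points, the ideal sheaf consists of
  the functions vanishing at all points of \<open>A\<close>; hence this is \<open>H\<^sup>0(\<I>\<^sub>A(a,b))\<close>.\<close>

definition ideal_sections :: "(cp2 \<times> cp2) set \<Rightarrow> nat \<Rightarrow> nat \<Rightarrow> ((complex^3) \<times> (complex^3) \<Rightarrow> complex) set"
  where "ideal_sections A a b = {f \<in> sections a b. \<forall>z\<in>flag_cone. pt z \<in> A \<longrightarrow> f z = 0}"

definition cscale :: "complex \<Rightarrow> ('a \<Rightarrow> complex) \<Rightarrow> 'a \<Rightarrow> complex"
  where "cscale c f = (\<lambda>z. c * f z)"

interpretation cfun: vector_space "cscale :: complex \<Rightarrow> ('a \<Rightarrow> complex) \<Rightarrow> 'a \<Rightarrow> complex"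
  by unfold_locales (auto simp: cscale_def fun_eq_iff algebra_simps)

text \<open>The library's \<open>dim\<close> is 0 on infinite-dimensional spaces, so a positive lower bound for
  \<open>h0_ideal\<close> includes finite dimensionality.\<close>

definition h0_ideal :: "(cp2 \<times> cp2) set \<Rightarrow> nat \<Rightarrow> nat \<Rightarrow> nat"
  where "h0_ideal A a b = cfun.dim (ideal_sections A a b)"

inductive homogeneous_on :: "('a \<Rightarrow> complex) set \<Rightarrow> nat \<Rightarrow> (('a \<Rightarrow> complex) \<Rightarrow> complex) \<Rightarrow> bool"
  for V where
  const: "homogeneous_on V 0 (\<lambda>_. c)"
| linear: "(\<And>f g. f \<in> V \<Longrightarrow> g \<in> V \<Longrightarrow> \<phi> (f + g) = \<phi> f + \<phi> g) \<Longrightarrow>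
    (\<And>c f. f \<in> V \<Longrightarrow> \<phi> (cscale c f) = c * \<phi> f) \<Longrightarrow> homogeneous_on V 1 \<phi>"
| add: "homogeneous_on V k \<phi> \<Longrightarrow> homogeneous_on V k \<psi> \<Longrightarrow> homogeneous_on V k (\<lambda>f. \<phi> f + \<psi> f)"
| mult: "homogeneous_on V j \<phi> \<Longrightarrow> homogeneous_on V k \<psi> \<Longrightarrow>
    homogeneous_on V (j + k) (\<lambda>f. \<phi> f * \<psi> f)"

text \<open>The linear system \<open>|V|\<close> is the projective space of the vector space \<open>V\<close> of sections. Its
  points are represented by the nonzero sections, its closed subsets by the zero sets of
  homogeneous polynomials on \<open>V\<close>. The member given by \<open>f\<close> has \<open>zero_locus f\<close> as support.\<close>

definition closed_in_system ::
    "((complex^3) \<times> (complex^3) \<Rightarrow> complex) set \<Rightarrow> ((complex^3) \<times> (complex^3) \<Rightarrow> complex) set \<Rightarrow> bool"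
  where "closed_in_system V Z \<longleftrightarrow>
    (\<exists>\<Phi>. (\<forall>\<phi>\<in>\<Phi>. \<exists>k. homogeneous_on V k \<phi>) \<and> Z = {f \<in> V - {0}. \<forall>\<phi>\<in>\<Phi>. \<phi> f = 0})"

definition general_member_irreducible :: "((complex^3) \<times> (complex^3) \<Rightarrow> complex) set \<Rightarrow> bool"
  where "general_member_irreducible V \<longleftrightarrow>
    (\<exists>Z. closed_in_system V Z \<and> Z \<noteq> V - {0} \<and> (\<forall>f \<in> V - {0} - Z. irreducible_set (zero_locus f)))"

section \<open>Unions of twistor fibers\<close>

definition twistor_fiber :: "cp2 \<Rightarrow> (cp2 \<times> cp2) set"
  where "twistor_fiber q = {(p, l) \<in> flag. incident p (cnj_cp2 q) \<and> incident q l}"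

definition twistor_unions :: "nat \<Rightarrow> (cp2 \<times> cp2) set \<Rightarrow> (cp2 \<times> cp2) set set"
  where "twistor_unions n L = {\<Union>\<C> | \<C>. \<C> \<subseteq> range twistor_fiber \<and> finite \<C> \<and> card \<C> = n \<and>
    pairwise disjnt \<C> \<and> (\<forall>C\<in>\<C>. C \<inter> L \<noteq> {})}"

definition fibers_meeting :: "(cp2 \<times> cp2) set \<Rightarrow> (cp2 \<times> cp2) set"
  where "fibers_meeting B = \<Union>{C \<in> range twistor_fiber. C \<inter> B \<noteq> {}}"

text \<open>Real polynomials in the real and imaginary parts of the homogeneous coordinates of \<open>n\<close>
  points. \<open>linear\<close> means linear over the reals.\<close>

inductive real_poly :: "nat \<Rightarrow> ((nat \<Rightarrow> (complex^3) \<times> (complex^3)) \<Rightarrow> real) \<Rightarrow> bool"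
  for n where
  const: "real_poly n (\<lambda>_. c)"
| coord: "i < n \<Longrightarrow> linear h \<Longrightarrow> real_poly n (\<lambda>v. h (v i))"
| add: "real_poly n g \<Longrightarrow> real_poly n h \<Longrightarrow> real_poly n (\<lambda>v. g v + h v)"
| mult: "real_poly n g \<Longrightarrow> real_poly n h \<Longrightarrow> real_poly n (\<lambda>v. g v * h v)"

text \<open>The real Zariski topology on \<open>twistor_unions n L\<close>, identified with the set of \<open>n\<close>-element
  subsets of \<open>L\<close>: it is the quotient topology from ordered \<open>n\<close>-tuples of distinct points of \<open>L\<close>,
  and further from their homogeneous coordinates. The polynomials need not be symmetric or
  homogeneous; the equivalence forces their common zero set to be invariant under
  permutations and rescaling.\<close>

definition real_closed :: "nat \<Rightarrow> (cp2 \<times> cp2) set \<Rightarrow> (cp2 \<times> cp2) set set \<Rightarrow> bool"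
  where "real_closed n L E \<longleftrightarrow> E \<subseteq> twistor_unions n L \<and>
    (\<exists>G. (\<forall>g\<in>G. real_poly n g) \<and>
      (\<forall>v. (\<forall>i<n. v i \<in> flag_cone \<and> pt (v i) \<in> L) \<and> inj_on (\<lambda>i. pt (v i)) {..<n} \<longrightarrow>
        (fibers_meeting ((\<lambda>i. pt (v i)) ` {..<n}) \<in> E \<longleftrightarrow> (\<forall>g\<in>G. g v = 0))))"

end

theory Submission
  imports Defs "HOL-Complex_Analysis.Complex_Analysis" "Jordan_Normal_Form.Determinant"
    "HOL-Computational_Algebra.Field_as_Ring"
    "HOL-Computational_Algebra.Fundamental_Theorem_Algebra"
begin

text \<open>The proof is explicit. Let \<open>L\<close> be the fiber of the second projection over \<open>m\<close>. In coordinates \<open>X\<close>, \<open>Y\<close> on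
  the two planes that come from a unitary frame whose last vector represents \<open>m\<close>, incidence is
  \<open>X0 Y0 + X1 Y1 + X2 Y2 = 0\<close>, and \<open>L\<close> is \<open>Y = (0 : 0 : 1)\<close>, a projective line with coordinate
  \<open>(X0 : X1)\<close>. A twistor fiber that meets \<open>L\<close> at \<open>\<lambda>\<close> is the curve on which \<open>(X0, X1)\<close> is
  proportional to \<open>\<lambda>\<close> and \<open>(Y0, Y1)\<close> to its conjugate (\<open>fiber_through_line_point\<close>); this is where
  the unitarity of the frame is used.

  \<^emph>\<open>The sections.\<close> In the chart \<open>Y2 = 1\<close> a section of bidegree \<open>(1, d)\<close> is linear in \<open>(X0, X1)\<close>, and its
  two coefficients are entire functions of \<open>(Y0, Y1)\<close> of growth \<open>d + 1\<close>, hence polynomials. Their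
  forms of degree \<open>d + 1\<close> are read off at \<open>X = (0 : 0 : 1)\<close>, \<open>Y2 = 0\<close>. If the section vanishes
  on \<open>d + 2\<close> fibers, these forms have \<open>d + 2\<close> zeros and vanish, so the section is
  \<open>X0 * A Y + X1 * B Y\<close> with forms \<open>A\<close>, \<open>B\<close> of degree \<open>d\<close> (\<open>section_formula\<close>).

  \<^emph>\<open>Irreducibility.\<close> The surface of such a section is cut out by \<open>x \<bottom> y\<close> and \<open>x \<bottom> w y\<close>, where \<open>w y\<close>
  is \<open>(A Y, B Y, 0)\<close>. Over a point \<open>y\<close> that is not proportional to \<open>w y\<close> it has the single point
  \<open>y \<times> w y\<close>. If only finitely many \<open>y\<close> are degenerate, a product of two polynomials that vanishes on
  the surface has a factor that vanishes over all other \<open>y\<close>, and by Hurwitz' theorem the fibers over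
  the degenerate \<open>y\<close> consist of limits of other points of the surface, so the factor vanishes
  there too (\<open>irreducible_surface\<close>). There are only finitely many degenerate \<open>y\<close> as soon as the
  restrictions of \<open>A\<close> and \<open>B\<close> to \<open>Y2 = 0\<close> have nonzero resultant (\<open>dir_degenerate_finite\<close>),
  and the resultant is a homogeneous polynomial on the linear system.

  \<^emph>\<open>Good members.\<close> Forms \<open>A\<close>, \<open>B\<close> in \<open>Y0\<close>, \<open>Y1\<close> alone have \<open>2 (d + 1)\<close> coefficients and satisfy
  \<open>d + 2\<close> conditions. With two of the fibers moved to \<open>0\<close> and \<open>\<infinity>\<close> and the others at \<open>t\<close> in a set \<open>T\<close>
  of \<open>d\<close> numbers, such members correspond to polynomials \<open>u\<close>, \<open>w\<close> of degree below \<open>d\<close> with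
  \<open>t * w t = cnj t * u t\<close> on \<open>T\<close>. Here \<open>u\<close> is arbitrary, which gives the dimension \<open>d\<close>. If the \<open>d + 2\<close>
  points do not lie on one circle, so that \<open>cnj t / t\<close> is not constant on \<open>T\<close>, a power
  \<open>u = (t - \<tau>) ^ (d - 1)\<close> gives a member with nonzero resultant (\<open>ex_coprime_conj_interpolant\<close>). Being on
  one circle means that all cross-ratios are real, which is a real closed condition.\<close>

no_notation vec_index (infixl "$" 100)
no_notation fps_nth (infixl "$" 75)
hide_const (open) module.smult

section \<open>Polynomial functions of one variable\<close>

text \<open>Polynomial functions of several variables are treated through their restrictions to curves, so
  that only univariate polynomials are needed.\<close>

definition poly_fun :: "(complex \<Rightarrow> complex) \<Rightarrow> bool"
  where "poly_fun g \<longleftrightarrow> (\<exists>p. \<forall>s. g s = poly p s)"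

lemma poly_fun_const [intro]: "poly_fun (\<lambda>s. c)"
  unfolding poly_fun_def by (rule exI[of _ "[:c:]"]) simp

lemma poly_fun_id [intro]: "poly_fun (\<lambda>s. s)"
  unfolding poly_fun_def by (rule exI[of _ "[:0, 1:]"]) simp

lemma poly_fun_add [intro]: "poly_fun f \<Longrightarrow> poly_fun g \<Longrightarrow> poly_fun (\<lambda>s. f s + g s)"
  unfolding poly_fun_def by (metis poly_add)

lemma poly_fun_mult [intro]: "poly_fun f \<Longrightarrow> poly_fun g \<Longrightarrow> poly_fun (\<lambda>s. f s * g s)"
  unfolding poly_fun_def by (metis poly_mult)

lemma poly_fun_diff [intro]: "poly_fun f \<Longrightarrow> poly_fun g \<Longrightarrow> poly_fun (\<lambda>s. f s - g s)"
  unfolding poly_fun_def by (metis poly_diff)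

lemma poly_fun_minus [intro]: "poly_fun f \<Longrightarrow> poly_fun (\<lambda>s. - f s)"
  unfolding poly_fun_def by (metis poly_minus)

lemma poly_fun_power [intro]: "poly_fun f \<Longrightarrow> poly_fun (\<lambda>s. f s ^ n)"
  unfolding poly_fun_def by (metis poly_power)

lemma poly_fun_sum [intro]: "(\<And>i. i \<in> I \<Longrightarrow> poly_fun (f i)) \<Longrightarrow> poly_fun (\<lambda>s. \<Sum>i\<in>I. f i s)"
  by (induction I rule: infinite_finite_induct) auto

lemma poly_fun_prod [intro]: "(\<And>i. i \<in> I \<Longrightarrow> poly_fun (f i)) \<Longrightarrow> poly_fun (\<lambda>s. \<Prod>i\<in>I. f i s)"
  by (induction I rule: infinite_finite_induct) auto

lemma poly_fun_zeros_finite: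
  assumes "poly_fun g" and "g s0 \<noteq> 0"
  shows "finite {s. g s = 0}"
proof -
  obtain p where p: "\<And>s. g s = poly p s" using assms(1) unfolding poly_fun_def by blast
  with assms(2) have "p \<noteq> 0" by auto
  then show ?thesis using poly_roots_finite[of p] by (simp add: p)
qed

lemma poly_fun_integral_domain:
  assumes "poly_fun f" "poly_fun g" "\<And>s. f s * g s = 0"
  shows "(\<forall>s. f s = 0) \<or> (\<forall>s. g s = 0)"
proof (rule ccontr)
  assume "\<not> ?thesis"
  then obtain s t where "f s \<noteq> 0" "g t \<noteq> 0" by blast
  then have "finite ({s. f s = 0} \<union> {s. g s = 0})"
    using poly_fun_zeros_finite assms by blast
  moreover have "{s. f s = 0} \<union> {s. g s = 0} = UNIV" using assms(3) by auto
  ultimately show False using infinite_UNIV_char_0[where 'a=complex] by simp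
qed

lemma poly_fun_holomorphic: "poly_fun g \<Longrightarrow> g holomorphic_on A"
proof -
  assume "poly_fun g"
  then obtain p where "g = poly p" unfolding poly_fun_def by blast
  then show ?thesis by (simp add: holomorphic_intros)
qed

lemma Liouville_poly:
  assumes "f holomorphic_on UNIV" and b: "\<And>z. norm (f z) \<le> C * (1 + norm z) ^ N"
  shows "\<exists>p. degree p \<le> N \<and> (\<forall>z. f z = poly p z)"
proof -
  have C: "C \<ge> 0" using b[of 0] by (simp add: order_trans[OF norm_ge_zero])
  have "norm (f z) \<le> (C * 2 ^ N) * norm z ^ N" if "1 \<le> norm z" for z
  proof -
    have "(1 + norm z) ^ N \<le> (2 * norm z) ^ N" using that by (intro power_mono) auto
    from mult_left_mono[OF this C] b[of z] show ?thesis
      by (simp add: power_mult_distrib mult_ac)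
  qed
  then have e: "\<And>z. f z = (\<Sum>k\<le>N. (deriv ^^ k) f 0 / fact k * z ^ k)"
    using Liouville_polynomial[OF assms(1)] by blast
  define p where "p = (\<Sum>k\<le>N. monom ((deriv ^^ k) f 0 / fact k) k)"
  have "degree p \<le> N" unfolding p_def
    by (rule degree_sum_le) (auto intro: order_trans[OF degree_monom_le])
  moreover have "f z = poly p z" for z
    unfolding p_def poly_sum poly_monom by (rule e)
  ultimately show ?thesis by blast
qed

section \<open>Lagrange interpolation\<close>

definition lagrange :: "complex set \<Rightarrow> complex \<Rightarrow> complex poly"
  where "lagrange T c = (\<Prod>j\<in>T - {c}. smult (1 / (c - j)) [:- j, 1:])"

lemma poly_lagrange: "poly (lagrange T c) x = (\<Prod>j\<in>T - {c}. (x - j) / (c - j))"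
  unfolding lagrange_def poly_prod by (simp add: diff_divide_distrib algebra_simps)

lemma lagrange_same: "finite T \<Longrightarrow> poly (lagrange T c) c = 1"
  unfolding poly_lagrange by (intro prod.neutral) auto

lemma lagrange_other: "finite T \<Longrightarrow> j \<in> T \<Longrightarrow> j \<noteq> c \<Longrightarrow> poly (lagrange T c) j = 0"
  unfolding poly_lagrange by (intro prod_zero) auto

lemma degree_lagrange:
  assumes "finite T" "c \<in> T"
  shows "degree (lagrange T c) < card T"
proof -
  have "degree (lagrange T c) \<le> (\<Sum>j\<in>T - {c}. degree (smult (1 / (c - j)) [:- j, 1:]))"
    unfolding lagrange_def using degree_prod_sum_le[of "T - {c}" "\<lambda>j. smult (1 / (c - j)) [:- j, 1:]"] assms(1) by (simp only: comp_def finite_Diff)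
  also have "\<dots> \<le> (\<Sum>j\<in>T - {c}. 1)" by (intro sum_mono) auto
  also have "\<dots> < card T" using card_gt_0_iff[of T] assms by (auto simp: card_Diff_singleton)
  finally show ?thesis .
qed

lemma degree_lagrange_combination:
  assumes "finite T" "T \<noteq> {}"
  shows "degree (\<Sum>c\<in>T. smult (f c) (lagrange T c)) < card T"
proof -
  have "degree (\<Sum>c\<in>T. smult (f c) (lagrange T c)) \<le> card T - 1"
  proof (rule degree_sum_le)
    fix c assume "c \<in> T"
    then have "degree (smult (f c) (lagrange T c)) < card T"
      using degree_lagrange[OF assms(1)] degree_smult_le le_less_trans by blast
    then show "degree (smult (f c) (lagrange T c)) \<le> card T - 1" by simp
  qed (use assms in auto)
  moreover have "card T > 0" using assms by (simp add: card_gt_0_iff)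
  ultimately show ?thesis by linarith
qed

lemma poly_lagrange_combination:
  assumes "finite T" "t \<in> T"
  shows "poly (\<Sum>c\<in>T. smult (f c) (lagrange T c)) t = f t"
proof -
  have "poly (\<Sum>c\<in>T. smult (f c) (lagrange T c)) t = (\<Sum>c\<in>T. if c = t then f t else 0)"
    unfolding poly_sum by (intro sum.cong) (use assms in \<open>auto simp: lagrange_same lagrange_other\<close>)
  with assms show ?thesis by simp
qed

lemma poly_eq_on_card:
  fixes p q :: "complex poly"
  assumes "degree p < card T" "degree q < card T" "\<And>t. t \<in> T \<Longrightarrow> poly p t = poly q t"
  shows "p = q"
proof (rule ccontr)
  assume "p \<noteq> q"
  then have "p - q \<noteq> 0" by simp
  have "T \<subseteq> {x. poly (p - q) x = 0}" using assms(3) by auto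
  then have "card T \<le> card {x. poly (p - q) x = 0}"
    by (intro card_mono poly_roots_finite) (use \<open>p - q \<noteq> 0\<close> in auto)
  also have "\<dots> \<le> degree (p - q)" by (rule card_poly_roots_bound) fact
  also have "\<dots> < card T" using assms degree_diff_le_max[of p q] by (simp add: le_less_trans)
  finally show False by simp
qed

lemma lagrange_interpolation:
  assumes "finite T" "T \<noteq> {}" "degree p < card T"
  shows "p = (\<Sum>c\<in>T. smult (poly p c) (lagrange T c))"
  by (rule poly_eq_on_card[OF assms(3)])
     (use assms in \<open>auto simp: degree_lagrange_combination poly_lagrange_combination\<close>)

section \<open>Entire functions of polynomial growth in two variables\<close>

definition poly2 :: "nat \<Rightarrow> (nat \<Rightarrow> nat \<Rightarrow> complex) \<Rightarrow> complex \<Rightarrow> complex \<Rightarrow> complex"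
  where "poly2 N c s t = (\<Sum>j\<le>N. \<Sum>k\<le>N - j. c j k * s ^ j * t ^ k)"

lemma poly2_unique:
  assumes "\<And>s t. poly2 N c s t = poly2 N c' s t" and "j + k \<le> N"
  shows "c j k = c' j k"
proof -
  have 1: "(\<Sum>k\<le>N - j. c j k * t ^ k) = (\<Sum>k\<le>N - j. c' j k * t ^ k)" if "j \<le> N" for t j
  proof -
    have "\<forall>s. (\<Sum>j\<le>N. (\<Sum>k\<le>N - j. c j k * t ^ k) * s ^ j) = (\<Sum>j\<le>N. (\<Sum>k\<le>N - j. c' j k * t ^ k) * s ^ j)"
    proof
      fix s show "(\<Sum>j\<le>N. (\<Sum>k\<le>N - j. c j k * t ^ k) * s ^ j) = (\<Sum>j\<le>N. (\<Sum>k\<le>N - j. c' j k * t ^ k) * s ^ j)"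
        using assms(1)[of s t] unfolding poly2_def by (simp add: sum_distrib_left sum_distrib_right mult_ac)
    qed
    then show ?thesis using polyfun_eq_coeffs[of "\<lambda>j. \<Sum>k\<le>N - j. c j k * t ^ k" N "\<lambda>j. \<Sum>k\<le>N - j. c' j k * t ^ k"] that by simp
  qed
  have "\<forall>t. (\<Sum>k\<le>N - j. c j k * t ^ k) = (\<Sum>k\<le>N - j. c' j k * t ^ k)" using 1 assms(2) by auto
  then show ?thesis using polyfun_eq_coeffs[of "c j" "N - j" "c' j"] assms(2) by simp
qed

lemma poly_eq_sum_upto: "degree (p :: complex poly) \<le> N \<Longrightarrow> poly p x = (\<Sum>i\<le>N. coeff p i * x ^ i)"
  unfolding poly_altdef by (intro sum.mono_neutral_left) (auto simp: coeff_eq_0)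

text \<open>Liouville's theorem in the second variable gives polynomials in \<open>t\<close> with coefficients depending on
  \<open>s\<close>. By interpolation the coefficients are combinations of finitely many values, so the theorem
  applies to them in turn.\<close>

lemma Liouville_poly2:
  fixes g :: "complex \<Rightarrow> complex \<Rightarrow> complex"
  assumes h1: "\<And>t. (\<lambda>s. g s t) holomorphic_on UNIV" and h2: "\<And>s. (\<lambda>t. g s t) holomorphic_on UNIV"
    and b: "\<And>s t. norm (g s t) \<le> C * (1 + norm s + norm t) ^ N"
  shows "\<exists>c. \<forall>s t. g s t = poly2 N c s t"
proof -
  have C: "C \<ge> 0" using b[of 0 0] by (simp add: order_trans[OF norm_ge_zero])
  have bound: "norm (g s t) \<le> (C * (1 + norm t) ^ N) * (1 + norm s) ^ N" for s t
  proof -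
    have "(1 + norm s + norm t) ^ N \<le> ((1 + norm t) * (1 + norm s)) ^ N"
      by (intro power_mono) (auto simp: algebra_simps)
    from mult_left_mono[OF this C] b[of s t] show ?thesis
      by (simp add: power_mult_distrib mult_ac)
  qed
  have "\<exists>p. degree p \<le> N \<and> (\<forall>t. g s t = poly p t)" for s
  proof (rule Liouville_poly[OF h2])
    fix t :: complex
    have "(1 + norm s + norm t) ^ N \<le> ((1 + norm s) * (1 + norm t)) ^ N"
      by (intro power_mono) (auto simp: algebra_simps)
    from mult_left_mono[OF this C] b[of s t]
    show "norm (g s t) \<le> (C * (1 + norm s) ^ N) * (1 + norm t) ^ N"
      by (simp add: power_mult_distrib mult_ac)
  qed
  then obtain p where p: "\<And>s. degree (p s) \<le> N" "\<And>s t. g s t = poly (p s) t" by metis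
  define T where "T = (of_nat :: nat \<Rightarrow> complex) ` {..N}"
  have T: "finite T" "T \<noteq> {}" "card T = N + 1"
    unfolding T_def by (auto simp: card_image inj_on_def)
  \<comment> \<open>The coefficients of \<open>g s\<close> are linear combinations of finitely many values \<open>g s \<tau>\<close>,
    hence entire functions of \<open>s\<close> of polynomial growth.\<close>
  have cp: "coeff (p s) k = (\<Sum>\<tau>\<in>T. g s \<tau> * coeff (lagrange T \<tau>) k)" for s k
  proof -
    have "p s = (\<Sum>\<tau>\<in>T. smult (poly (p s) \<tau>) (lagrange T \<tau>))"
      by (rule lagrange_interpolation) (use T p(1)[of s] in auto)
    then have "coeff (p s) k = coeff (\<Sum>\<tau>\<in>T. smult (poly (p s) \<tau>) (lagrange T \<tau>)) k" by metis
    then show ?thesis by (simp add: coeff_sum p(2))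
  qed
  have "\<exists>q. degree q \<le> N \<and> (\<forall>s. coeff (p s) k = poly q s)" for k
  proof (rule Liouville_poly)
    show "(\<lambda>s. coeff (p s) k) holomorphic_on UNIV"
      unfolding cp by (intro holomorphic_intros h1)
    fix s
    have "norm (coeff (p s) k) \<le> (\<Sum>\<tau>\<in>T. norm (g s \<tau>) * norm (coeff (lagrange T \<tau>) k))"
      unfolding cp by (rule sum_norm_le) (simp add: norm_mult)
    also have "\<dots> \<le> (\<Sum>\<tau>\<in>T. ((C * (1 + norm \<tau>) ^ N) * (1 + norm s) ^ N) * norm (coeff (lagrange T \<tau>) k))"
      by (intro sum_mono mult_right_mono bound) auto
    also have "\<dots> = (\<Sum>\<tau>\<in>T. (C * (1 + norm \<tau>) ^ N) * norm (coeff (lagrange T \<tau>) k)) * (1 + norm s) ^ N"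
      unfolding sum_distrib_right by (intro sum.cong) (auto simp: mult_ac)
    finally show "norm (coeff (p s) k) \<le> \<dots>" .
  qed
  then obtain q where q: "\<And>k. degree (q k) \<le> N" "\<And>k s. coeff (p s) k = poly (q k) s" by metis
  define c where "c j k = coeff (q k) j" for j k
  have g: "g s t = (\<Sum>k\<le>N. \<Sum>j\<le>N. c j k * s ^ j * t ^ k)" for s t
  proof -
    have "g s t = (\<Sum>k\<le>N. coeff (p s) k * t ^ k)"
      using p poly_eq_sum_upto[of "p s" N t] by simp
    also have "\<dots> = (\<Sum>k\<le>N. (\<Sum>j\<le>N. c j k * s ^ j) * t ^ k)"
      unfolding q(2) c_def using poly_eq_sum_upto[OF q(1)] by simp
    finally show ?thesis by (simp add: sum_distrib_right)
  qed
  \<comment> \<open>Along a line through the origin the growth bounds the total degree.\<close>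
  have top: "c j k = 0" if jk: "j + k > N" "j \<le> N" "k \<le> N" for j k
  proof -
    let ?n = "j + k"
    have z: "(\<Sum>k\<le>N. (if k \<le> ?n \<and> ?n - k \<le> N then c (?n - k) k else 0) * t ^ k) = 0" for t
    proof -
      define P where "P = (\<Sum>k\<le>N. \<Sum>j\<le>N. monom (c j k * t ^ k) (j + k))"
      have P: "g r (r * t) = poly P r" for r
        unfolding g P_def by (simp add: poly_sum poly_monom power_add power_mult_distrib mult_ac)
      have "\<exists>p. degree p \<le> N \<and> (\<forall>r. g r (r * t) = poly p r)"
      proof (rule Liouville_poly)
        show "(\<lambda>r. g r (r * t)) holomorphic_on UNIV" unfolding P by (intro holomorphic_intros)
        fix r
        have "norm (g r (r * t)) \<le> C * (1 + norm r + norm (r * t)) ^ N" by (rule b)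
        also have "\<dots> \<le> C * ((1 + norm t) * (1 + norm r)) ^ N"
          by (intro mult_left_mono power_mono) (use C in \<open>auto simp: norm_mult algebra_simps\<close>)
        finally show "norm (g r (r * t)) \<le> (C * (1 + norm t) ^ N) * (1 + norm r) ^ N"
          by (simp add: power_mult_distrib mult_ac)
      qed
      then obtain p' where "degree p' \<le> N" "poly P = poly p'" using P by auto
      then have "degree P \<le> N" by (simp add: poly_eq_poly_eq_iff)
      then have "coeff P ?n = 0" using jk by (intro coeff_eq_0) auto
      then have "(\<Sum>k\<le>N. \<Sum>j\<le>N. if j + k = ?n then c j k * t ^ k else 0) = 0"
        unfolding P_def by (simp add: coeff_sum)
      moreover have "(\<Sum>j'\<le>N. if j' + k' = ?n then c j' k' * t ^ k' else 0)
          = (if k' \<le> ?n \<and> ?n - k' \<le> N then c (?n - k') k' else 0) * t ^ k'" for k'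
      proof (cases "k' \<le> ?n")
        case True
        then have "(\<Sum>j'\<le>N. if j' + k' = ?n then c j' k' * t ^ k' else 0) = (\<Sum>j'\<le>N. if j' = ?n - k' then c j' k' * t ^ k' else 0)"
          by (intro sum.cong) auto
        then show ?thesis using True by simp
      next
        case False
        then show ?thesis by (intro trans[OF sum.neutral]) auto
      qed
      ultimately show ?thesis by simp
    qed
    then have "\<forall>t. (\<Sum>k\<le>N. (if k \<le> ?n \<and> ?n - k \<le> N then c (?n - k) k else 0) * t ^ k) = 0"
      by blast
    then have "\<forall>k\<le>N. (if k \<le> ?n \<and> ?n - k \<le> N then c (?n - k) k else 0) = 0"
      using polyfun_eq_0[of "\<lambda>k. if k \<le> ?n \<and> ?n - k \<le> N then c (?n - k) k else 0" N] by blast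
    then show ?thesis using jk by (metis diff_add_inverse2 le_add2)
  qed
  have "g s t = poly2 N c s t" for s t
  proof -
    have "g s t = (\<Sum>j\<le>N. \<Sum>k\<le>N. c j k * s ^ j * t ^ k)" unfolding g by (rule sum.swap)
    also have "\<dots> = poly2 N c s t" unfolding poly2_def
      by (intro sum.cong[OF refl] sum.mono_neutral_right) (auto intro!: top)
    finally show ?thesis .
  qed
  then show ?thesis by blast
qed

section \<open>Resultants of binary forms\<close>

text \<open>The pair \<open>a\<close>, \<open>b\<close> of polynomials of degree at most \<open>d\<close> stands for two binary forms of degree
  exactly \<open>d\<close>. The size of the matrix is therefore fixed, and a common zero at infinity, where both
  coefficients of degree \<open>d\<close> vanish, is detected as well. Its columns are the shifts of \<open>a\<close> and \<open>b\<close>,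
  so the vectors of its kernel are the syzygies of \<open>a\<close> and \<open>b\<close> of degree below \<open>d\<close>.\<close>

definition sylvester :: "nat \<Rightarrow> complex poly \<Rightarrow> complex poly \<Rightarrow> complex Matrix.mat"
  where "sylvester d a b = Matrix.mat (2 * d) (2 * d)
    (\<lambda>(i, j). if j < d then coeff (monom 1 j * a) i else coeff (monom 1 (j - d) * b) i)"

definition res :: "nat \<Rightarrow> complex poly \<Rightarrow> complex poly \<Rightarrow> complex"
  where "res d a b = Determinant.det (sylvester d a b)"

lemma sylvester_carrier: "sylvester d a b \<in> carrier_mat (2 * d) (2 * d)"
  unfolding sylvester_def by simp

lemma poly_sum_below: "degree (p :: complex poly) < n \<Longrightarrow> poly p x = (\<Sum>i<n. coeff p i * x ^ i)"
  using poly_eq_sum_upto[of p "n - 1" x] by (cases n) (auto simp: lessThan_Suc_atMost)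

lemma res_zeroI_left:
  assumes "v \<in> carrier_vec (2 * d)" "v \<noteq> 0\<^sub>v (2 * d)"
    and "\<And>j. j < d \<Longrightarrow> (\<Sum>i<2 * d. coeff (monom 1 j * a) i * vec_index v i) = 0"
    and "\<And>j. j < d \<Longrightarrow> (\<Sum>i<2 * d. coeff (monom 1 j * b) i * vec_index v i) = 0"
  shows "res d a b = 0"
proof -
  let ?S = "sylvester d a b"
  have T: "transpose_mat ?S \<in> carrier_mat (2 * d) (2 * d)" using sylvester_carrier by simp
  have "transpose_mat ?S *\<^sub>v v = 0\<^sub>v (2 * d)"
  proof (rule eq_vecI)
    fix j assume "j < dim_vec (0\<^sub>v (2 * d) :: complex Matrix.vec)"
    then have j: "j < 2 * d" by simp
    have "vec_index (transpose_mat ?S *\<^sub>v v) j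
        = (\<Sum>i<2 * d. (if j < d then coeff (monom 1 j * a) i else coeff (monom 1 (j - d) * b) i) * vec_index v i)"
      using j assms(1) by (simp add: sylvester_def scalar_prod_def lessThan_atLeast0)
    also have "\<dots> = 0" using assms(3)[of j] assms(4)[of "j - d"] j by (cases "j < d") auto
    finally show "vec_index (transpose_mat ?S *\<^sub>v v) j = vec_index (0\<^sub>v (2 * d)) j" using j by simp
  qed (simp add: sylvester_def)
  with assms(1,2) have "Determinant.det (transpose_mat ?S) = 0"
    using det_0_iff_vec_prod_zero[OF T] by blast
  then show ?thesis unfolding res_def using det_transpose[OF sylvester_carrier] by metis
qed

text \<open>The powers of a common root form a vector in the kernel of the transposed matrix; for a common
  zero at infinity the last unit vector is one.\<close>

lemma res_common_root:
  assumes "d > 0" "degree a \<le> d" "degree b \<le> d" "poly a t = 0" "poly b t = 0"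
  shows "res d a b = 0"
proof (rule res_zeroI_left)
  let ?v = "Matrix.vec (2 * d) (\<lambda>i. t ^ i)"
  show "?v \<in> carrier_vec (2 * d)" by simp
  show "?v \<noteq> 0\<^sub>v (2 * d)"
  proof
    assume "?v = 0\<^sub>v (2 * d)"
    then have "vec_index ?v 0 = vec_index (0\<^sub>v (2 * d)) 0" by (rule arg_cong)
    with \<open>d > 0\<close> show False by simp
  qed
  fix j assume j: "j < d"
  have "(\<Sum>i<2 * d. coeff (monom 1 j * p) i * vec_index ?v i) = poly (monom 1 j * p) t"
    if "degree p \<le> d" for p :: "complex poly"
  proof -
    have "degree (monom 1 j * p) < 2 * d"
      using degree_mult_le[of "monom 1 j" p] degree_monom_le[of "1::complex" j] that j by linarith
    then have "poly (monom 1 j * p) t = (\<Sum>i<2 * d. coeff (monom 1 j * p) i * t ^ i)"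
      by (rule poly_sum_below)
    then show ?thesis by simp
  qed
  with assms show "(\<Sum>i<2 * d. coeff (monom 1 j * a) i * vec_index ?v i) = 0"
    "(\<Sum>i<2 * d. coeff (monom 1 j * b) i * vec_index ?v i) = 0" by auto
qed

lemma res_common_infinity:
  assumes "d > 0" "degree a \<le> d" "degree b \<le> d" "coeff a d = 0" "coeff b d = 0"
  shows "res d a b = 0"
proof (rule res_zeroI_left)
  let ?v = "unit_vec (2 * d) (2 * d - 1) :: complex Matrix.vec"
  show "?v \<in> carrier_vec (2 * d)" by simp
  show "?v \<noteq> 0\<^sub>v (2 * d)" using assms(1) by simp
  fix j assume j: "j < d"
  have z: "coeff (monom 1 j * p) i * vec_index ?v i = 0"
    if "degree p \<le> d" "coeff p d = 0" "i < 2 * d" for p :: "complex poly" and i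
  proof (cases "i = 2 * d - 1")
    case True
    have "d \<le> i - j" using True j by simp
    then have "coeff p (i - j) = 0"
      using that(1,2) by (cases "i - j = d") (auto simp: coeff_eq_0)
    then show ?thesis using True j by (simp add: coeff_monom_mult)
  qed (use that(3) in simp)
  from assms show "(\<Sum>i<2 * d. coeff (monom 1 j * a) i * vec_index ?v i) = 0"
    by (intro sum.neutral ballI z) auto
  from assms show "(\<Sum>i<2 * d. coeff (monom 1 j * b) i * vec_index ?v i) = 0"
    by (intro sum.neutral ballI z) auto
qed

lemma coeff_mult_below:
  fixes a u :: "complex poly"
  assumes "degree u < d"
  shows "coeff (u * a) i = (\<Sum>j<d. coeff (monom 1 j * a) i * coeff u j)"
proof -
  have "u = (\<Sum>j<d. monom (coeff u j) j)"
    using assms by (intro poly_eqI) (auto simp: coeff_sum coeff_eq_0)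
  then have "coeff (u * a) i = coeff ((\<Sum>j<d. monom (coeff u j) j) * a) i" by metis
  also have "\<dots> = (\<Sum>j<d. coeff (monom 1 j * a) i * coeff u j)"
    unfolding sum_distrib_right coeff_sum by (intro sum.cong) (auto simp: coeff_monom_mult)
  finally show ?thesis .
qed

lemma sum_lessThan_add:
  fixes f :: "nat \<Rightarrow> complex"
  shows "(\<Sum>j<m + n. f j) = (\<Sum>j<m. f j) + (\<Sum>j<n. f (m + j))"
  by (induction n) (auto simp: add_ac)

lemma sylvester_mult_vec:
  assumes "i < 2 * d" "degree u < d" "degree w < d" "v \<in> carrier_vec (2 * d)"
    and "\<And>j. j < d \<Longrightarrow> vec_index v j = coeff u j" "\<And>j. j < d \<Longrightarrow> vec_index v (d + j) = coeff w j"
  shows "vec_index (sylvester d a b *\<^sub>v v) i = coeff (u * a + w * b) i"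
proof -
  let ?e = "\<lambda>j. if j < d then coeff (monom 1 j * a) i else coeff (monom 1 (j - d) * b) i"
  have "vec_index (sylvester d a b *\<^sub>v v) i = (\<Sum>j<d + d. ?e j * vec_index v j)"
    using assms(1,4) by (simp add: sylvester_def scalar_prod_def lessThan_atLeast0 mult_2)
  also have "\<dots> = (\<Sum>j<d. ?e j * vec_index v j) + (\<Sum>j<d. ?e (d + j) * vec_index v (d + j))"
    by (rule sum_lessThan_add)
  also have "\<dots> = coeff (u * a) i + coeff (w * b) i"
    using assms(5,6) by (simp add: coeff_mult_below[OF assms(2)] coeff_mult_below[OF assms(3)])
  finally show ?thesis by simp
qed

lemma res_zero_if_syzygy:
  assumes "degree u < d" "degree w < d" "u * a + w * b = 0" "u \<noteq> 0 \<or> w \<noteq> 0"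
  shows "res d a b = 0"
proof -
  let ?v = "Matrix.vec (2 * d) (\<lambda>j. if j < d then coeff u j else coeff w (j - d))"
  have "sylvester d a b *\<^sub>v ?v = 0\<^sub>v (2 * d)"
  proof (rule eq_vecI)
    fix i assume "i < dim_vec (0\<^sub>v (2 * d) :: complex Matrix.vec)"
    then show "vec_index (sylvester d a b *\<^sub>v ?v) i = vec_index (0\<^sub>v (2 * d)) i"
      using sylvester_mult_vec[of i d u w ?v a b] assms by simp
  qed (simp add: sylvester_def)
  moreover have "?v \<noteq> 0\<^sub>v (2 * d)"
  proof
    assume z: "?v = 0\<^sub>v (2 * d)"
    have u: "coeff u j = 0" and w: "coeff w j = 0" if "j < d" for j
      using arg_cong[OF z, of "\<lambda>v. vec_index v j"] arg_cong[OF z, of "\<lambda>v. vec_index v (d + j)"] that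
      by auto
    have "u = 0" using u assms(1) by (metis leading_coeff_0_iff)
    moreover have "w = 0" using w assms(2) by (metis leading_coeff_0_iff)
    ultimately show False using assms(4) by simp
  qed
  ultimately show ?thesis
    unfolding res_def det_0_iff_vec_prod_zero[OF sylvester_carrier, of d a b] by (intro exI[of _ ?v]) simp
qed

lemma syzygy_if_res_zero:
  assumes "res d a b = 0" "degree a \<le> d" "degree b \<le> d" "d > 0"
  shows "\<exists>u w. degree u < d \<and> degree w < d \<and> u * a + w * b = 0 \<and> (u \<noteq> 0 \<or> w \<noteq> 0)"
proof -
  obtain v where v: "v \<in> carrier_vec (2 * d)" "v \<noteq> 0\<^sub>v (2 * d)" "sylvester d a b *\<^sub>v v = 0\<^sub>v (2 * d)"
    using assms(1) det_0_iff_vec_prod_zero[OF sylvester_carrier] unfolding res_def by blast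
  define u where "u = (\<Sum>j<d. monom (vec_index v j) j)"
  define w where "w = (\<Sum>j<d. monom (vec_index v (d + j)) j)"
  have "degree u \<le> d - 1" "degree w \<le> d - 1"
    unfolding u_def w_def by (auto intro!: degree_sum_le order_trans[OF degree_monom_le])
  then have deg: "degree u < d" "degree w < d" using assms(4) by auto
  have c: "coeff u j = vec_index v j" "coeff w j = vec_index v (d + j)" if "j < d" for j
    unfolding u_def w_def using that by (simp_all add: coeff_sum)
  have "u * a + w * b = 0"
  proof (rule poly_eqI)
    fix i
    show "coeff (u * a + w * b) i = coeff 0 i"
    proof (cases "i < 2 * d")
      case True
      then show ?thesis using sylvester_mult_vec[of i d u w v a b] deg v c by simp
    next
      case False
      have "degree (u * a) < 2 * d" "degree (w * b) < 2 * d"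
        using degree_mult_le[of u a] degree_mult_le[of w b] deg assms by linarith+
      then show ?thesis using False by (simp add: coeff_eq_0)
    qed
  qed
  moreover have "u \<noteq> 0 \<or> w \<noteq> 0"
  proof (rule ccontr)
    assume "\<not> ?thesis"
    then have z: "vec_index v j = 0" "vec_index v (d + j) = 0" if "j < d" for j
      using c[OF that] by auto
    have "v = 0\<^sub>v (2 * d)"
    proof (rule eq_vecI)
      fix i assume "i < dim_vec (0\<^sub>v (2 * d) :: complex Matrix.vec)"
      then have "i < 2 * d" by simp
      then show "vec_index v i = vec_index (0\<^sub>v (2 * d)) i"
        using z(1)[of i] z(2)[of "i - d"] by (cases "i < d") auto
    qed (use v in simp)
    with v show False by simp
  qed
  ultimately show ?thesis using deg by blast
qed

lemma coprime_if_no_common_root: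
  fixes a b :: "complex poly"
  assumes "\<And>t. poly a t = 0 \<Longrightarrow> poly b t \<noteq> 0"
  shows "coprime a b"
proof (rule coprimeI)
  fix c assume c: "c dvd a" "c dvd b"
  have nz: "poly c t \<noteq> 0" for t
    using assms[of t] c by (auto simp: dvd_def)
  have "constant (poly c)" using nz fundamental_theorem_of_algebra by blast
  then have "degree c = 0" by (simp add: constant_degree)
  moreover have "c \<noteq> 0" using nz by auto
  ultimately show "is_unit c" by (simp add: is_unit_iff_degree)
qed

text \<open>A syzygy of coprime forms is a multiple of the trivial one, which has degree \<open>d\<close>.\<close>

lemma res_nonzero:
  assumes "degree a \<le> d" "degree b \<le> d" "d > 0"
    and "\<And>t. poly a t = 0 \<Longrightarrow> poly b t \<noteq> 0" and "coeff a d \<noteq> 0 \<or> coeff b d \<noteq> 0"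
  shows "res d a b \<noteq> 0"
proof
  assume "res d a b = 0"
  then obtain u w where uw: "degree u < d" "degree w < d" "u * a + w * b = 0" "u \<noteq> 0 \<or> w \<noteq> 0"
    using syzygy_if_res_zero assms by blast
  have cop: "coprime a b" using assms(4) by (rule coprime_if_no_common_root)
  have key: False
    if "coprime a b" "coeff a d \<noteq> 0" "degree u < d" "degree w < d" "u * a + w * b = 0" "u \<noteq> 0 \<or> w \<noteq> 0"
    for a b u w :: "complex poly"
  proof -
    have "w * b = - u * a" using that(5) by (simp add: eq_neg_iff_add_eq_0 add.commute)
    then have "a dvd w * b" by simp
    then have "a dvd w" using coprime_dvd_mult_left_iff[OF that(1), of w] by blast
    moreover have "degree a \<ge> d" using that(2) by (rule le_degree)
    ultimately have "w = 0" using that(4) dvd_imp_degree_le[of a w] by fastforce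
    moreover have "a \<noteq> 0" using that(2) by auto
    ultimately show False using that(5,6) by simp
  qed
  from assms(5) show False
  proof
    assume "coeff a d \<noteq> 0" then show False by (rule key[OF cop _ uw])
  next
    assume "coeff b d \<noteq> 0" then show False
      using key[of b a w u] cop uw by (metis add.commute coprime_commute)
  qed
qed

text \<open>The Leibniz expansion shows that the resultant is a polynomial in the coefficients, homogeneous of
  degree \<open>2 * d\<close>.\<close>

lemma res_expansion:
  "res d a b = (\<Sum>p\<in>{p. p permutes {0..<2 * d}}. signof p * (\<Prod>i\<in>{0..<2 * d}.
     if p i < d then if i < p i then 0 else coeff a (i - p i)
     else if i < p i - d then 0 else coeff b (i - (p i - d))))"
proof -
  have "index_mat (sylvester d a b) (i, p i) = (if p i < d then if i < p i then 0 else coeff a (i - p i)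
     else if i < p i - d then 0 else coeff b (i - (p i - d)))"
    if "p permutes {0..<2 * d}" "i \<in> {0..<2 * d}" for p i
    using that permutes_in_image[OF that(1), of i]
    by (auto simp: sylvester_def coeff_monom_mult)
  then show ?thesis
    unfolding res_def det_def'[OF sylvester_carrier]
    by (intro sum.cong arg_cong2[where f = "(*)"] prod.cong) auto
qed

lemma poly_fun_res:
  assumes "\<And>i. poly_fun (\<lambda>s. coeff (a s) i)" "\<And>i. poly_fun (\<lambda>s. coeff (b s) i)"
  shows "poly_fun (\<lambda>s. res d (a s) (b s))"
proof -
  have "poly_fun (\<lambda>s. if P then if Q then 0 else coeff (a s) m else if R then 0 else coeff (b s) n)"
    for P Q R m n
    using assms by (cases P; cases Q; cases R) auto
  then show ?thesis
    unfolding res_expansion by (intro poly_fun_sum poly_fun_mult poly_fun_prod poly_fun_const)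
qed

lemma homogeneous_on_zero: "homogeneous_on V k (\<lambda>_. 0)"
proof (induction k)
  case 0 show ?case by (rule homogeneous_on.const)
next
  case (Suc k)
  have "homogeneous_on V 1 (\<lambda>_. 0)" by (rule homogeneous_on.linear) auto
  from homogeneous_on.mult[OF this Suc] show ?case by simp
qed

lemma homogeneous_on_sum:
  assumes "\<And>i. i \<in> I \<Longrightarrow> homogeneous_on V k (F i)"
  shows "homogeneous_on V k (\<lambda>f. \<Sum>i\<in>I. F i f)"
  using assms
  by (induction I rule: infinite_finite_induct) (auto intro: homogeneous_on_zero homogeneous_on.add)

lemma homogeneous_on_prod:
  assumes "finite I" "\<And>i. i \<in> I \<Longrightarrow> homogeneous_on V 1 (F i)"
  shows "homogeneous_on V (card I) (\<lambda>f. \<Prod>i\<in>I. F i f)"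
  using assms
proof (induction I rule: finite_induct)
  case empty
  show ?case using homogeneous_on.const by simp
next
  case (insert x I)
  have "homogeneous_on V (1 + card I) (\<lambda>f. F x f * (\<Prod>i\<in>I. F i f))"
    by (rule homogeneous_on.mult) (use insert in auto)
  with insert(1,2) show ?case by simp
qed

lemma homogeneous_on_res:
  assumes "\<And>i. i \<le> d \<Longrightarrow> homogeneous_on V 1 (\<lambda>f. coeff (a f) i)"
    and "\<And>i. i \<le> d \<Longrightarrow> homogeneous_on V 1 (\<lambda>f. coeff (b f) i)"
    and deg: "\<And>f. degree (a f) \<le> d" "\<And>f. degree (b f) \<le> d"
  shows "homogeneous_on V (2 * d) (\<lambda>f. res d (a f) (b f))"
proof -
  have coef: "homogeneous_on V 1 (\<lambda>f. coeff (a f) i)" "homogeneous_on V 1 (\<lambda>f. coeff (b f) i)" for i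
  proof -
    have "(\<lambda>f. coeff (a f) i) = (\<lambda>_. 0)" "(\<lambda>f. coeff (b f) i) = (\<lambda>_. 0)" if "i > d"
      using deg that by (auto simp: fun_eq_iff intro!: coeff_eq_0 intro: le_less_trans)
    then show "homogeneous_on V 1 (\<lambda>f. coeff (a f) i)" "homogeneous_on V 1 (\<lambda>f. coeff (b f) i)"
      using assms(1,2)[of i] homogeneous_on_zero[of V 1] by (metis not_le_imp_less)+
  qed
  have entry: "homogeneous_on V 1 (\<lambda>f. if P then if Q then 0 else coeff (a f) m else if R then 0 else coeff (b f) n)"
    for P Q R m n
    using coef homogeneous_on_zero[of V 1] by (cases P; cases Q; cases R) auto
  have "homogeneous_on V (0 + card {0..<2 * d}) (\<lambda>f. signof p * (\<Prod>i\<in>{0..<2 * d}.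
     if p i < d then if i < p i then 0 else coeff (a f) (i - p i)
     else if i < p i - d then 0 else coeff (b f) (i - (p i - d))))" for p
    by (rule homogeneous_on.mult[OF homogeneous_on.const homogeneous_on_prod]) (rule finite_atLeastLessThan, rule entry)
  then show ?thesis unfolding res_expansion by (intro homogeneous_on_sum) simp
qed

section \<open>Interpolating the conjugation ratio\<close>

lemma lagrange_factor:
  "lagrange T c = smult (\<Prod>j\<in>T - {c}. 1 / (c - j)) (\<Prod>j\<in>T - {c}. [:- j, 1:])"
  unfolding lagrange_def by (rule prod_smult)

lemma coeff_lagrange_top:
  assumes "finite T" "c \<in> T"
  shows "coeff (lagrange T c) (card T - 1) = (\<Prod>j\<in>T - {c}. 1 / (c - j))"
proof -
  let ?N = "\<Prod>j\<in>T - {c}. [:- j, 1:] :: complex poly"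
  have "degree ?N = (\<Sum>j\<in>T - {c}. degree [:- j, 1:])" by (rule degree_prod_eq_sum_degree) auto
  then have "degree ?N = card T - 1" using assms by simp
  moreover have "lead_coeff ?N = 1" unfolding lead_coeff_prod by simp
  ultimately show ?thesis unfolding lagrange_factor by simp
qed

text \<open>The left-hand side of the hypothesis is a polynomial in \<open>\<tau>\<close> whose coefficients are the moments up to
  nonzero factors.\<close>

lemma moments_zero:
  fixes g :: "complex \<Rightarrow> complex"
  assumes "\<And>\<tau>. (\<Sum>c\<in>T. g c * (c - \<tau>) ^ m) = 0" and "k \<le> m"
  shows "(\<Sum>c\<in>T. g c * c ^ k) = 0"
proof -
  define a where "a i = of_nat (m choose i) * (- 1) ^ i * (\<Sum>c\<in>T. g c * c ^ (m - i))" for i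
  have "(\<Sum>i\<le>m. a i * \<tau> ^ i) = 0" for \<tau>
  proof -
    have "(c - \<tau>) ^ m = (\<Sum>i\<le>m. of_nat (m choose i) * (- \<tau>) ^ i * c ^ (m - i))" for c
      using binomial_ring[of "- \<tau>" c m] by simp
    then have "(\<Sum>c\<in>T. g c * (c - \<tau>) ^ m) = (\<Sum>c\<in>T. \<Sum>i\<le>m. of_nat (m choose i) * (- 1) ^ i * \<tau> ^ i * (g c * c ^ (m - i)))"
      by (simp add: sum_distrib_left power_minus[of \<tau>] mult_ac)
    also have "\<dots> = (\<Sum>i\<le>m. a i * \<tau> ^ i)"
      unfolding a_def by (subst sum.swap) (simp add: sum_distrib_left sum_distrib_right mult_ac)
    finally show ?thesis using assms(1) by simp
  qed
  then have "a (m - k) = 0" using polyfun_eq_0[of a m] by simp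
  then show ?thesis using assms(2) diff_le_self[of m k] by (auto simp: a_def)
qed

text \<open>The polynomial \<open>w\<close> of degree below \<open>card T\<close> with \<open>t * w t = cnj t * u t\<close> on \<open>T\<close>.\<close>

definition conj_interpolant :: "complex set \<Rightarrow> complex poly \<Rightarrow> complex poly"
  where "conj_interpolant T u = (\<Sum>c\<in>T. smult (cnj c / c * poly u c) (lagrange T c))"

lemma conj_interpolant:
  assumes "finite T" "T \<noteq> {}" "0 \<notin> T"
  shows "degree (conj_interpolant T u) < card T"
    and "t \<in> T \<Longrightarrow> t * poly (conj_interpolant T u) t = cnj t * poly u t"
proof -
  show "degree (conj_interpolant T u) < card T"
    unfolding conj_interpolant_def by (rule degree_lagrange_combination[OF assms(1,2)])
  assume "t \<in> T"
  then have "poly (conj_interpolant T u) t = cnj t / t * poly u t"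
    unfolding conj_interpolant_def by (rule poly_lagrange_combination[OF assms(1)])
  moreover have "t \<noteq> 0" using \<open>t \<in> T\<close> assms(3) by auto
  ultimately show "t * poly (conj_interpolant T u) t = cnj t * poly u t" by simp
qed

text \<open>For \<open>u = (t - \<tau>) ^ (d - 1)\<close> the only zero to be avoided is \<open>\<tau>\<close>. Lagrange's formula gives
  the top coefficient of \<open>w\<close> and its value at \<open>\<tau>\<close>, up to a nonzero factor, as \<open>\<Sum>\<rho> c * \<omega> c * (c - \<tau>) ^ m\<close>
  with \<open>\<rho> c = cnj c / c\<close> and \<open>m = d - 1\<close>, \<open>m = d - 2\<close>. If such a sum vanished for all \<open>\<tau>\<close>, the functional with
  weights \<open>\<rho> c * \<omega> c\<close> would kill all polynomials of degree at most \<open>d - 2\<close>. So does the one with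
  weights \<open>\<omega> c\<close>, and testing both on the polynomial with zeros \<open>T - {t1, t2}\<close> would force
  \<open>\<rho> t1 = \<rho> t2\<close>.\<close>

lemma ex_coprime_conj_interpolant:
  assumes T: "finite T" "card T = d" "d \<ge> 2" "0 \<notin> T"
    and t12: "t1 \<in> T" "t2 \<in> T" "t1 * cnj t2 \<noteq> cnj t1 * t2"
  shows "\<exists>u. degree u < d \<and> coeff (conj_interpolant T u) (d - 1) \<noteq> 0 \<and>
    (\<forall>t. poly u t = 0 \<longrightarrow> t * poly (conj_interpolant T u) t \<noteq> 0)"
proof -
  have Tne: "T \<noteq> {}" using t12 by auto
  define \<omega> where "\<omega> c = (\<Prod>j\<in>T - {c}. 1 / (c - j))" for c
  define \<rho> where "\<rho> c = cnj c / c" for c :: complex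
  have \<omega>: "coeff (lagrange T c) (d - 1) = \<omega> c" if "c \<in> T" for c
    using coeff_lagrange_top[OF T(1) that] T(2) by (simp add: \<omega>_def)
  have \<omega>0: "\<omega> c \<noteq> 0" for c unfolding \<omega>_def using T(1) by (simp add: prod_zero_iff)
  have res: "(\<Sum>c\<in>T. \<omega> c * poly p c) = 0" if "degree p < d - 1" for p
  proof -
    have "p = (\<Sum>c\<in>T. smult (poly p c) (lagrange T c))"
      using that T by (intro lagrange_interpolation[OF T(1) Tne]) auto
    then have "coeff p (d - 1) = coeff (\<Sum>c\<in>T. smult (poly p c) (lagrange T c)) (d - 1)" by metis
    also have "\<dots> = (\<Sum>c\<in>T. \<omega> c * poly p c)"
      unfolding coeff_sum by (intro sum.cong) (auto simp: \<omega>[unfolded One_nat_def])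
    finally show ?thesis using that by (simp add: coeff_eq_0)
  qed
  \<comment> \<open>The functional \<open>p \<mapsto> \<Sum> \<rho> c * \<omega> c * p c\<close> is nonzero on degree below \<open>d - 1\<close>, since \<open>\<rho>\<close> is
    not constant.\<close>
  have nz: "\<not> (\<forall>k\<le>d - 2. (\<Sum>c\<in>T. \<rho> c * \<omega> c * c ^ k) = 0)"
  proof
    assume z: "\<forall>k\<le>d - 2. (\<Sum>c\<in>T. \<rho> c * \<omega> c * c ^ k) = 0"
    have t0: "t1 \<noteq> 0" "t2 \<noteq> 0" "t1 \<noteq> t2" using t12 T(4) by auto
    define p where "p = (\<Prod>j\<in>T - {t1, t2}. [:- j, 1:] :: complex poly)"
    have "degree p = (\<Sum>j\<in>T - {t1, t2}. degree [:- j, 1:])"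
      unfolding p_def by (rule degree_prod_eq_sum_degree) auto
    also have "\<dots> = d - 2" using T t12 t0 by (simp add: card_Diff_subset)
    finally have deg: "degree p = d - 2" .
    have pz: "poly p c = 0 \<longleftrightarrow> c \<in> T - {t1, t2}" for c
      unfolding p_def poly_prod using T(1) by (simp add: prod_zero_iff)
    have split: "(\<Sum>c\<in>T. h c * poly p c) = h t1 * poly p t1 + h t2 * poly p t2" for h
    proof -
      have "(\<Sum>c\<in>T. h c * poly p c) = (\<Sum>c\<in>{t1, t2}. h c * poly p c)"
        by (rule sum.mono_neutral_right) (use T(1) t12 pz in auto)
      then show ?thesis using t0(3) by simp
    qed
    have "(\<Sum>c\<in>T. \<rho> c * \<omega> c * poly p c) = (\<Sum>c\<in>T. \<Sum>k\<le>d - 2. coeff p k * (\<rho> c * \<omega> c * c ^ k))"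
      using deg by (simp add: poly_altdef sum_distrib_left mult_ac)
    also have "\<dots> = (\<Sum>k\<le>d - 2. coeff p k * (\<Sum>c\<in>T. \<rho> c * \<omega> c * c ^ k))"
      by (subst sum.swap) (simp add: sum_distrib_left)
    finally have "\<rho> t1 * \<omega> t1 * poly p t1 + \<rho> t2 * \<omega> t2 * poly p t2 = 0"
      using z split[of "\<lambda>c. \<rho> c * \<omega> c"] by simp
    moreover have "\<omega> t1 * poly p t1 + \<omega> t2 * poly p t2 = 0"
      using res[of p] split[of \<omega>] deg T(3) by simp
    moreover have "(\<rho> t1 - \<rho> t2) * (\<omega> t1 * poly p t1) = \<rho> t1 * \<omega> t1 * poly p t1
        + \<rho> t2 * \<omega> t2 * poly p t2 - \<rho> t2 * (\<omega> t1 * poly p t1 + \<omega> t2 * poly p t2)"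
      by (simp add: algebra_simps)
    ultimately have "(\<rho> t1 - \<rho> t2) * (\<omega> t1 * poly p t1) = 0" by simp
    then have "\<rho> t1 = \<rho> t2" using \<omega>0 pz by auto
    then show False using t12(3) t0 by (simp add: \<rho>_def field_simps)
  qed
  define M where "M m \<tau> = (\<Sum>c\<in>T. \<rho> c * \<omega> c * (c - \<tau>) ^ m)" for m \<tau>
  have fin: "finite {\<tau>. M m \<tau> = 0}" if "d - 2 \<le> m" for m
  proof -
    have "\<not> (\<forall>\<tau>. M m \<tau> = 0)"
    proof
      assume "\<forall>\<tau>. M m \<tau> = 0"
      then have "(\<Sum>c\<in>T. \<rho> c * \<omega> c * c ^ k) = 0" if "k \<le> d - 2" for k
        using moments_zero[where g = "\<lambda>c. \<rho> c * \<omega> c" and T = T and m = m and k = k] that \<open>d - 2 \<le> m\<close> by (simp add: M_def)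
      with nz show False by blast
    qed
    moreover have "poly_fun (M m)" unfolding M_def
      by (intro poly_fun_sum poly_fun_mult poly_fun_const poly_fun_power poly_fun_diff poly_fun_id)
    ultimately show ?thesis using poly_fun_zeros_finite by blast
  qed
  have "finite (T \<union> {0} \<union> {\<tau>. M (d - 2) \<tau> = 0} \<union> {\<tau>. M (d - 1) \<tau> = 0})"
    using T(1) fin by simp
  from ex_new_if_finite[OF infinite_UNIV_char_0 this] obtain \<tau> where
    \<tau>: "\<tau> \<notin> T" "\<tau> \<noteq> 0" "M (d - 2) \<tau> \<noteq> 0" "M (d - 1) \<tau> \<noteq> 0" by auto
  define u where "u = [:- \<tau>, 1:] ^ (d - 1)"
  have pu: "poly u t = (t - \<tau>) ^ (d - 1)" for t by (simp add: u_def poly_power)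
  have "degree u < d" using T(3) by (simp add: u_def degree_power_eq)
  moreover have "coeff (conj_interpolant T u) (d - 1) = M (d - 1) \<tau>"
    unfolding conj_interpolant_def coeff_sum M_def
    by (intro sum.cong) (auto simp: \<omega>[unfolded One_nat_def] pu \<rho>_def mult_ac)
  moreover have "poly (conj_interpolant T u) \<tau> = - (\<Prod>j\<in>T. \<tau> - j) * M (d - 2) \<tau>"
  proof -
    have "cnj c / c * poly u c * poly (lagrange T c) \<tau> = - (\<Prod>j\<in>T. \<tau> - j) * (\<rho> c * \<omega> c * (c - \<tau>) ^ (d - 2))"
      if "c \<in> T" for c
    proof -
      have a: "poly (lagrange T c) \<tau> = \<omega> c * (\<Prod>j\<in>T - {c}. \<tau> - j)"
        unfolding lagrange_factor \<omega>_def by (simp add: poly_prod)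
      have b: "(\<Prod>j\<in>T. \<tau> - j) = (\<tau> - c) * (\<Prod>j\<in>T - {c}. \<tau> - j)"
        using prod.remove[OF T(1) that] by simp
      have c: "(c - \<tau>) ^ (d - 1) = (c - \<tau>) * (c - \<tau>) ^ (d - 2)"
        using T(3) by (metis Suc_1 Suc_diff_Suc Suc_le_lessD power_Suc Suc_diff_1 diff_Suc_1 le_trans lessI less_imp_le_nat)
      show ?thesis unfolding a b pu c \<rho>_def by (simp add: algebra_simps)
    qed
    then show ?thesis
      unfolding conj_interpolant_def poly_sum M_def sum_distrib_left by (intro sum.cong) auto
  qed
  ultimately show ?thesis
    using \<tau> T(1) pu by (intro exI[of _ u]) (auto simp: prod_zero_iff)
qed

section \<open>Bihomogeneous polynomials and the cross product\<close>

abbreviation bipoly :: "nat \<Rightarrow> nat \<Rightarrow> ((3 \<Rightarrow> nat) \<Rightarrow> (3 \<Rightarrow> nat) \<Rightarrow> complex) \<Rightarrow> complex^3 \<Rightarrow> complex^3 \<Rightarrow> complex"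
  where "bipoly a b c x y \<equiv> (\<Sum>\<alpha> | sum \<alpha> UNIV = a. \<Sum>\<beta> | sum \<beta> UNIV = b.
    c \<alpha> \<beta> * (\<Prod>i\<in>UNIV. x $ i ^ \<alpha> i) * (\<Prod>i\<in>UNIV. y $ i ^ \<beta> i))"

lemma bihomogeneous_scale:
  assumes "bihomogeneous a b P"
  shows "P (s *s x, t *s y) = s ^ a * t ^ b * P (x, y)"
proof -
  obtain c where c: "\<And>x y. P (x, y) = bipoly a b c x y"
    using assms unfolding bihomogeneous_def by blast
  have "(\<Prod>i\<in>UNIV. (r *s z) $ i ^ \<gamma> i) = r ^ n * (\<Prod>i\<in>UNIV. z $ i ^ \<gamma> i)"
    if "sum \<gamma> UNIV = n" for r and z :: "complex^3" and \<gamma> n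
    using that by (auto simp: power_mult_distrib prod.distrib power_sum)
  then show ?thesis
    unfolding c sum_distrib_left by (intro sum.cong refl) (simp add: mult_ac)
qed

lemma bihomogeneous_continuous:
  assumes "bihomogeneous a b P"
  shows "continuous_on A P"
proof -
  obtain c where c: "\<And>x y. P (x, y) = bipoly a b c x y"
    using assms unfolding bihomogeneous_def by blast
  have "P = (\<lambda>z. \<Sum>\<alpha> | sum \<alpha> UNIV = a. \<Sum>\<beta> | sum \<beta> UNIV = b.
        c \<alpha> \<beta> * (\<Prod>i\<in>UNIV. fst z $ i ^ \<alpha> i) * (\<Prod>i\<in>UNIV. snd z $ i ^ \<beta> i))"
    using c by (auto simp: fun_eq_iff)
  then show ?thesis by (simp add: continuous_intros)
qed

definition poly_curve :: "(complex \<Rightarrow> complex^3) \<Rightarrow> bool"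
  where "poly_curve \<gamma> \<longleftrightarrow> (\<forall>i. poly_fun (\<lambda>u. \<gamma> u $ i))"

lemma poly_curve_const [intro]: "poly_curve (\<lambda>u. x)"
  unfolding poly_curve_def by auto

lemma poly_curve_add [intro]: "poly_curve f \<Longrightarrow> poly_curve g \<Longrightarrow> poly_curve (\<lambda>u. f u + g u)"
  unfolding poly_curve_def by auto

lemma poly_curve_scale [intro]: "poly_fun f \<Longrightarrow> poly_curve g \<Longrightarrow> poly_curve (\<lambda>u. f u *s g u)"
  unfolding poly_curve_def by auto

lemma bihomogeneous_poly_curve:
  assumes "bihomogeneous a b P" "poly_curve \<gamma>" "poly_curve \<delta>"
  shows "poly_fun (\<lambda>u. P (\<gamma> u, \<delta> u))"
proof -
  obtain c where c: "\<And>x y. P (x, y) = bipoly a b c x y"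
    using assms(1) unfolding bihomogeneous_def by blast
  show ?thesis
    using assms(2,3) unfolding c poly_curve_def
    by (intro poly_fun_sum poly_fun_mult poly_fun_prod poly_fun_power poly_fun_const) auto
qed

lemma dot3_expand: "dot3 x y = x $ 1 * y $ 1 + x $ 2 * y $ 2 + x $ 3 * y $ 3"
  unfolding dot3_def by (simp add: sum_3)

definition cross :: "complex^3 \<Rightarrow> complex^3 \<Rightarrow> complex^3"
  where "cross x y = vector [x $ 2 * y $ 3 - x $ 3 * y $ 2, x $ 3 * y $ 1 - x $ 1 * y $ 3, x $ 1 * y $ 2 - x $ 2 * y $ 1]"

lemma cross_nth [simp]:
  "cross x y $ 1 = x $ 2 * y $ 3 - x $ 3 * y $ 2"
  "cross x y $ 2 = x $ 3 * y $ 1 - x $ 1 * y $ 3"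
  "cross x y $ 3 = x $ 1 * y $ 2 - x $ 2 * y $ 1"
  unfolding cross_def by simp_all

lemma vec3_eq_iff: "(x :: complex^3) = y \<longleftrightarrow> x $ 1 = y $ 1 \<and> x $ 2 = y $ 2 \<and> x $ 3 = y $ 3"
  by (simp add: Finite_Cartesian_Product.vec_eq_iff forall_3)

lemma dot3_commute: "dot3 x y = dot3 y x"
  by (simp add: dot3_expand mult.commute)

lemma dot3_linear [simp]:
  "dot3 (x + x') y = dot3 x y + dot3 x' y" "dot3 x (y + y') = dot3 x y + dot3 x y'"
  "dot3 (c *s x) y = c * dot3 x y" "dot3 x (c *s y) = c * dot3 x y"
  "dot3 0 y = 0" "dot3 x 0 = 0"
  by (simp_all add: dot3_expand algebra_simps)

lemma dot3_cross [simp]: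
  "dot3 x (cross x y) = 0" "dot3 y (cross x y) = 0" "dot3 (cross x y) x = 0" "dot3 (cross x y) y = 0"
  by (simp_all add: dot3_expand algebra_simps)

lemma cross_cross: "cross x (cross y w) = dot3 x w *s y - dot3 x y *s w"
  by (simp add: vec3_eq_iff dot3_expand algebra_simps)

lemma cross_zero_imp:
  assumes "cross x v = 0" "v \<noteq> 0"
  shows "\<exists>c. x = c *s v"
proof -
  have e: "x $ 2 * v $ 3 = x $ 3 * v $ 2" "x $ 3 * v $ 1 = x $ 1 * v $ 3" "x $ 1 * v $ 2 = x $ 2 * v $ 1"
    using assms(1) by (auto simp: vec3_eq_iff)
  from assms(2) consider "v $ 1 \<noteq> 0" | "v $ 2 \<noteq> 0" | "v $ 3 \<noteq> 0" by (auto simp: vec3_eq_iff)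
  then show ?thesis
  proof cases
    case 1 then show ?thesis using e by (intro exI[of _ "x $ 1 / v $ 1"]) (auto simp: vec3_eq_iff field_simps)
  next
    case 2 then show ?thesis using e by (intro exI[of _ "x $ 2 / v $ 2"]) (auto simp: vec3_eq_iff field_simps)
  next
    case 3 then show ?thesis using e by (intro exI[of _ "x $ 3 / v $ 3"]) (auto simp: vec3_eq_iff field_simps)
  qed
qed

lemma orthogonal_to_both:
  assumes "dot3 x y = 0" "dot3 x w = 0" "cross y w \<noteq> 0"
  shows "\<exists>c. x = c *s cross y w"
  using cross_zero_imp[of x "cross y w"] assms by (simp add: cross_cross)

lemma cnj3_nth [simp]: "cnj3 x $ i = cnj (x $ i)"
  by (simp add: cnj3_def)

lemma dot3_cnj3_eq_0: "dot3 x (cnj3 x) = 0 \<longleftrightarrow> x = 0"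
proof
  assume "dot3 x (cnj3 x) = 0"
  then have "complex_of_real ((cmod (x $ 1))\<^sup>2 + (cmod (x $ 2))\<^sup>2 + (cmod (x $ 3))\<^sup>2) = 0"
    unfolding dot3_expand by (simp add: complex_norm_square[symmetric] del: of_real_power)
  then have "(cmod (x $ 1))\<^sup>2 + (cmod (x $ 2))\<^sup>2 + (cmod (x $ 3))\<^sup>2 = 0" using of_real_eq_0_iff by blast
  then have "x $ 1 = 0 \<and> x $ 2 = 0 \<and> x $ 3 = 0"
    by (smt (verit) norm_eq_zero zero_le_power2 zero_eq_power2)
  then show "x = 0" by (simp add: vec3_eq_iff)
qed simp

text \<open>The preimage is \<open>y \<times> cnj x\<close> up to a factor, by the identity for the double cross product.\<close>

lemma ex_cross_preimage:
  assumes "dot3 x y = 0" "x \<noteq> 0"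
  shows "\<exists>z. y = cross x z"
proof -
  have n: "dot3 x (cnj3 x) \<noteq> 0" using assms(2) by (simp add: dot3_cnj3_eq_0)
  have "cross x (cross y (cnj3 x)) = dot3 x (cnj3 x) *s y" by (simp add: cross_cross assms(1))
  then have "y = cross x (inverse (dot3 x (cnj3 x)) *s cross y (cnj3 x))"
    using n by (simp add: vec3_eq_iff algebra_simps field_simps)
  then show ?thesis by blast
qed

lemma poly_curve_cross [intro]: "poly_curve f \<Longrightarrow> poly_curve g \<Longrightarrow> poly_curve (\<lambda>u. cross (f u) (g u))"
  unfolding poly_curve_def by (auto simp: forall_3)

lemma poly_fun_dot3 [intro]: "poly_curve f \<Longrightarrow> poly_curve g \<Longrightarrow> poly_fun (\<lambda>u. dot3 (f u) (g u))"
  unfolding poly_curve_def dot3_expand by (intro poly_fun_add poly_fun_mult) auto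

lemma continuous_on_vector3:
  fixes f :: "'a::topological_space \<Rightarrow> complex^3"
  assumes "\<And>i. continuous_on A (\<lambda>z. f z $ i)"
  shows "continuous_on A f"
  using continuous_on_vec_lambda[of A "\<lambda>i z. f z $ i"] assms by simp

lemma continuous_on_cross [continuous_intros]:
  assumes "continuous_on A f" "continuous_on A g"
  shows "continuous_on A (\<lambda>z. cross (f z) (g z))"
proof (rule continuous_on_vector3)
  have "\<forall>i. continuous_on A (\<lambda>z. cross (f z) (g z) $ i)"
    unfolding forall_3 using assms by (auto intro!: continuous_intros)
  then show "continuous_on A (\<lambda>z. cross (f z) (g z) $ i)" for i by blast
qed

lemma continuous_on_dot3 [continuous_intros]:
  "continuous_on A f \<Longrightarrow> continuous_on A g \<Longrightarrow> continuous_on A (\<lambda>z. dot3 (f z) (g z))"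
  unfolding dot3_expand by (intro continuous_intros)

lemma continuous_on_scale3 [continuous_intros]:
  fixes g :: "'a::topological_space \<Rightarrow> complex^3"
  assumes "continuous_on A f" "continuous_on A g"
  shows "continuous_on A (\<lambda>z. f z *s g z)"
  by (rule continuous_on_vector3) (use assms in \<open>auto intro!: continuous_intros\<close>)

lemma continuous_on_cnj3 [continuous_intros]:
  "continuous_on A f \<Longrightarrow> continuous_on A (\<lambda>z. cnj3 (f z))"
  by (rule continuous_on_vector3) (auto intro!: continuous_intros)

section \<open>Irreducibility of surfaces that are generically a section over the plane\<close>

text \<open>Two points of the line through \<open>y\<close> in direction \<open>b\<close> are never proportional, so each line \<open>k\<close>
  accounts for at most one parameter.\<close>

lemma line_leaves_finitely_many_lines:
  assumes "finite K" "0 \<notin> K" "cross y b \<noteq> 0" "(e::real) > 0"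
  shows "\<exists>s. cmod s < e \<and> \<not> (\<exists>k\<in>K. \<exists>c. y + s *s b = c *s k)"
proof (rule ccontr)
  assume "\<not> ?thesis"
  then obtain k where k: "\<And>s. cmod s < e \<Longrightarrow> k s \<in> K \<and> (\<exists>c. y + s *s b = c *s k s)" by metis
  let ?D = "ball 0 e :: complex set"
  have inf: "infinite ?D" using uncountable_ball[OF assms(4)] uncountable_infinite by blast
  have "finite (k ` ?D)" by (rule finite_subset[OF _ assms(1)]) (use k in auto)
  then have "\<not> inj_on k ?D" using inf finite_imageD by blast
  then obtain s s' where s: "cmod s < e" "cmod s' < e" "s \<noteq> s'" "k s = k s'"
    unfolding inj_on_def by auto
  from k[OF s(1)] k[OF s(2)] s(4) obtain c c' where "y + s *s b = c *s k s" "y + s' *s b = c' *s k s" by auto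
  then have "cross (y + s *s b) (y + s' *s b) = 0" by (simp add: vec3_eq_iff)
  moreover have "cross (y + s *s b) (y + s' *s b) = (s' - s) *s cross y b"
    by (simp add: vec3_eq_iff algebra_simps)
  ultimately show False using s(3) assms(3) by simp
qed

text \<open>A vector \<open>(1, r, r\<^sup>2)\<close> on the moment curve is orthogonal to a given nonzero vector for at most two
  values of \<open>r\<close>.\<close>

lemma ex_not_orthogonal:
  assumes "finite K" "0 \<notin> K"
  shows "\<exists>a. \<forall>k\<in>K. dot3 a k \<noteq> 0"
proof -
  define a :: "complex \<Rightarrow> complex^3" where "a r = vector [1, r, r ^ 2]" for r
  have fin: "finite {r. dot3 (a r) k = 0}" if "k \<in> K" for k
  proof -
    let ?p = "[:k $ 1, k $ 2, k $ 3:]"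
    have "?p \<noteq> 0"
    proof
      assume "?p = 0"
      then have "k = 0" by (simp add: vec3_eq_iff)
      with that assms(2) show False by simp
    qed
    moreover have "dot3 (a r) k = poly ?p r" for r
      by (simp add: a_def dot3_expand algebra_simps power2_eq_square)
    ultimately show ?thesis using poly_roots_finite[of ?p] by simp
  qed
  then have "finite (\<Union>k\<in>K. {r. dot3 (a r) k = 0})" using assms(1) by auto
  then obtain r where "r \<notin> (\<Union>k\<in>K. {r. dot3 (a r) k = 0})"
    using ex_new_if_finite[OF infinite_UNIV_char_0[where 'a=complex]] by blast
  then show ?thesis by blast
qed

text \<open>Hurwitz' theorem in the form used below: if \<open>F (u, _)\<close> has no zero near \<open>0\<close> for a sequence of \<open>u\<close>
  that tends to \<open>0\<close>, then \<open>F (0, _)\<close>, which has the zero \<open>0\<close>, is constant there,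
  hence zero.\<close>

lemma root_persists:
  fixes F :: "complex \<times> complex \<Rightarrow> complex"
  assumes cont: "continuous_on UNIV F" and hol: "\<And>u. (\<lambda>s. F (u, s)) holomorphic_on UNIV"
    and "F (0, 0) = 0" and e: "e > 0" and U: "\<And>n::nat. U n \<in> cball 0 1" "U \<longlonglongrightarrow> 0"
    and nz: "\<And>n s. cmod s < e \<Longrightarrow> F (U n, s) \<noteq> 0"
  shows "\<forall>s. cmod s < e \<longrightarrow> F (0, s) = 0"
proof (rule ccontr)
  assume neg: "\<not> ?thesis"
  have "(\<lambda>s. F (0, s)) 0 \<noteq> 0"
  proof (rule Hurwitz_no_zeros[of "ball 0 e" "\<lambda>n s. F (U n, s)" "\<lambda>s. F (0, s)" 0])
    show "\<not> (\<lambda>s. F (0, s)) constant_on ball 0 e"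
      using neg assms(3) e unfolding constant_on_def by (metis centre_in_ball mem_ball_0)
    show "uniform_limit K (\<lambda>n s. F (U n, s)) (\<lambda>s. F (0, s)) sequentially" if "compact K" "K \<subseteq> ball 0 e" for K
    proof (rule uniform_limitI)
      fix \<epsilon> :: real assume "\<epsilon> > 0"
      have "uniformly_continuous_on (cball 0 1 \<times> K) F"
        by (rule compact_uniformly_continuous[OF continuous_on_subset[OF cont]])
           (auto intro: compact_Times that)
      then obtain \<delta> where \<delta>: "\<delta> > 0" "\<And>z z'. z \<in> cball 0 1 \<times> K \<Longrightarrow> z' \<in> cball 0 1 \<times> K \<Longrightarrow> dist z' z < \<delta> \<Longrightarrow> dist (F z') (F z) < \<epsilon>"
        unfolding uniformly_continuous_on_def using \<open>\<epsilon> > 0\<close> by metis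
      have "\<forall>\<^sub>F n in sequentially. dist (U n) 0 < \<delta>" using U(2) \<delta>(1) by (rule tendstoD)
      then show "\<forall>\<^sub>F n in sequentially. \<forall>s\<in>K. dist (F (U n, s)) (F (0, s)) < \<epsilon>"
        by eventually_elim (use U(1) in \<open>auto intro!: \<delta>(2) simp: dist_Pair_Pair\<close>)
    qed
  qed (use e nz in \<open>auto intro!: holomorphic_on_subset[OF hol]\<close>)
  with assms(3) show False by simp
qed

definition poly_map :: "(complex^3 \<Rightarrow> complex^3) \<Rightarrow> bool"
  where "poly_map w \<longleftrightarrow> continuous_on UNIV w \<and> (\<forall>\<gamma>. poly_curve \<gamma> \<longrightarrow> poly_curve (\<lambda>u. w (\<gamma> u)))"

text \<open>The surface \<open>x \<bottom> y\<close>, \<open>x \<bottom> w y\<close> is the closure of the graph of \<open>v y = y \<times> w y\<close> over the points where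
  \<open>v\<close> does not vanish. The hypothesis on \<open>K\<close> says that \<open>v\<close> vanishes at finitely many points of
  the projective plane only.\<close>

lemma zero_product_on_surface:
  assumes w: "poly_map w" and K: "finite K" "0 \<notin> K"
      "\<And>y. y \<noteq> 0 \<Longrightarrow> cross y (w y) = 0 \<Longrightarrow> \<exists>k\<in>K. \<exists>c. y = c *s k"
    and P: "bihomogeneous a b P" and Q: "bihomogeneous a' b' Q"
    and PQ: "\<And>x y. (x, y) \<in> flag_cone \<Longrightarrow> dot3 x (w y) = 0 \<Longrightarrow> P (x, y) * Q (x, y) = 0"
  shows "(\<forall>x y. (x, y) \<in> flag_cone \<longrightarrow> dot3 x (w y) = 0 \<longrightarrow> P (x, y) = 0) \<or>
    (\<forall>x y. (x, y) \<in> flag_cone \<longrightarrow> dot3 x (w y) = 0 \<longrightarrow> Q (x, y) = 0)"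
proof -
  define v where "v y = cross y (w y)" for y
  have wc: "continuous_on UNIV w" and wp: "\<And>\<gamma>. poly_curve \<gamma> \<Longrightarrow> poly_curve (\<lambda>u. w (\<gamma> u))"
    using w unfolding poly_map_def by auto
  have wcc: "continuous_on A (\<lambda>z. w (g z))" if "continuous_on A g" for A and g :: "complex \<times> complex \<Rightarrow> complex^3"
    using continuous_on_compose2[OF wc that] by simp
  have vp: "poly_curve (\<lambda>u. v (\<gamma> u))" if "poly_curve \<gamma>" for \<gamma>
    unfolding v_def using that wp by auto
  have vK: "\<exists>k\<in>K. \<exists>c. y = c *s k" if "y \<noteq> 0" "v y = 0" for y
    using K(3) that unfolding v_def by blast
  have onS: "P (v y, y) * Q (v y, y) = 0" if "v y \<noteq> 0" for y
  proof (rule PQ)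
    have "y \<noteq> 0" using that by (auto simp: v_def vec3_eq_iff)
    then show "(v y, y) \<in> flag_cone" using that by (simp add: flag_cone_def) (simp add: v_def)
  qed (simp add: v_def)
  \<comment> \<open>\<open>v\<close> does not vanish identically, so a product of two polynomials that vanishes where
    \<open>v \<noteq> 0\<close> vanishes everywhere; on a line, one factor vanishes.\<close>
  obtain y0 where y0: "v y0 \<noteq> 0"
  proof -
    have "cross (axis 1 1) (axis 2 1 :: complex^3) \<noteq> 0" by (simp add: vec3_eq_iff axis_def)
    from line_leaves_finitely_many_lines[OF K(1,2) this, of 1] obtain s where
      s: "\<not> (\<exists>k\<in>K. \<exists>c. axis 1 1 + s *s axis 2 (1::complex) = c *s k)" by auto
    have "axis 1 1 + s *s axis 2 (1::complex) \<noteq> (0 :: complex^3)" by (simp add: vec3_eq_iff axis_def)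
    with s vK show ?thesis using that by blast
  qed
  then obtain i where i: "v y0 $ i \<noteq> 0" by (auto simp: Finite_Cartesian_Product.vec_eq_iff)
  have alt: "(\<forall>y. v y \<noteq> 0 \<longrightarrow> P (v y, y) = 0) \<or> (\<forall>y. v y \<noteq> 0 \<longrightarrow> Q (v y, y) = 0)"
  proof (rule ccontr)
    assume "\<not> ?thesis"
    then obtain y1 y2 where y1: "v y1 \<noteq> 0" "P (v y1, y1) \<noteq> 0" and y2: "v y2 \<noteq> 0" "Q (v y2, y2) \<noteq> 0" by blast
    from y1(1) obtain j where j: "v y1 $ j \<noteq> 0" by (auto simp: Finite_Cartesian_Product.vec_eq_iff)
    define \<gamma> where "\<gamma> u = y1 + u *s (y2 + (- 1) *s y1)" for u
    have \<gamma>: "poly_curve \<gamma>" unfolding \<gamma>_def by (intro poly_curve_add poly_curve_scale poly_curve_const poly_fun_id)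
    have e: "\<gamma> 0 = y1" "\<gamma> 1 = y2" by (simp_all add: \<gamma>_def vec3_eq_iff)
    have f: "poly_fun (\<lambda>u. v (\<gamma> u) $ j * P (v (\<gamma> u), \<gamma> u))" "poly_fun (\<lambda>u. Q (v (\<gamma> u), \<gamma> u))"
      using bihomogeneous_poly_curve[OF P vp[OF \<gamma>] \<gamma>] bihomogeneous_poly_curve[OF Q vp[OF \<gamma>] \<gamma>] vp[OF \<gamma>]
      unfolding poly_curve_def by auto
    have "(v (\<gamma> u) $ j * P (v (\<gamma> u), \<gamma> u)) * Q (v (\<gamma> u), \<gamma> u) = 0" for u
      using onS[of "\<gamma> u"] by (cases "v (\<gamma> u) = 0") auto
    from poly_fun_integral_domain[OF f this]
    show False using e j y1 y2 by (metis mult_eq_0_iff)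
  qed
  \<comment> \<open>Over the finitely many points with \<open>v = 0\<close> the whole fiber lies on the surface; its points
    are limits of points over \<open>v \<noteq> 0\<close>.\<close>
  have closure: "R (x, y) = 0"
    if R: "bihomogeneous a b R" and R0: "\<And>y. v y \<noteq> 0 \<Longrightarrow> R (v y, y) = 0"
      and xy: "(x, y) \<in> flag_cone" "dot3 x (w y) = 0" for R a b x y
  proof -
    have gen: "R (x, y) = 0" if "(x, y) \<in> flag_cone" "dot3 x (w y) = 0" "v y \<noteq> 0" for x y
    proof -
      from that obtain c where "x = c *s v y"
        using orthogonal_to_both[of x y "w y"] unfolding v_def flag_cone_def by auto
      then have "R (x, y) = c ^ a * 1 ^ b * R (v y, y)" using bihomogeneous_scale[OF R, of c "v y" 1 y] by simp
      with R0 that show ?thesis by simp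
    qed
    show ?thesis
    proof (rule ccontr)
      assume neg: "R (x, y) \<noteq> 0"
      have xy': "x \<noteq> 0" "y \<noteq> 0" "dot3 x y = 0" using xy(1) by (auto simp: flag_cone_def)
      \<comment> \<open>Move \<open>x\<close> in a direction \<open>aa\<close> such that the line orthogonal to \<open>X\<close> avoids \<open>K\<close> for
        small \<open>u \<noteq> 0\<close>; \<open>Y\<close> parametrizes that line near \<open>y\<close>.\<close>
      obtain z where z: "y = cross x z" using ex_cross_preimage[OF xy'(3,1)] by blast
      obtain aa where aa: "\<And>k. k \<in> K \<Longrightarrow> dot3 aa k \<noteq> 0" using ex_not_orthogonal[OF K(1,2)] by blast
      define z' where "z' = cnj3 y"
      define X where "X p = x + fst p *s aa" for p :: "complex \<times> complex"
      define Y where "Y p = cross (X p) (z + snd p *s z')" for p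
      have cX: "continuous_on UNIV X" and cY: "continuous_on UNIV Y"
        unfolding X_def Y_def by (auto intro!: continuous_intros)
      have X0: "X (0, s) = x" for s by (simp add: X_def)
      have Y00: "Y (0, 0) = y" by (simp add: Y_def X0 z)
      have XY: "dot3 (X p) (Y p) = 0" for p by (simp add: Y_def)
      define good where "good = {p. R (X p, Y p) \<noteq> 0} \<inter> {p. X p \<noteq> 0} \<inter> {p. Y p \<noteq> 0}"
      have "open good" unfolding good_def
      proof (intro open_Int)
        have "continuous_on UNIV (\<lambda>p. R (X p, Y p))"
          using continuous_on_compose2[OF bihomogeneous_continuous[OF R, of UNIV] continuous_on_Pair[OF cX cY]] by simp
        then show "open {p. R (X p, Y p) \<noteq> 0}" by (intro open_Collect_neq continuous_intros)
        show "open {p. X p \<noteq> 0}" "open {p. Y p \<noteq> 0}" using cX cY by (auto intro!: open_Collect_neq continuous_intros)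
      qed
      moreover have "(0, 0) \<in> good" using neg xy' by (simp add: good_def X0 Y00)
      ultimately obtain e0 where e0: "e0 > 0" "ball (0, 0) e0 \<subseteq> good" by (meson openE)
      define e where "e = min (e0 / 2) 1"
      have e: "e > 0" "e \<le> 1" "2 * e \<le> e0" using e0 by (auto simp: e_def)
      have eg: "(u, s) \<in> good" if "cmod u < e" "cmod s < e" for u s
      proof -
        have "dist (0, 0) (u, s) \<le> cmod u + cmod s"
          using norm_Pair_le[of u s] by (simp add: dist_norm dist_Pair_Pair norm_Pair norm_minus_commute)
        then show ?thesis using that e e0 by (intro subsetD[OF e0(2)]) auto
      qed
      define F where "F p = dot3 (X p) (w (Y p))" for p
      have F0: "F p \<noteq> 0" if "p \<in> good" "v (Y p) \<noteq> 0" for p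
        using gen[of "X p" "Y p"] that XY[of p] unfolding F_def good_def flag_cone_def by auto
      have "finite {u. \<exists>k\<in>K. dot3 (x + u *s aa) k = 0}"
      proof -
        have "u = - dot3 x k / dot3 aa k" if "k \<in> K" "dot3 (x + u *s aa) k = 0" for u k
          using aa[OF that(1)] that(2) by (simp add: field_simps eq_neg_iff_add_eq_0)
        then have "{u. \<exists>k\<in>K. dot3 (x + u *s aa) k = 0} \<subseteq> (\<lambda>k. - dot3 x k / dot3 aa k) ` K"
          by blast
        then show ?thesis using finite_subset K(1) by blast
      qed
      from finite_set_avoid[OF this, of 0] obtain \<delta> where \<delta>: "\<delta> > 0"
        "\<And>u k. k \<in> K \<Longrightarrow> dot3 (x + u *s aa) k = 0 \<Longrightarrow> u \<noteq> 0 \<Longrightarrow> \<delta> \<le> cmod u" by (auto simp: dist_norm)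
      define r where "r = min \<delta> e / 2"
      have r: "r > 0" "r < \<delta>" "r < e" using \<delta> e by (auto simp: r_def min_def)
      define U where "U n = complex_of_real (r / (1 + real n))" for n
      have Un: "cmod (U n) \<le> r" "U n \<noteq> 0" for n
      proof -
        have "cmod (U n) = r / (1 + real n)" unfolding U_def norm_of_real using r(1) by simp
        moreover have "r / (1 + real n) \<le> r" "0 < r / (1 + real n)" using r(1) by (simp_all add: field_simps)
        ultimately show "cmod (U n) \<le> r" "U n \<noteq> 0" by auto
      qed
      have "\<forall>s. cmod s < e \<longrightarrow> F (0, s) = 0"
      proof (rule root_persists[of F e U])
        show "continuous_on UNIV F" unfolding F_def by (intro continuous_intros wcc cX cY)
        show "(\<lambda>s. F (u, s)) holomorphic_on UNIV" for u
        proof (rule poly_fun_holomorphic)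
          have "poly_curve (\<lambda>s. Y (u, s))" unfolding Y_def X_def fst_conv snd_conv
            by (intro poly_curve_cross poly_curve_const poly_curve_add poly_curve_scale poly_fun_id)
          then show "poly_fun (\<lambda>s. F (u, s))" unfolding F_def X_def fst_conv
            by (intro poly_fun_dot3 poly_curve_const wp)
        qed
        show "F (0, 0) = 0" using xy(2) by (simp add: F_def X0 Y00)
        show "U n \<in> cball 0 1" for n using Un[of n] r e by (simp add: order_trans)
        have "(\<lambda>n. r / (1 + real n)) \<longlonglongrightarrow> 0" by real_asymp
        then show "U \<longlonglongrightarrow> 0" unfolding U_def using tendsto_of_real[where 'a = complex] of_real_0 by metis
        fix n s assume s: "cmod s < e"
        have g: "(U n, s) \<in> good" using eg s Un(1)[of n] r by auto
        have "v (Y (U n, s)) \<noteq> 0"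
        proof
          assume "v (Y (U n, s)) = 0"
          then obtain k c where k: "k \<in> K" "Y (U n, s) = c *s k" using vK g unfolding good_def by blast
          then have "c \<noteq> 0" using g unfolding good_def by auto
          then have "dot3 (x + U n *s aa) k = 0" using XY[of "(U n, s)"] k by (simp add: X_def)
          from \<delta>(2)[OF k(1) this] Un[of n] r show False by auto
        qed
        then show "F (U n, s) \<noteq> 0" using F0 g by blast
      qed (rule e)
      \<comment> \<open>So the whole line orthogonal to \<open>x\<close> lies on the surface near \<open>y\<close>. As \<open>R\<close> does not vanish
        there, \<open>v\<close> does; but \<open>K\<close> contains only finitely many points of the line.\<close>
      then have vY: "v (Y (0, s)) = 0" if "cmod s < e" for s
        using F0[of "(0, s)"] eg[of 0 s] that e(1) norm_zero[where 'a = complex] by metis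
      have Y0s: "Y (0, s) = y + s *s cross x z'" for s
      proof -
        have "Y (0, s) = cross x (z + s *s z')" by (simp add: Y_def X0)
        also have "\<dots> = cross x z + s *s cross x z'" by (simp add: vec3_eq_iff algebra_simps)
        finally show ?thesis unfolding z .
      qed
      have "cross y (cross x z') \<noteq> 0"
      proof -
        have "dot3 y x = 0" using xy'(3) dot3_commute[of x y] by metis
        moreover have "dot3 y z' \<noteq> 0" unfolding z'_def dot3_cnj3_eq_0 by (rule xy'(2))
        ultimately show ?thesis using xy'(1) unfolding cross_cross by simp
      qed
      from line_leaves_finitely_many_lines[OF K(1,2) this e(1)] obtain s where
        s: "cmod s < e" "\<not> (\<exists>k\<in>K. \<exists>c. Y (0, s) = c *s k)" unfolding Y0s by blast
      have "Y (0, s) \<noteq> 0" using eg[of 0 s] s(1) e(1) unfolding good_def by auto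
      with vK vY[OF s(1)] s(2) show False by blast
    qed
  qed
  from alt show ?thesis using closure[OF P] closure[OF Q] by blast
qed

section \<open>Points of the flag threefold and the Zariski topology\<close>

lemma abs_cp2_eq_iff:
  assumes "x \<noteq> 0" "y \<noteq> 0"
  shows "abs_cp2 x = abs_cp2 y \<longleftrightarrow> (\<exists>c. c \<noteq> 0 \<and> y = c *s x)"
proof -
  have r: "proportional z z" if "z \<noteq> 0" for z
    unfolding proportional_def using that by (auto intro!: exI[of _ 1])
  have "proportional x y \<longleftrightarrow> abs_cp2 x = abs_cp2 y"
    using Quotient_rel[OF Quotient_cp2, of x y] r assms by blast
  then show ?thesis using assms unfolding proportional_def by blast
qed

lemma abs_cp2_surj: "\<exists>x. x \<noteq> 0 \<and> q = abs_cp2 x"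
proof (intro exI conjI)
  show "q = abs_cp2 (rep_cp2 q)" using Quotient_abs_rep[OF Quotient_cp2] by simp
  show "rep_cp2 q \<noteq> 0" using Quotient_rep_reflp[OF Quotient_cp2, of q] by (simp add: proportional_def)
qed

lemma incident_abs: "x \<noteq> 0 \<Longrightarrow> y \<noteq> 0 \<Longrightarrow> incident (abs_cp2 x) (abs_cp2 y) \<longleftrightarrow> dot3 x y = 0"
  by (rule incident.abs_eq) (auto simp: proportional_def intro!: exI[of _ 1])

lemma cnj_cp2_abs: "x \<noteq> 0 \<Longrightarrow> cnj_cp2 (abs_cp2 x) = abs_cp2 (cnj3 x)"
  by (rule cnj_cp2.abs_eq) (auto simp: proportional_def intro!: exI[of _ 1])

lemma pt_Pair: "pt (x, y) = (abs_cp2 x, abs_cp2 y)"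
  by (simp add: pt_def)

lemma pt_eqD:
  assumes "(x, y) \<in> flag_cone" "(x', y') \<in> flag_cone" "pt (x, y) = pt (x', y')"
  shows "\<exists>s t. s \<noteq> 0 \<and> t \<noteq> 0 \<and> x' = s *s x \<and> y' = t *s y"
  using assms abs_cp2_eq_iff[of x x'] abs_cp2_eq_iff[of y y'] by (auto simp: pt_Pair flag_cone_def)

lemma flag_eq: "flag = pt ` flag_cone"
proof (rule Set.set_eqI, rule iffI)
  fix z assume "z \<in> flag"
  moreover obtain x y where "x \<noteq> 0" "y \<noteq> 0" "z = (abs_cp2 x, abs_cp2 y)"
    using abs_cp2_surj[of "fst z"] abs_cp2_surj[of "snd z"] prod.collapse[of z] by metis
  ultimately have "(x, y) \<in> flag_cone" "z = pt (x, y)"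
    using incident_abs[of x y] by (simp_all add: flag_def flag_cone_def pt_Pair)
  then show "z \<in> pt ` flag_cone" by blast
qed (auto simp: flag_def flag_cone_def incident_abs pt_Pair)

lemma zero_locus_bihomogeneous_iff:
  assumes "bihomogeneous a b P" "z \<in> flag_cone"
  shows "pt z \<in> zero_locus P \<longleftrightarrow> P z = 0"
proof
  assume "pt z \<in> zero_locus P"
  then obtain z' where z': "z' \<in> flag_cone" "P z' = 0" "pt z = pt z'" unfolding zero_locus_def by blast
  obtain x y x' y' where e: "z = (x, y)" "z' = (x', y')" by (metis prod.exhaust)
  with pt_eqD z' assms(2) obtain s t where "x = s *s x'" "y = t *s y'" by metis
  then show "P z = 0" using z'(2) bihomogeneous_scale[OF assms(1)] e by simp
qed (use assms in \<open>auto simp: zero_locus_def\<close>)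

lemma cross_antisym: "cross x y = (- 1) *s cross y x"
  by (simp add: vec3_eq_iff)

text \<open>Irreducibility only has to be tested against hypersurfaces: two closed sets that do not
  contain the set each have an equation that does not vanish on it.\<close>

lemma irreducible_zero_locusI:
  assumes "\<exists>z\<in>flag_cone. f z = 0"
    and prime: "\<And>a b a' b' P Q. bihomogeneous a b P \<Longrightarrow> bihomogeneous a' b' Q \<Longrightarrow>
      (\<And>z. z \<in> flag_cone \<Longrightarrow> f z = 0 \<Longrightarrow> P z * Q z = 0) \<Longrightarrow>
      (\<forall>z\<in>flag_cone. f z = 0 \<longrightarrow> P z = 0) \<or> (\<forall>z\<in>flag_cone. f z = 0 \<longrightarrow> Q z = 0)"
  shows "irreducible_set (zero_locus f)"
  unfolding irreducible_set_def
proof (intro conjI allI impI)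
  show "zero_locus f \<noteq> {}" using assms(1) unfolding zero_locus_def by blast
next
  fix Y Z assume YZ: "zariski_closed Y \<and> zariski_closed Z \<and> zero_locus f \<subseteq> Y \<union> Z"
  have sep: "\<exists>P a b. bihomogeneous a b P \<and> (\<forall>z\<in>flag_cone. pt z \<in> W \<longrightarrow> P z = 0) \<and> (\<exists>z\<in>flag_cone. f z = 0 \<and> P z \<noteq> 0)"
    if W: "zariski_closed W" "\<not> zero_locus f \<subseteq> W" for W
  proof -
    obtain \<P> where \<P>: "\<And>P. P \<in> \<P> \<Longrightarrow> \<exists>a b. bihomogeneous a b P" "W = flag \<inter> (\<Inter>P\<in>\<P>. zero_locus P)"
      using W(1) unfolding zariski_closed_def by blast
    obtain z where z: "z \<in> flag_cone" "f z = 0" "pt z \<notin> W" using W(2) unfolding zero_locus_def by blast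
    then obtain P where P: "P \<in> \<P>" "pt z \<notin> zero_locus P" using \<P>(2) flag_eq by blast
    then obtain a b where ab: "bihomogeneous a b P" using \<P>(1) by blast
    have "P z \<noteq> 0" using zero_locus_bihomogeneous_iff[OF ab z(1)] P(2) by blast
    moreover have "\<forall>z\<in>flag_cone. pt z \<in> W \<longrightarrow> P z = 0"
      using zero_locus_bihomogeneous_iff[OF ab] P(1) \<P>(2) by blast
    ultimately show ?thesis using ab z by blast
  qed
  show "zero_locus f \<subseteq> Y \<or> zero_locus f \<subseteq> Z"
  proof (rule ccontr)
    assume neg: "\<not> ?thesis"
    then obtain P a b where P: "bihomogeneous a b P" "\<forall>z\<in>flag_cone. pt z \<in> Y \<longrightarrow> P z = 0" "\<exists>z\<in>flag_cone. f z = 0 \<and> P z \<noteq> 0"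
      using sep YZ by blast
    from neg obtain Q a' b' where Q: "bihomogeneous a' b' Q" "\<forall>z\<in>flag_cone. pt z \<in> Z \<longrightarrow> Q z = 0" "\<exists>z\<in>flag_cone. f z = 0 \<and> Q z \<noteq> 0"
      using sep[of Z] YZ by blast
    have "P z * Q z = 0" if "z \<in> flag_cone" "f z = 0" for z
    proof -
      have "pt z \<in> zero_locus f" using that by (auto simp: zero_locus_def)
      then show ?thesis using YZ P(2) Q(2) that by auto
    qed
    from prime[OF P(1) Q(1) this] P(3) Q(3) show False by blast
  qed
qed

lemma irreducible_surface:
  assumes w: "poly_map w" and K: "finite K" "0 \<notin> K"
      "\<And>y. y \<noteq> 0 \<Longrightarrow> cross y (w y) = 0 \<Longrightarrow> \<exists>k\<in>K. \<exists>c. y = c *s k"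
    and f: "\<And>x y. (x, y) \<in> flag_cone \<Longrightarrow> f (x, y) = dot3 x (w y)"
  shows "irreducible_set (zero_locus f)"
proof (rule irreducible_zero_locusI)
  show "\<exists>z\<in>flag_cone. f z = 0"
  proof -
    define y :: "complex^3" where "y = axis 1 1"
    have y: "y \<noteq> 0" by (simp add: y_def vec3_eq_iff axis_def)
    obtain x where "x \<noteq> 0" "dot3 x y = 0" "dot3 x (w y) = 0"
    proof (cases "cross y (w y) = 0")
      case True
      then obtain c where "w y = c *s y" using cross_zero_imp[of "w y" y] y cross_antisym[of "w y" y] by auto
      then show ?thesis using that[of "axis 2 1"] by (auto simp: y_def vec3_eq_iff dot3_expand axis_def)
    qed (use that[of "cross y (w y)"] in auto)
    with y have "(x, y) \<in> flag_cone" by (simp add: flag_cone_def)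
    with f \<open>dot3 x (w y) = 0\<close> show ?thesis by force
  qed
next
  fix a b a' b' P Q
  assume P: "bihomogeneous a b P" and Q: "bihomogeneous a' b' Q"
    and PQ: "\<And>z. z \<in> flag_cone \<Longrightarrow> f z = 0 \<Longrightarrow> P z * Q z = 0"
  have "(\<forall>x y. (x, y) \<in> flag_cone \<longrightarrow> dot3 x (w y) = 0 \<longrightarrow> P (x, y) = 0) \<or>
    (\<forall>x y. (x, y) \<in> flag_cone \<longrightarrow> dot3 x (w y) = 0 \<longrightarrow> Q (x, y) = 0)"
    proof (rule zero_product_on_surface[OF w K(1,2) _ P Q])
    show "\<exists>k\<in>K. \<exists>c. y = c *s k" if "y \<noteq> 0" "cross y (w y) = 0" for y using K(3) that by blast
    show "P (x, y) * Q (x, y) = 0" if "(x, y) \<in> flag_cone" "dot3 x (w y) = 0" for x y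
      using PQ f that by metis
  qed
  then show "(\<forall>z\<in>flag_cone. f z = 0 \<longrightarrow> P z = 0) \<or> (\<forall>z\<in>flag_cone. f z = 0 \<longrightarrow> Q z = 0)"
    using f by (auto simp: Ball_def)
qed

section \<open>Sections are continuous, homogeneous and of polynomial growth\<close>

lemma norm_scale3: "norm (c *s (x :: complex^3)) = cmod c * norm x"
  unfolding norm_vec_def by (simp add: norm_mult L2_set_right_distrib)

lemma flag_cone_scale: "(x, y) \<in> flag_cone \<Longrightarrow> s \<noteq> 0 \<Longrightarrow> t \<noteq> 0 \<Longrightarrow> (s *s x, t *s y) \<in> flag_cone"
  by (simp add: flag_cone_def)

lemma section_local:
  assumes "f \<in> sections a b" "z \<in> flag_cone"
  obtains m n P Q where "bihomogeneous (a + m) (b + n) P" "bihomogeneous m n Q" "Q z \<noteq> 0"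
    "\<And>w. w \<in> flag_cone \<Longrightarrow> Q w \<noteq> 0 \<Longrightarrow> f w = P w / Q w"
  using assms unfolding sections_def by blast

lemma section_scale:
  assumes "f \<in> sections a b" "(x, y) \<in> flag_cone" "s \<noteq> 0" "t \<noteq> 0"
  shows "f (s *s x, t *s y) = s ^ a * t ^ b * f (x, y)"
proof -
  obtain m n P Q where PQ: "bihomogeneous (a + m) (b + n) P" "bihomogeneous m n Q" "Q (x, y) \<noteq> 0"
    "\<And>w. w \<in> flag_cone \<Longrightarrow> Q w \<noteq> 0 \<Longrightarrow> f w = P w / Q w"
    using section_local[OF assms(1,2)] by metis
  have q: "Q (s *s x, t *s y) = s ^ m * t ^ n * Q (x, y)" by (rule bihomogeneous_scale[OF PQ(2)])
  have "f (s *s x, t *s y) = P (s *s x, t *s y) / Q (s *s x, t *s y)"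
    by (rule PQ(4)[OF flag_cone_scale[OF assms(2-4)]]) (use q PQ(3) assms(3,4) in simp)
  also have "\<dots> = (s ^ (a + m) * t ^ (b + n) * P (x, y)) / (s ^ m * t ^ n * Q (x, y))"
    unfolding q bihomogeneous_scale[OF PQ(1)] ..
  also have "\<dots> = s ^ a * t ^ b * (P (x, y) / Q (x, y))" using assms(3,4) by (simp add: power_add)
  finally show ?thesis unfolding PQ(4)[OF assms(2) PQ(3)] .
qed

lemma section_continuous:
  assumes "f \<in> sections a b"
  shows "continuous_on flag_cone f"
  unfolding continuous_on_eq_continuous_within
proof
  fix z assume z: "z \<in> flag_cone"
  obtain m n P Q where PQ: "bihomogeneous (a + m) (b + n) P" "bihomogeneous m n Q" "Q z \<noteq> 0"
    "\<And>w. w \<in> flag_cone \<Longrightarrow> Q w \<noteq> 0 \<Longrightarrow> f w = P w / Q w"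
    using section_local[OF assms z] by metis
  have c: "continuous_on UNIV P" "continuous_on UNIV Q"
    using PQ(1,2) bihomogeneous_continuous by blast+
  define T where "T = {w. Q w \<noteq> 0}"
  have T: "open T" "z \<in> T" unfolding T_def using c PQ(3) by (auto intro!: open_Collect_neq continuous_intros)
  have "continuous (at z within flag_cone) (\<lambda>w. P w / Q w)"
  proof (rule continuous_at_within_divide)
    show "continuous (at z within flag_cone) P" "continuous (at z within flag_cone) Q"
      using bihomogeneous_continuous[OF PQ(1), of flag_cone] bihomogeneous_continuous[OF PQ(2), of flag_cone] z
      unfolding continuous_on_eq_continuous_within by blast+
  qed (rule PQ(3))
  then show "continuous (at z within flag_cone) f"
  proof (rule continuous_transform_within_openin[where S = "flag_cone \<inter> T"])
    show "openin (top_of_set flag_cone) (flag_cone \<inter> T)" using T(1) by (simp add: openin_open_Int)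
  qed (use z T PQ(4) in \<open>auto simp: T_def\<close>)
qed

text \<open>Sections are only known locally as quotients; the curves turn them into entire functions, to which
  Liouville's theorem applies.\<close>

lemma section_holomorphic:
  assumes f: "f \<in> sections a b" and c: "poly_curve \<gamma>" "poly_curve \<delta>"
    and cone: "\<And>u. (\<gamma> u, \<delta> u) \<in> flag_cone"
  shows "(\<lambda>u. f (\<gamma> u, \<delta> u)) holomorphic_on UNIV"
  unfolding holomorphic_on_def
proof
  fix u :: complex
  obtain m n P Q where PQ: "bihomogeneous (a + m) (b + n) P" "bihomogeneous m n Q" "Q (\<gamma> u, \<delta> u) \<noteq> 0"
    "\<And>w. w \<in> flag_cone \<Longrightarrow> Q w \<noteq> 0 \<Longrightarrow> f w = P w / Q w"
    using section_local[OF f cone] by metis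
  define p where "p u = P (\<gamma> u, \<delta> u)" for u
  define q where "q u = Q (\<gamma> u, \<delta> u)" for u
  have h: "p holomorphic_on UNIV" "q holomorphic_on UNIV"
    unfolding p_def q_def
    using bihomogeneous_poly_curve[OF PQ(1) c] bihomogeneous_poly_curve[OF PQ(2) c] poly_fun_holomorphic by blast+
  define T where "T = {u. q u \<noteq> 0}"
  have T: "open T" unfolding T_def
    using holomorphic_on_imp_continuous_on[OF h(2)] by (intro open_Collect_neq continuous_intros)
  have "u \<in> T" using PQ(3) by (simp add: T_def q_def)
  have "(\<lambda>u. p u / q u) holomorphic_on T"
    by (intro holomorphic_intros holomorphic_on_subset[OF h(1)] holomorphic_on_subset[OF h(2)]) (auto simp: T_def)
  then have "(\<lambda>u. f (\<gamma> u, \<delta> u)) holomorphic_on T"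
    by (rule holomorphic_transform) (use PQ(4) cone in \<open>auto simp: p_def q_def T_def\<close>)
  then have "(\<lambda>u. f (\<gamma> u, \<delta> u)) field_differentiable at u"
    using holomorphic_on_imp_differentiable_at[OF _ T \<open>u \<in> T\<close>] by blast
  then show "(\<lambda>u. f (\<gamma> u, \<delta> u)) field_differentiable at u within UNIV" by simp
qed

text \<open>By homogeneity it suffices to bound a section on pairs of unit vectors, which form a compact set.\<close>

lemma section_bound:
  assumes f: "f \<in> sections a b"
  shows "\<exists>C\<ge>0. \<forall>x y. (x, y) \<in> flag_cone \<longrightarrow> cmod (f (x, y)) \<le> C * norm x ^ a * norm y ^ b"
proof -
  define S where "S = (sphere 0 1 \<times> sphere 0 1) \<inter> {z. dot3 (fst z) (snd z) = (0::complex)}"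
  have "compact S" unfolding S_def
    by (intro compact_Int_closed compact_Times compact_sphere closed_Collect_eq continuous_intros)
  moreover have S: "S \<subseteq> flag_cone" by (auto simp: S_def flag_cone_def)
  ultimately have "compact (f ` S)"
    using section_continuous[OF f] continuous_on_subset compact_continuous_image by blast
  then obtain C where C: "\<And>w. w \<in> f ` S \<Longrightarrow> cmod w \<le> C" using compact_imp_bounded bounded_iff by metis
  have "cmod (f (x, y)) \<le> max C 0 * norm x ^ a * norm y ^ b" if xy: "(x, y) \<in> flag_cone" for x y
  proof -
    have n: "norm x > 0" "norm y > 0" using xy by (auto simp: flag_cone_def)
    define x' where "x' = complex_of_real (1 / norm x) *s x"
    define y' where "y' = complex_of_real (1 / norm y) *s y"
    have xy': "x = complex_of_real (norm x) *s x'" "y = complex_of_real (norm y) *s y'"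
      using n by (simp_all add: x'_def y'_def Finite_Cartesian_Product.vec_eq_iff)
    have "(x', y') \<in> S" using xy n by (simp add: S_def x'_def y'_def norm_scale3 norm_divide flag_cone_def)
    then have "cmod (f (x', y')) \<le> C" "(x', y') \<in> flag_cone" using C S by auto
    moreover have "f (x, y) = complex_of_real (norm x) ^ a * complex_of_real (norm y) ^ b * f (x', y')"
      using section_scale[OF f \<open>(x', y') \<in> flag_cone\<close>, of "norm x" "norm y"] n xy' by simp
    ultimately have "cmod (f (x, y)) = norm x ^ a * norm y ^ b * cmod (f (x', y'))" "cmod (f (x', y')) \<le> max C 0"
      by (simp_all add: norm_mult norm_power)
    then have "cmod (f (x, y)) \<le> norm x ^ a * norm y ^ b * max C 0" by (simp add: mult_left_mono)
    then show ?thesis by (simp only: mult_ac)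
  qed
  then show ?thesis by (intro exI[of _ "max C 0"]) auto
qed

lemma section_zero_off_cone: "f \<in> sections a b \<Longrightarrow> z \<notin> flag_cone \<Longrightarrow> f z = 0"
  unfolding sections_def by blast

text \<open>Along a line that misses the origin the section is an entire function of linear growth, hence affine.
  Homogeneity relates its values on the lines \<open>p + u q\<close> and \<open>q + u p\<close>, and this determines the two
  coefficients.\<close>

lemma section_linear_in_x:
  assumes f: "f \<in> sections 1 b" and y: "y \<noteq> 0" "dot3 p y = 0" "dot3 q y = 0"
    and pq: "\<And>s t. s \<noteq> 0 \<or> t \<noteq> 0 \<Longrightarrow> s *s p + t *s q \<noteq> 0"
  shows "f (s *s p + t *s q, y) = s * f (p, y) + t * f (q, y)"
proof -
  have cone: "(s *s p + t *s q, y) \<in> flag_cone" if "s \<noteq> 0 \<or> t \<noteq> 0" for s t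
    using y pq[OF that] by (simp add: flag_cone_def)
  obtain C where C: "C \<ge> 0" "\<And>x y. (x, y) \<in> flag_cone \<Longrightarrow> cmod (f (x, y)) \<le> C * norm x ^ 1 * norm y ^ b"
    using section_bound[OF f] by blast
  have lin: "\<exists>p. degree p \<le> 1 \<and> (\<forall>u. f (\<gamma> u, y) = poly p u)"
    if g: "\<gamma> = (\<lambda>u. x + u *s x')" "\<And>u. (\<gamma> u, y) \<in> flag_cone" for \<gamma> x x'
  proof (rule Liouville_poly)
    have "poly_curve \<gamma>" unfolding g by (intro poly_curve_add poly_curve_const poly_curve_scale poly_fun_id)
    then show "(\<lambda>u. f (\<gamma> u, y)) holomorphic_on UNIV" by (rule section_holomorphic[OF f _ poly_curve_const g(2)])
    fix u
    have "norm (\<gamma> u) \<le> norm x + cmod u * norm x'"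
      using norm_triangle_ineq[of x "u *s x'"] unfolding g(1) norm_scale3 .
    also have "\<dots> \<le> (norm x + norm x') * (1 + cmod u)" by (simp add: algebra_simps)
    finally have "C * norm y ^ b * norm (\<gamma> u) \<le> C * norm y ^ b * ((norm x + norm x') * (1 + cmod u))"
      using C(1) by (intro mult_left_mono) auto
    then show "cmod (f (\<gamma> u, y)) \<le> (C * norm y ^ b * (norm x + norm x')) * (1 + cmod u) ^ 1"
      using C(2)[OF g(2), of u] by (simp add: mult_ac)
  qed
  have line: "poly r u = coeff r 0 + u * coeff r 1" if "degree r \<le> 1" for r :: "complex poly" and u
    using poly_eq_sum_upto[OF that, of u] by (simp add: mult.commute)
  have A1: "(p + u *s q, y) \<in> flag_cone" "(q + u *s p, y) \<in> flag_cone" for u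
    using cone[of 1 u] cone[of u 1] by (simp_all add: add.commute[of q])
  obtain r1 where r1: "degree r1 \<le> 1" "\<And>u. f (p + u *s q, y) = poly r1 u"
    using lin[OF refl A1(1)] by blast
  obtain r2 where r2: "degree r2 \<le> 1" "\<And>u. f (q + u *s p, y) = poly r2 u"
    using lin[OF refl A1(2)] by blast
  \<comment> \<open>Both lines parametrize the same points up to scaling, which identifies the coefficients.\<close>
  have rel: "poly r2 u = u * poly r1 (1 / u)" if "u \<noteq> 0" for u
  proof -
    have "q + u *s p = u *s (p + (1 / u) *s q)" 
      unfolding vector_add_ldistrib vector_smult_assoc using that by simp
    then have "f (q + u *s p, y) = f (u *s (p + (1 / u) *s q), 1 *s y)" by (simp only: vector_smult_lid)
    also have "\<dots> = u * f (p + (1 / u) *s q, y)"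
      using section_scale[OF f A1(1)[of "1 / u"] that, of 1] by (simp only: power_one power_one_right mult_1_right one_neq_zero not_False_eq_True)
    finally show ?thesis unfolding r1(2) r2(2) .
  qed
  have e1: "coeff r2 0 + u * coeff r2 1 = u * coeff r1 0 + coeff r1 1" if "u \<noteq> 0" for u
    using rel[OF that] that unfolding line[OF r1(1)] line[OF r2(1)] by (simp add: distrib_left)
  have e2: "coeff r2 0 = coeff r1 1"
  proof -
    have "coeff r2 0 + 1 * coeff r2 1 = 1 * coeff r1 0 + coeff r1 1" by (rule e1) simp
    moreover have "coeff r2 0 + 2 * coeff r2 1 = 2 * coeff r1 0 + coeff r1 1" by (rule e1) simp
    ultimately have "2 * (coeff r2 0 + 1 * coeff r2 1) - (coeff r2 0 + 2 * coeff r2 1)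
        = 2 * (1 * coeff r1 0 + coeff r1 1) - (2 * coeff r1 0 + coeff r1 1)" by (simp only:)
    then show ?thesis by simp
  qed
  have v: "f (p, y) = coeff r1 0" "f (q, y) = coeff r1 1"
  proof -
    have "f (p, y) = poly r1 0" using r1(2)[of 0] by (simp only: vector_smult_lzero add_0_right)
    then show "f (p, y) = coeff r1 0" unfolding line[OF r1(1)] by simp
    have "f (q, y) = poly r2 0" using r2(2)[of 0] by (simp only: vector_smult_lzero add_0_right)
    then show "f (q, y) = coeff r1 1" unfolding line[OF r2(1)] e2 by simp
  qed
  show ?thesis
  proof (cases "s = 0")
    case False
    have "s *s p + t *s q = s *s (p + (t / s) *s q)" 
      unfolding vector_add_ldistrib vector_smult_assoc using False by simp
    then have "f (s *s p + t *s q, y) = f (s *s (p + (t / s) *s q), 1 *s y)" by (simp only: vector_smult_lid)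
    also have "\<dots> = s * f (p + (t / s) *s q, y)"
      using section_scale[OF f A1(1)[of "t / s"] False, of 1] by (simp only: power_one power_one_right mult_1_right one_neq_zero not_False_eq_True)
    also have "\<dots> = s * f (p, y) + t * f (q, y)"
      unfolding r1(2) line[OF r1(1)] v using False by (simp add: distrib_left)
    finally show ?thesis .
  next
    case s0: True
    show ?thesis
    proof (cases "t = 0")
      case True
      have "(0, y) \<notin> flag_cone" by (simp add: flag_cone_def)
      then show ?thesis using s0 True section_zero_off_cone[OF f] by simp
    next
      case False
      have q: "(q, y) \<in> flag_cone" using A1(2)[of 0] by (simp only: vector_smult_lzero add_0_right)
      have "f (s *s p + t *s q, y) = f (t *s q, 1 *s y)"
        unfolding s0 by (simp only: vector_smult_lzero add_0_left vector_smult_lid)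
      also have "\<dots> = t ^ 1 * 1 ^ b * f (q, y)" by (rule section_scale[OF f q False]) simp
      finally show ?thesis using s0 by simp
    qed
  qed
qed

section \<open>Coordinates adapted to a unitary frame\<close>

locale frame =
  fixes u0 u1 u2 :: "complex^3"
  assumes unit: "dot3 (cnj3 u0) u0 = 1" "dot3 (cnj3 u1) u1 = 1" "dot3 (cnj3 u2) u2 = 1"
    and orth: "dot3 (cnj3 u0) u1 = 0" "dot3 (cnj3 u0) u2 = 0" "dot3 (cnj3 u1) u2 = 0"
begin

text \<open>The planes of \<open>x\<close> and \<open>y\<close> are dual, so they carry the conjugate frame and the frame. This makes the
  incidence form the standard one (\<open>dot3_xvec_yvec\<close>) and conjugation act on the coordinates
  (\<open>cnj3_xvec\<close>).\<close>

definition xvec :: "complex \<Rightarrow> complex \<Rightarrow> complex \<Rightarrow> complex^3"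
  where "xvec a b c = a *s cnj3 u0 + b *s cnj3 u1 + c *s cnj3 u2"

definition yvec :: "complex \<Rightarrow> complex \<Rightarrow> complex \<Rightarrow> complex^3"
  where "yvec a b c = a *s u0 + b *s u1 + c *s u2"

lemma orth': "dot3 (cnj3 u1) u0 = 0" "dot3 (cnj3 u2) u0 = 0" "dot3 (cnj3 u2) u1 = 0"
proof -
  have "dot3 (cnj3 v) u = cnj (dot3 (cnj3 u) v)" for u v by (simp add: dot3_expand mult.commute)
  then show "dot3 (cnj3 u1) u0 = 0" "dot3 (cnj3 u2) u0 = 0" "dot3 (cnj3 u2) u1 = 0"
    using orth by (metis complex_cnj_zero)+
qed

lemma dot3_xvec: "dot3 (xvec a b c) u0 = a" "dot3 (xvec a b c) u1 = b" "dot3 (xvec a b c) u2 = c"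
  unfolding xvec_def by (simp_all add: unit orth orth')

lemma dot3_yvec: "dot3 (cnj3 u0) (yvec a b c) = a" "dot3 (cnj3 u1) (yvec a b c) = b" "dot3 (cnj3 u2) (yvec a b c) = c"
  unfolding yvec_def by (simp_all add: unit orth orth')

lemma dot3_xvec_yvec: "dot3 (xvec a b c) (yvec s t r) = a * s + b * t + c * r"
  unfolding yvec_def by (simp add: dot3_xvec mult.commute)

lemma cnj3_xvec: "cnj3 (xvec a b c) = yvec (cnj a) (cnj b) (cnj c)"
  unfolding xvec_def yvec_def by (simp add: vec3_eq_iff)

text \<open>A vector that is orthogonal to \<open>u0\<close> and \<open>u1\<close> is a multiple of \<open>u0 \<times> u1\<close>. So is the conjugate of \<open>u2\<close>,
  which is not orthogonal to \<open>u2\<close>.\<close>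

lemma xvec_coords: "x = xvec (dot3 x u0) (dot3 x u1) (dot3 x u2)"
proof -
  have c: "cross u0 u1 \<noteq> 0"
  proof
    assume "cross u0 u1 = 0"
    moreover have "u1 \<noteq> 0" using unit(2) by auto
    ultimately obtain k where k: "u0 = k *s u1" using cross_zero_imp by blast
    then have "k = 0" using orth'(1) unit(2) by simp
    then show False using k unit(1) by simp
  qed
  obtain k where k: "cnj3 u2 = k *s cross u0 u1"
    using orthogonal_to_both[OF orth'(2,3) c] by blast
  define r where "r = x - xvec (dot3 x u0) (dot3 x u1) (dot3 x u2)"
  have x: "x = xvec (dot3 x u0) (dot3 x u1) (dot3 x u2) + r" by (simp add: r_def)
  have "dot3 r u0 = 0" "dot3 r u1 = 0" "dot3 r u2 = 0"
    using arg_cong[OF x, of "\<lambda>z. dot3 z u0"] arg_cong[OF x, of "\<lambda>z. dot3 z u1"] arg_cong[OF x, of "\<lambda>z. dot3 z u2"]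
    by (simp_all only: dot3_linear dot3_xvec add_cancel_right_right)
  then obtain l where l: "r = l *s cross u0 u1" using orthogonal_to_both c by blast
  have "k * dot3 (cross u0 u1) u2 = 1" using unit(3) k by simp
  moreover have "l * dot3 (cross u0 u1) u2 = 0" using \<open>dot3 r u2 = 0\<close> l by simp
  ultimately have "l = 0" by auto
  then have "r = 0" using l by simp
  then show ?thesis using x by simp
qed

lemma yvec_coords: "y = yvec (dot3 (cnj3 u0) y) (dot3 (cnj3 u1) y) (dot3 (cnj3 u2) y)"
proof -
  have "cnj3 y = xvec (dot3 (cnj3 y) u0) (dot3 (cnj3 y) u1) (dot3 (cnj3 y) u2)" by (rule xvec_coords)
  then have "cnj3 (cnj3 y) = yvec (cnj (dot3 (cnj3 y) u0)) (cnj (dot3 (cnj3 y) u1)) (cnj (dot3 (cnj3 y) u2))"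
    by (metis cnj3_xvec)
  moreover have "cnj3 (cnj3 y) = y" by (simp add: vec3_eq_iff)
  moreover have "cnj (dot3 (cnj3 y) u) = dot3 (cnj3 u) y" for u by (simp add: dot3_expand mult.commute)
  ultimately show ?thesis by simp
qed

lemma xvec_eq_iff: "xvec a b c = xvec a' b' c' \<longleftrightarrow> a = a' \<and> b = b' \<and> c = c'"
  by (metis dot3_xvec)

lemma yvec_eq_iff: "yvec a b c = yvec a' b' c' \<longleftrightarrow> a = a' \<and> b = b' \<and> c = c'"
  by (metis dot3_yvec)

lemma xvec_0: "xvec 0 0 0 = 0" and yvec_0: "yvec 0 0 0 = 0"
  by (simp_all add: xvec_def yvec_def)

lemma xvec_eq_0: "xvec a b c = 0 \<longleftrightarrow> a = 0 \<and> b = 0 \<and> c = 0"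
  using xvec_eq_iff[of a b c 0 0 0] by (simp add: xvec_0)

lemma yvec_eq_0: "yvec a b c = 0 \<longleftrightarrow> a = 0 \<and> b = 0 \<and> c = 0"
  using yvec_eq_iff[of a b c 0 0 0] by (simp add: yvec_0)

lemma cone_iff: "(xvec a b c, yvec s t r) \<in> flag_cone \<longleftrightarrow>
    \<not> (a = 0 \<and> b = 0 \<and> c = 0) \<and> \<not> (s = 0 \<and> t = 0 \<and> r = 0) \<and> a * s + b * t + c * r = 0"
  by (simp add: flag_cone_def xvec_eq_0 yvec_eq_0 dot3_xvec_yvec)

lemma scale_xvec: "k *s xvec a b c = xvec (k * a) (k * b) (k * c)"
  by (simp add: xvec_def vector_add_ldistrib vector_smult_assoc)

lemma scale_yvec: "k *s yvec a b c = yvec (k * a) (k * b) (k * c)"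
  by (simp add: yvec_def vector_add_ldistrib vector_smult_assoc)

lemma add_xvec: "xvec a b c + xvec a' b' c' = xvec (a + a') (b + b') (c + c')"
  by (simp add: xvec_def vec3_eq_iff algebra_simps)

lemma poly_curve_xvec: "poly_fun a \<Longrightarrow> poly_fun b \<Longrightarrow> poly_fun c \<Longrightarrow> poly_curve (\<lambda>u. xvec (a u) (b u) (c u))"
  unfolding xvec_def by (intro poly_curve_add poly_curve_scale poly_curve_const)

lemma poly_curve_yvec: "poly_fun a \<Longrightarrow> poly_fun b \<Longrightarrow> poly_fun c \<Longrightarrow> poly_curve (\<lambda>u. yvec (a u) (b u) (c u))"
  unfolding yvec_def by (intro poly_curve_add poly_curve_scale poly_curve_const)

lemma norm_xvec_le:
  "\<exists>M\<ge>0. \<forall>a b c R. cmod a \<le> R \<longrightarrow> cmod b \<le> R \<longrightarrow> cmod c \<le> R \<longrightarrow> norm (xvec a b c) \<le> M * R \<and> norm (yvec a b c) \<le> M * R"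
proof (intro exI[of _ "norm (cnj3 u0) + norm (cnj3 u1) + norm (cnj3 u2) + (norm u0 + norm u1 + norm u2)"] conjI allI impI)
  fix a b c R assume R: "cmod a \<le> R" "cmod b \<le> R" "cmod c \<le> R"
  have R0: "R \<ge> 0" using R(1) norm_ge_zero order_trans by blast
  have "norm (a *s v0 + b *s v1 + c *s v2) \<le> (norm v0 + norm v1 + norm v2) * R" for v0 v1 v2 :: "complex^3"
  proof -
    have "norm (a *s v0 + b *s v1 + c *s v2) \<le> cmod a * norm v0 + cmod b * norm v1 + cmod c * norm v2"
      using norm_triangle_ineq[of "a *s v0 + b *s v1" "c *s v2"] norm_triangle_ineq[of "a *s v0" "b *s v1"]
      by (simp add: norm_scale3)
    also have "\<dots> \<le> R * norm v0 + R * norm v1 + R * norm v2"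
      using R by (intro add_mono mult_right_mono) auto
    finally show ?thesis by (simp add: algebra_simps)
  qed
  from this[of "cnj3 u0" "cnj3 u1" "cnj3 u2"] this[of u0 u1 u2]
  show "norm (xvec a b c) \<le> (norm (cnj3 u0) + norm (cnj3 u1) + norm (cnj3 u2) + (norm u0 + norm u1 + norm u2)) * R"
    "norm (yvec a b c) \<le> (norm (cnj3 u0) + norm (cnj3 u1) + norm (cnj3 u2) + (norm u0 + norm u1 + norm u2)) * R"
    unfolding xvec_def yvec_def distrib_right[of _ _ R] using R0
    by (smt (verit, best) mult_nonneg_nonneg norm_ge_zero add_nonneg_nonneg)+
qed simp

end

section \<open>The sections that vanish on the fibers\<close>

lemma continuous_eq_at_0:
  fixes g h :: "complex \<Rightarrow> complex"
  assumes "continuous_on UNIV g" "continuous_on UNIV h" "\<And>e. e \<noteq> 0 \<Longrightarrow> g e = h e"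
  shows "g 0 = h 0"
proof -
  have "(g \<longlongrightarrow> g 0) (at 0)" "(h \<longlongrightarrow> h 0) (at 0)"
    using assms(1,2) by (simp_all add: continuous_on_def)
  moreover have "(g \<longlongrightarrow> h 0) (at 0)"
    by (rule Lim_transform_eventually[OF \<open>(h \<longlongrightarrow> h 0) (at 0)\<close>])
       (auto simp: eventually_at_filter assms(3))
  ultimately show ?thesis using tendsto_unique[of "at 0" g] by simp
qed

text \<open>The zeros with \<open>q i \<noteq> 0\<close> are roots \<open>p i / q i\<close> of the dehomogenized form. At most one zero has
  \<open>q i = 0\<close>, and if there is one, the degree drops as well.\<close>

lemma binary_form_zero:
  fixes c :: "nat \<Rightarrow> complex" and p q :: "'i \<Rightarrow> complex"
  assumes J: "finite J" "card J \<ge> n + 1"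
    and np: "\<And>i j. i \<in> J \<Longrightarrow> j \<in> J \<Longrightarrow> i \<noteq> j \<Longrightarrow> p i * q j \<noteq> p j * q i"
    and z: "\<And>i. i \<in> J \<Longrightarrow> (\<Sum>j\<le>n. c j * p i ^ j * q i ^ (n - j)) = 0"
    and "n > 0" and "k \<le> n"
  shows "c k = 0"
proof -
  define P where "P = (\<Sum>j\<le>n. monom (c j) j)"
  have cP: "coeff P j = (if j \<le> n then c j else 0)" for j
    unfolding P_def by (simp add: coeff_sum)
  have degP: "degree P \<le> n" by (rule degree_le) (simp add: cP)
  define J' where "J' = {i \<in> J. q i \<noteq> 0}"
  have root: "poly P (p i / q i) = 0" if "i \<in> J'" for i
  proof -
    have qi: "q i \<noteq> 0" "i \<in> J" using that by (auto simp: J'_def)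
    have "q i ^ n * poly P (p i / q i) = (\<Sum>j\<le>n. c j * p i ^ j * q i ^ (n - j))"
      unfolding P_def poly_sum poly_monom sum_distrib_left
      by (intro sum.cong) (use qi in \<open>auto simp: power_divide power_diff field_simps\<close>)
    with z[OF qi(2)] qi show ?thesis by simp
  qed
  have inj: "inj_on (\<lambda>i. p i / q i) J'"
    using np by (auto simp: inj_on_def J'_def field_simps)
  have fJ: "finite J'" using J(1) by (simp add: J'_def)
  have P0: "P = 0" if "degree P < card J'"
  proof (rule ccontr)
    assume "P \<noteq> 0"
    have "card J' = card ((\<lambda>i. p i / q i) ` J')" using inj by (simp add: card_image)
    also have "\<dots> \<le> card {x. poly P x = 0}"
      by (rule card_mono[OF poly_roots_finite[OF \<open>P \<noteq> 0\<close>]]) (use root in auto)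
    also have "\<dots> \<le> degree P" by (rule card_poly_roots_bound[OF \<open>P \<noteq> 0\<close>])
    finally show False using that by simp
  qed
  have "P = 0"
  proof (cases "J' = J")
    case True
    then show ?thesis using P0 degP J(2) by simp
  next
    case False
    then obtain i where i: "i \<in> J" "q i = 0" by (auto simp: J'_def)
    have JJ: "J - {i} \<subseteq> J'"
    proof
      fix j assume j: "j \<in> J - {i}"
      then have "q j \<noteq> 0" using np[of i j] i by auto
      then show "j \<in> J'" using j by (simp add: J'_def)
    qed
    have cJ: "card J' \<ge> n" using card_mono[OF fJ JJ] J i by simp
    have "J - {i} \<noteq> {}"
    proof
      assume "J - {i} = {}"
      then have "J = {i}" using i by auto
      then show False using J(2) \<open>n > 0\<close> by simp
    qed
    then obtain j where "j \<in> J" "j \<noteq> i" by auto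
    then have "p i \<noteq> 0" using np[of i j] i by auto
    have "(\<Sum>j\<le>n. c j * p i ^ j * q i ^ (n - j)) = (\<Sum>j\<in>{n}. c j * p i ^ j * q i ^ (n - j))"
      by (rule sum.mono_neutral_right) (auto simp: i(2))
    with z[OF i(1)] \<open>p i \<noteq> 0\<close> have "c n = 0" by simp
    then have "degree P < n"
      using degP cP[of n] \<open>n > 0\<close> by (metis leading_coeff_0_iff degree_0 le_neq_implies_less order_refl)
    then show ?thesis using P0 cJ by simp
  qed
  then show ?thesis using cP[of k] \<open>k \<le> n\<close> by simp
qed

text \<open>Ternary forms of degree \<open>d\<close>, indexed so that \<open>r = 1\<close> gives \<^const>\<open>poly2\<close> with the same coefficients.\<close>

definition ternary :: "nat \<Rightarrow> (nat \<Rightarrow> nat \<Rightarrow> complex) \<Rightarrow> complex \<Rightarrow> complex \<Rightarrow> complex \<Rightarrow> complex"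
  where "ternary d c s t r = (\<Sum>j\<le>d. \<Sum>k\<le>d - j. c j k * s ^ j * t ^ k * r ^ (d - j - k))"

lemma ternary_1: "ternary d c s t 1 = poly2 d c s t"
  by (simp add: ternary_def poly2_def)

lemma ternary_dehomogenize:
  assumes "r \<noteq> 0"
  shows "ternary d c s t r = r ^ d * poly2 d c (s / r) (t / r)"
proof -
  have "c j k * s ^ j * t ^ k * r ^ (d - j - k) = r ^ d * (c j k * (s / r) ^ j * (t / r) ^ k)"
    if "j \<le> d" "k \<le> d - j" for j k
  proof -
    have "r ^ d = r ^ (d - j - k) * r ^ j * r ^ k" using that by (simp add: power_add[symmetric])
    then show ?thesis using assms by (simp add: power_divide)
  qed
  then show ?thesis unfolding ternary_def poly2_def sum_distrib_left
    by (intro sum.cong refl) auto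
qed

lemma poly_fun_ternary:
  "poly_fun s \<Longrightarrow> poly_fun t \<Longrightarrow> poly_fun r \<Longrightarrow> poly_fun (\<lambda>u. ternary d c (s u) (t u) (r u))"
  unfolding ternary_def by (intro poly_fun_sum poly_fun_mult poly_fun_power poly_fun_const)

lemma ternary_at_0: "ternary d c s t 0 = (\<Sum>j\<le>d. c j (d - j) * s ^ j * t ^ (d - j))"
proof -
  have "(\<Sum>k\<le>d - j. c j k * s ^ j * t ^ k * 0 ^ (d - j - k)) = (\<Sum>k\<in>{d - j}. c j k * s ^ j * t ^ k * 0 ^ (d - j - k))"
    for j by (rule sum.mono_neutral_right) auto
  then show ?thesis unfolding ternary_def by simp
qed

lemma poly2_Suc:
  assumes "\<And>j. j \<le> Suc d \<Longrightarrow> c j (Suc d - j) = 0"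
  shows "poly2 (Suc d) c s t = poly2 d c s t"
proof -
  have "poly2 (Suc d) c s t = (\<Sum>j\<le>d. \<Sum>k\<le>Suc d - j. c j k * s ^ j * t ^ k)"
    unfolding poly2_def using assms[of "Suc d"] by simp
  also have "\<dots> = poly2 d c s t"
    unfolding poly2_def
  proof (rule sum.cong)
    fix j assume "j \<in> {..d}"
    then show "(\<Sum>k\<le>Suc d - j. c j k * s ^ j * t ^ k) = (\<Sum>k\<le>d - j. c j k * s ^ j * t ^ k)"
      using assms[of j] by (simp add: Suc_diff_le)
  qed simp
  finally show ?thesis .
qed

context frame
begin

text \<open>The case \<open>a = 1\<close>, \<open>b = 0\<close> and the case \<open>a = 0\<close>, \<open>b = 1\<close> are the two coefficients of a section in the
  chart \<open>r = 1\<close>. The growth of a section allows the degree \<open>d + 1\<close>; the zeros at the points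
  \<open>(p i : q i)\<close> lower it to \<open>d\<close>.\<close>

lemma chart_polynomial:
  assumes f: "f \<in> sections 1 d" and ab: "a \<noteq> 0 \<or> b \<noteq> 0"
    and J: "finite J" "card J \<ge> d + 2"
    and np: "\<And>i j. i \<in> J \<Longrightarrow> j \<in> J \<Longrightarrow> i \<noteq> j \<Longrightarrow> p i * q j \<noteq> p j * q i"
    and z: "\<And>i c. i \<in> J \<Longrightarrow> f (xvec 0 0 c, yvec (p i) (q i) 0) = 0"
  shows "\<exists>c. \<forall>s t. f (xvec a b (- (a * s + b * t)), yvec s t 1) = poly2 d c s t"
proof -
  define g where "g s t = f (xvec a b (- (a * s + b * t)), yvec s t 1)" for s t
  have cone: "(xvec a b (- (a * s + b * t)), yvec s t 1) \<in> flag_cone" for s t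
    using ab by (auto simp: cone_iff)
  obtain C where C: "C \<ge> 0" "\<And>x y. (x, y) \<in> flag_cone \<Longrightarrow> cmod (f (x, y)) \<le> C * norm x ^ 1 * norm y ^ d"
    using section_bound[OF f] by blast
  obtain M where M: "M \<ge> 0" "\<And>a b c R. cmod a \<le> R \<Longrightarrow> cmod b \<le> R \<Longrightarrow> cmod c \<le> R \<Longrightarrow> norm (xvec a b c) \<le> M * R \<and> norm (yvec a b c) \<le> M * R"
    using norm_xvec_le by blast
  define N where "N = 1 + cmod a + cmod b"
  have bound: "cmod (g s t) \<le> (C * (M * N) * (M * N) ^ d) * (1 + cmod s + cmod t) ^ Suc d" for s t
  proof -
    let ?R = "1 + cmod s + cmod t"
    have N1: "N \<ge> 1" by (simp add: N_def)
    have "cmod a \<le> N * ?R" "cmod b \<le> N * ?R" unfolding N_def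
      by (simp_all add: algebra_simps add_increasing add_increasing2)
    moreover have "cmod (- (a * s + b * t)) \<le> N * ?R"
    proof -
      have "cmod (a * s + b * t) \<le> cmod a * cmod s + cmod b * cmod t"
        by (metis norm_mult norm_triangle_ineq)
      also have "\<dots> \<le> N * cmod s + N * cmod t" unfolding N_def by (intro add_mono mult_right_mono) auto
      also have "\<dots> \<le> N * ?R" using N1 by (simp add: distrib_left)
      finally show ?thesis by (simp only: norm_minus_cancel)
    qed
    ultimately have x: "norm (xvec a b (- (a * s + b * t))) \<le> M * (N * ?R)" using M(2) by blast
    have "?R \<le> N * ?R" using N1 mult_right_mono[of 1 N ?R] by simp
    then have "cmod s \<le> N * ?R" "cmod t \<le> N * ?R" "cmod 1 \<le> N * ?R" 
      by (smt (verit) norm_ge_zero norm_one)+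
    then have y: "norm (yvec s t 1) \<le> M * (N * ?R)" using M(2) by blast
    have "cmod (g s t) \<le> C * norm (xvec a b (- (a * s + b * t))) ^ 1 * norm (yvec s t 1) ^ d"
      unfolding g_def by (rule C(2)[OF cone])
    also have "\<dots> \<le> C * (M * (N * ?R)) ^ 1 * (M * (N * ?R)) ^ d"
      using x y C(1) M(1) N1 by (intro mult_mono power_mono mult_nonneg_nonneg zero_le_power) auto
    finally show ?thesis by (simp add: power_mult_distrib mult_ac)
  qed
  have "\<exists>c. \<forall>s t. g s t = poly2 (Suc d) c s t"
  proof (rule Liouville_poly2[OF _ _ bound])
    show "(\<lambda>s. g s t) holomorphic_on UNIV" for t
      unfolding g_def by (rule section_holomorphic[OF f _ _ cone])
        (intro poly_curve_xvec poly_curve_yvec poly_fun_const poly_fun_minus poly_fun_add poly_fun_mult poly_fun_id)+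
    show "(\<lambda>t. g s t) holomorphic_on UNIV" for s
      unfolding g_def by (rule section_holomorphic[OF f _ _ cone])
        (intro poly_curve_xvec poly_curve_yvec poly_fun_const poly_fun_minus poly_fun_add poly_fun_mult poly_fun_id)+
  qed
  then obtain c where c: "\<And>s t. g s t = poly2 (Suc d) c s t" by blast
  \<comment> \<open>Rescaling by \<open>e\<close> and letting \<open>e\<close> tend to \<open>0\<close> identifies the leading form of the chart
    polynomial with a value of \<open>f\<close> at \<open>r = 0\<close>.\<close>
  have top: "ternary (Suc d) c (p i) (q i) 0 = 0" if i: "i \<in> J" for i
  proof -
    define s where "s = p i"
    define t where "t = q i"
    have st: "s \<noteq> 0 \<or> t \<noteq> 0"
    proof -
      have "J - {i} \<noteq> {}"
      proof
        assume "J - {i} = {}"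
        then have "J = {i}" using i by auto
        then show False using J(2) by simp
      qed
      then obtain j where "j \<in> J" "j \<noteq> i" by auto
      then show ?thesis using np[of i j] i by (auto simp: s_def t_def)
    qed
    have tc: "continuous_on UNIV (\<lambda>e. ternary (Suc d) c s t e)"
      by (intro holomorphic_on_imp_continuous_on poly_fun_holomorphic poly_fun_ternary poly_fun_const poly_fun_id)
    define m where "m = - (a * s + b * t)"
    have k: "f (xvec (a * e) (b * e) m, yvec s t e) = ternary (Suc d) c s t e" if "e \<noteq> 0" for e
    proof -
      have "(xvec a b (- (a * (s / e) + b * (t / e))), yvec (s / e) (t / e) 1) \<in> flag_cone" by (rule cone)
      from section_scale[OF f this that that]
      have "f (xvec (e * a) (e * b) (e * (- (a * (s / e) + b * (t / e)))), yvec (e * (s / e)) (e * (t / e)) (e * 1))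
          = e ^ 1 * e ^ d * g (s / e) (t / e)"
        unfolding scale_xvec scale_yvec g_def .
      moreover have "e * (- (a * (s / e) + b * (t / e))) = m" "e * (s / e) = s" "e * (t / e) = t"
        using that by (simp_all add: m_def field_simps)
      ultimately show ?thesis unfolding ternary_dehomogenize[OF that] c by (simp add: mult.commute)
    qed
    \<comment> \<open>For \<open>m = 0\<close> the vector \<open>x\<close> tends to \<open>0\<close>, which is not in the cone, but \<open>f\<close> is
      homogeneous in \<open>x\<close>.\<close>
    show ?thesis
    proof (cases "m = 0")
      case False
      have "continuous_on UNIV (\<lambda>e. f (xvec (a * e) (b * e) m, yvec s t e))"
        by (rule holomorphic_on_imp_continuous_on, rule section_holomorphic[OF f])
          (use False st in \<open>auto simp: cone_iff m_def algebra_simps intro!: poly_curve_xvec poly_curve_yvec\<close>)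
      from continuous_eq_at_0[OF this tc k] show ?thesis
        using z[OF i, of m] by (simp add: s_def t_def)
    next
      case True
      have cn: "(xvec a b 0, yvec s t e) \<in> flag_cone" for e
      proof -
        have "a * s + b * t = 0" using True by (simp only: m_def neg_equal_0_iff_equal)
        then show ?thesis using ab st by (auto simp: cone_iff)
      qed
      have "continuous_on UNIV (\<lambda>e. f (xvec a b 0, yvec s t e))"
        by (rule holomorphic_on_imp_continuous_on, rule section_holomorphic[OF f _ _ cn])
          (intro poly_curve_xvec poly_curve_yvec poly_fun_const poly_fun_id)+
      then have "continuous_on UNIV (\<lambda>e. e * f (xvec a b 0, yvec s t e))" by (intro continuous_intros)
      moreover have "e * f (xvec a b 0, yvec s t e) = ternary (Suc d) c s t e" if "e \<noteq> 0" for e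
        using k[OF that] section_scale[OF f cn that one_neq_zero, of e] True
        by (simp add: scale_xvec mult.commute)
      ultimately show ?thesis using continuous_eq_at_0[OF _ tc] by (fastforce simp: s_def t_def)
    qed
  qed
  have "c j (Suc d - j) = 0" if "j \<le> Suc d" for j
    by (rule binary_form_zero[OF J(1) _ np, of "Suc d"]) (use J(2) top that in \<open>auto simp: ternary_at_0\<close>)
  then have "g s t = poly2 d c s t" for s t unfolding c by (rule poly2_Suc)
  then show ?thesis unfolding g_def by blast
qed

lemma section_formula:
  assumes f: "f \<in> sections 1 d"
    and J: "finite J" "card J \<ge> d + 2"
    and np: "\<And>i j. i \<in> J \<Longrightarrow> j \<in> J \<Longrightarrow> i \<noteq> j \<Longrightarrow> p i * q j \<noteq> p j * q i"
    and z: "\<And>i c. i \<in> J \<Longrightarrow> f (xvec 0 0 c, yvec (p i) (q i) 0) = 0"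
  shows "\<exists>cA cB. \<forall>a b c s t r. (xvec a b c, yvec s t r) \<in> flag_cone \<longrightarrow>
    f (xvec a b c, yvec s t r) = a * ternary d cA s t r + b * ternary d cB s t r"
proof -
  have chart: "\<exists>c. \<forall>s t. f (xvec a b (- (a * s + b * t)), yvec s t 1) = poly2 d c s t"
    if "a \<noteq> 0 \<or> b \<noteq> 0" for a b
    by (rule chart_polynomial[where p = p and q = q, OF f that J]) (rule np z; assumption)+
  obtain cA where cA: "\<And>s t. f (xvec 1 0 (- (1 * s + 0 * t)), yvec s t 1) = poly2 d cA s t"
    using chart[of 1 0] zero_neq_one by metis
  obtain cB where cB: "\<And>s t. f (xvec 0 1 (- (0 * s + 1 * t)), yvec s t 1) = poly2 d cB s t"
    using chart[of 0 1] zero_neq_one by metis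
  have main: "f (xvec a b c, yvec s t r) = a * ternary d cA s t r + b * ternary d cB s t r"
    if cone: "(xvec a b c, yvec s t r) \<in> flag_cone" and r: "r \<noteq> 0" for a b c s t r
  proof -
    define s' where "s' = s / r"
    define t' where "t' = t / r"
    have c: "c = - (a * s' + b * t')"
      using cone r by (simp add: cone_iff s'_def t'_def field_simps eq_neg_iff_add_eq_0)
    have ab: "a \<noteq> 0 \<or> b \<noteq> 0" using cone c by (auto simp: cone_iff)
    have cone': "(xvec a b c, yvec s' t' 1) \<in> flag_cone" using ab c by (auto simp: cone_iff)
    have "f (xvec a b c, yvec s t r) = f (1 *s xvec a b c, r *s yvec s' t' 1)"
      unfolding scale_xvec scale_yvec s'_def t'_def using r by simp
    also have "\<dots> = r ^ d * f (xvec a b c, yvec s' t' 1)"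
      using section_scale[OF f cone' one_neq_zero r] by simp
    also have "f (xvec a b c, yvec s' t' 1) = a * poly2 d cA s' t' + b * poly2 d cB s' t'"
    proof -
      have "xvec a b c = a *s xvec 1 0 (- s') + b *s xvec 0 1 (- t')"
        unfolding scale_xvec add_xvec c by (simp add: xvec_eq_iff)
      moreover have "f (a *s xvec 1 0 (- s') + b *s xvec 0 1 (- t'), yvec s' t' 1)
          = a * f (xvec 1 0 (- s'), yvec s' t' 1) + b * f (xvec 0 1 (- t'), yvec s' t' 1)"
        by (rule section_linear_in_x[OF f])
          (auto simp: yvec_eq_0 dot3_xvec_yvec scale_xvec add_xvec xvec_eq_0)
      ultimately show ?thesis using cA[of s' t'] cB[of s' t'] by simp
    qed
    finally show ?thesis
      unfolding ternary_dehomogenize[OF r] s'_def t'_def by (simp add: algebra_simps)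
  qed
  have "f (xvec a b c, yvec s t r) = a * ternary d cA s t r + b * ternary d cB s t r"
    if cone: "(xvec a b c, yvec s t r) \<in> flag_cone" for a b c s t r
  proof (cases "r = 0")
    case r: True
    \<comment> \<open>Deform the point into the chart along a line in the flag threefold.\<close>
    have ext: ?thesis
      if ll: "l1 * s + l2 * t + c = 0" and nz: "\<And>e. \<not> (a + l1 * e = 0 \<and> b + l2 * e = 0 \<and> c = 0)" for l1 l2
    proof -
      have st: "s \<noteq> 0 \<or> t \<noteq> 0" "a * s + b * t = 0" using cone r by (auto simp: cone_iff)
      have cn: "(xvec (a + l1 * e) (b + l2 * e) c, yvec s t e) \<in> flag_cone" for e
      proof -
        have "(a + l1 * e) * s + (b + l2 * e) * t + c * e = (a * s + b * t) + e * (l1 * s + l2 * t + c)"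
          by (simp add: algebra_simps)
        then show ?thesis unfolding cone_iff using st nz[of e] ll by auto
      qed
      have "continuous_on UNIV (\<lambda>e. f (xvec (a + l1 * e) (b + l2 * e) c, yvec s t e))"
        by (rule holomorphic_on_imp_continuous_on, rule section_holomorphic[OF f _ _ cn])
          (intro poly_curve_xvec poly_curve_yvec poly_fun_const poly_fun_id poly_fun_add poly_fun_mult)+
      moreover have "continuous_on UNIV (\<lambda>e. (a + l1 * e) * ternary d cA s t e + (b + l2 * e) * ternary d cB s t e)"
        by (intro holomorphic_on_imp_continuous_on poly_fun_holomorphic poly_fun_add poly_fun_mult poly_fun_ternary poly_fun_const poly_fun_id)
      ultimately show ?thesis using continuous_eq_at_0[OF _ _ main[OF cn]] r by fastforce
    qed
    show ?thesis
    proof (cases "s = 0")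
      case False
      have "\<not> (a + - c / s * e = 0 \<and> b + 0 * e = 0 \<and> c = 0)" for e
        using cone by (auto simp: cone_iff)
      then show ?thesis by (rule ext[rotated]) (use False in simp)
    next
      case True
      then have "t \<noteq> 0" using cone r by (auto simp: cone_iff)
      have "\<not> (a + 0 * e = 0 \<and> b + - c / t * e = 0 \<and> c = 0)" for e
        using cone by (auto simp: cone_iff)
      then show ?thesis by (rule ext[rotated]) (use \<open>t \<noteq> 0\<close> in simp)
    qed
  qed (rule main[OF cone])
  then show ?thesis by blast
qed

end

section \<open>Building bihomogeneous polynomials\<close>

lemma finite_exponents: "finite {\<alpha> :: 3 \<Rightarrow> nat. sum \<alpha> UNIV = a}"
proof (rule finite_subset)
  show "{\<alpha> :: 3 \<Rightarrow> nat. sum \<alpha> UNIV = a} \<subseteq> PiE UNIV (\<lambda>_. {..a})"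
    by (auto simp: PiE_def member_le_sum)
  show "finite (PiE (UNIV :: 3 set) (\<lambda>_. {..a}))" by (rule finite_PiE) auto
qed

lemma bihomogeneous_add:
  assumes "bihomogeneous a b P" "bihomogeneous a b Q"
  shows "bihomogeneous a b (\<lambda>z. P z + Q z)"
proof -
  obtain c where c: "\<And>x y. P (x, y) = bipoly a b c x y"
    using assms(1) unfolding bihomogeneous_def by blast
  obtain e where e: "\<And>x y. Q (x, y) = bipoly a b e x y"
    using assms(2) unfolding bihomogeneous_def by blast
  show ?thesis unfolding bihomogeneous_def
    by (rule exI[of _ "\<lambda>\<alpha> \<beta>. c \<alpha> \<beta> + e \<alpha> \<beta>"]) (simp add: c e sum.distrib distrib_right)
qed

lemma bihomogeneous_zero: "bihomogeneous a b (\<lambda>z. 0)"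
  unfolding bihomogeneous_def by (rule exI[of _ "\<lambda>_ _. 0"]) simp

lemma bihomogeneous_sum:
  assumes "\<And>i. i \<in> I \<Longrightarrow> bihomogeneous a b (P i)"
  shows "bihomogeneous a b (\<lambda>z. \<Sum>i\<in>I. P i z)"
  using assms
  by (induction I rule: infinite_finite_induct) (auto intro: bihomogeneous_zero bihomogeneous_add)

lemma bihomogeneous_monomial:
  fixes P :: "(complex^3) \<times> (complex^3) \<Rightarrow> complex"
  assumes "sum \<alpha> UNIV = a" "sum \<beta> UNIV = b"
    and P: "\<And>x y. P (x, y) = k * (\<Prod>i\<in>UNIV. x $ i ^ \<alpha> i) * (\<Prod>i\<in>UNIV. y $ i ^ \<beta> i)"
  shows "bihomogeneous a b P"
  unfolding bihomogeneous_def
proof (intro exI[of _ "\<lambda>\<alpha>' \<beta>'. if \<alpha>' = \<alpha> \<and> \<beta>' = \<beta> then k else 0"] allI)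
  fix x y :: "complex^3"
  let ?m = "\<lambda>\<alpha> \<beta>. (\<Prod>i\<in>UNIV. x $ i ^ \<alpha> i) * (\<Prod>i\<in>UNIV. y $ i ^ \<beta> i)"
  have "(\<Sum>\<alpha>' | sum \<alpha>' UNIV = a. \<Sum>\<beta>' | sum \<beta>' UNIV = b.
      (if \<alpha>' = \<alpha> \<and> \<beta>' = \<beta> then k else 0) * (\<Prod>i\<in>UNIV. x $ i ^ \<alpha>' i) * (\<Prod>i\<in>UNIV. y $ i ^ \<beta>' i))
    = (\<Sum>\<alpha>' | sum \<alpha>' UNIV = a. if \<alpha>' = \<alpha> then k * ?m \<alpha> \<beta> else 0)"
  proof (rule sum.cong[OF refl])
    fix \<alpha>' :: "3 \<Rightarrow> nat"
    have "(\<Sum>\<beta>' | sum \<beta>' UNIV = b. (if \<alpha>' = \<alpha> \<and> \<beta>' = \<beta> then k else 0) * (\<Prod>i\<in>UNIV. x $ i ^ \<alpha>' i) * (\<Prod>i\<in>UNIV. y $ i ^ \<beta>' i))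
      = (\<Sum>\<beta>' | sum \<beta>' UNIV = b. if \<beta>' = \<beta> then (if \<alpha>' = \<alpha> then k * ?m \<alpha> \<beta> else 0) else 0)"
      by (intro sum.cong) auto
    then show "(\<Sum>\<beta>' | sum \<beta>' UNIV = b. (if \<alpha>' = \<alpha> \<and> \<beta>' = \<beta> then k else 0) * (\<Prod>i\<in>UNIV. x $ i ^ \<alpha>' i) * (\<Prod>i\<in>UNIV. y $ i ^ \<beta>' i))
      = (if \<alpha>' = \<alpha> then k * ?m \<alpha> \<beta> else 0)"
      using assms(2) by (simp add: finite_exponents)
  qed
  then show "P (x, y) = (\<Sum>\<alpha>' | sum \<alpha>' UNIV = a. \<Sum>\<beta>' | sum \<beta>' UNIV = b.
      (if \<alpha>' = \<alpha> \<and> \<beta>' = \<beta> then k else 0) * (\<Prod>i\<in>UNIV. x $ i ^ \<alpha>' i) * (\<Prod>i\<in>UNIV. y $ i ^ \<beta>' i))"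
    using assms(1) by (simp add: finite_exponents P)
qed

lemma bihomogeneous_const: "bihomogeneous 0 0 (\<lambda>z. k)"
  by (rule bihomogeneous_monomial[of "\<lambda>_. 0" _ "\<lambda>_. 0" _ _ k]) auto

lemma bihomogeneous_mult:
  assumes "bihomogeneous a b P" "bihomogeneous a' b' Q"
  shows "bihomogeneous (a + a') (b + b') (\<lambda>z. P z * Q z)"
proof -
  obtain c where c: "\<And>x y. P (x, y) = bipoly a b c x y"
    using assms(1) unfolding bihomogeneous_def by blast
  obtain e where e: "\<And>x y. Q (x, y) = bipoly a' b' e x y"
    using assms(2) unfolding bihomogeneous_def by blast
  have "(\<lambda>z. P z * Q z) = (\<lambda>z. \<Sum>\<alpha>' | sum \<alpha>' UNIV = a'. \<Sum>\<beta>' | sum \<beta>' UNIV = b'. \<Sum>\<alpha> | sum \<alpha> UNIV = a. \<Sum>\<beta> | sum \<beta> UNIV = b.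
     (c \<alpha> \<beta> * (\<Prod>i\<in>UNIV. fst z $ i ^ \<alpha> i) * (\<Prod>i\<in>UNIV. snd z $ i ^ \<beta> i)) *
     (e \<alpha>' \<beta>' * (\<Prod>i\<in>UNIV. fst z $ i ^ \<alpha>' i) * (\<Prod>i\<in>UNIV. snd z $ i ^ \<beta>' i)))"
    by (auto simp: fun_eq_iff c e sum_distrib_left sum_distrib_right)
  moreover have "bihomogeneous (a + a') (b + b') (\<lambda>z.
     (k * (\<Prod>i\<in>UNIV. fst z $ i ^ \<alpha> i) * (\<Prod>i\<in>UNIV. snd z $ i ^ \<beta> i)) *
     (k' * (\<Prod>i\<in>UNIV. fst z $ i ^ \<alpha>' i) * (\<Prod>i\<in>UNIV. snd z $ i ^ \<beta>' i)))"
    if "sum \<alpha> UNIV = a" "sum \<beta> UNIV = b" "sum \<alpha>' UNIV = a'" "sum \<beta>' UNIV = b'"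
    for k k' and \<alpha> \<beta> \<alpha>' \<beta>' :: "3 \<Rightarrow> nat"
    by (rule bihomogeneous_monomial[of "\<lambda>i. \<alpha> i + \<alpha>' i" _ "\<lambda>i. \<beta> i + \<beta>' i" _ _ "k * k'"])
       (use that in \<open>auto simp: sum.distrib power_add prod.distrib\<close>)
  ultimately show ?thesis by (simp only:) (intro bihomogeneous_sum, auto)
qed

lemma bihomogeneous_power:
  "bihomogeneous a b P \<Longrightarrow> bihomogeneous (n * a) (n * b) (\<lambda>z. P z ^ n)"
proof (induction n)
  case 0 show ?case using bihomogeneous_const by simp
next
  case (Suc n)
  from bihomogeneous_mult[OF Suc.prems Suc.IH[OF Suc.prems]] show ?case by simp
qed

lemma bihomogeneous_linear:
  "bihomogeneous 1 0 (\<lambda>z. dot3 (fst z) u)" "bihomogeneous 0 1 (\<lambda>z. dot3 v (snd z))"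
proof -
  have e: "(\<Prod>i\<in>UNIV. z $ i ^ (if i = j then 1 else 0)) = z $ j" for j and z :: "complex^3"
  proof -
    have "(\<Prod>i\<in>UNIV. z $ i ^ (if i = j then 1 else 0)) = (\<Prod>i\<in>UNIV. if i = j then z $ i else 1)"
      by (intro prod.cong) auto
    then show ?thesis by simp
  qed
  have "bihomogeneous 1 0 (\<lambda>z. fst z $ j * u $ j)" for j
    by (rule bihomogeneous_monomial[of "\<lambda>i. if i = j then 1 else 0" _ "\<lambda>_. 0" _ _ "u $ j"])
       (simp_all only: e, simp_all)
  then show "bihomogeneous 1 0 (\<lambda>z. dot3 (fst z) u)"
    unfolding dot3_def by (intro bihomogeneous_sum)
  have "bihomogeneous 0 1 (\<lambda>z. v $ j * snd z $ j)" for j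
    by (rule bihomogeneous_monomial[of "\<lambda>_. 0" _ "\<lambda>i. if i = j then 1 else 0" _ _ "v $ j"])
       (simp_all only: e, simp_all)
  then show "bihomogeneous 0 1 (\<lambda>z. dot3 v (snd z))"
    unfolding dot3_def by (intro bihomogeneous_sum)
qed

definition on_cone :: "((complex^3) \<times> (complex^3) \<Rightarrow> complex) \<Rightarrow> (complex^3) \<times> (complex^3) \<Rightarrow> complex"
  where "on_cone P z = (if z \<in> flag_cone then P z else 0)"

lemma bihomogeneous_section:
  assumes "bihomogeneous a b P"
  shows "on_cone P \<in> sections a b"
  unfolding sections_def
proof (intro CollectI conjI ballI allI impI)
  fix z assume z: "z \<in> flag_cone"
  show "\<exists>m n R Q. bihomogeneous (a + m) (b + n) R \<and> bihomogeneous m n Q \<and> Q z \<noteq> 0 \<and>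
      (\<forall>w\<in>flag_cone. Q w \<noteq> 0 \<longrightarrow> on_cone P w = R w / Q w)"
    by (rule exI[of _ 0], rule exI[of _ 0], rule exI[of _ P], rule exI[of _ "\<lambda>_. 1"])
       (use assms bihomogeneous_const in \<open>auto simp: on_cone_def\<close>)
qed (simp add: on_cone_def)

section \<open>A nonzero resultant makes the surface irreducible\<close>

text \<open>The restriction of a ternary form to the line \<open>(1 : t : e)\<close> through \<open>(0 : 1 : 0)\<close>, as a polynomial in
  \<open>t\<close>; for \<open>e = 0\<close> this is the line \<open>r = 0\<close>.\<close>

definition top_poly :: "nat \<Rightarrow> (nat \<Rightarrow> nat \<Rightarrow> complex) \<Rightarrow> complex \<Rightarrow> complex poly"
  where "top_poly d c e = (\<Sum>j\<le>d. \<Sum>k\<le>d - j. monom (c j k * e ^ (d - j - k)) k)"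

lemma poly_top_poly: "poly (top_poly d c e) t = ternary d c 1 t e"
  unfolding top_poly_def ternary_def by (simp add: poly_sum poly_monom mult_ac)

lemma coeff_top_poly_eq:
  "coeff (top_poly d c e) i = (\<Sum>j\<le>d. \<Sum>k\<le>d - j. if k = i then c j k * e ^ (d - j - k) else 0)"
  unfolding top_poly_def coeff_sum coeff_monom ..

lemma degree_top_poly: "degree (top_poly d c e) \<le> d"
  by (rule degree_le) (auto simp: coeff_top_poly_eq intro!: sum.neutral)

lemma poly_fun_coeff_top_poly: "poly_fun (\<lambda>e. coeff (top_poly d c e) i)"
proof -
  have "poly_fun (\<lambda>e. if k = i then c j k * e ^ (d - j - k) else 0)" for j k
  proof (cases "k = i")
    case True
    have "poly_fun (\<lambda>e. c j k * e ^ (d - j - k))"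
      by (intro poly_fun_mult poly_fun_const poly_fun_power poly_fun_id)
    then show ?thesis by (simp only: True simp_thms if_True)
  next
    case False
    then show ?thesis using poly_fun_const[of 0] by (simp only: if_False)
  qed
  then show ?thesis unfolding coeff_top_poly_eq by (intro poly_fun_sum)
qed

lemma coeff_top_poly_0: "i \<le> d \<Longrightarrow> coeff (top_poly d c 0) i = c (d - i) i"
proof -
  assume i: "i \<le> d"
  have "(\<Sum>k\<le>d - j. if k = i then c j k * 0 ^ (d - j - k) else 0) = (if j = d - i then c j i else 0)"
    if "j \<le> d" for j
    using that i by (cases "i \<le> d - j") (auto simp: power_0_left)
  then show ?thesis unfolding coeff_top_poly_eq using i by simp
qed

lemma coeff_top_poly_top: "coeff (top_poly d c e) d = c 0 d"
proof -
  have "(\<Sum>k\<le>d - j. if k = d then c j k * e ^ (d - j - k) else 0) = (if j = 0 then c 0 d else 0)"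
    if "j \<le> d" for j
    using that by (cases "j = 0") auto
  then show ?thesis unfolding coeff_top_poly_eq by simp
qed

lemma ternary_scale: "ternary d c (m * s) (m * t) (m * r) = m ^ d * ternary d c s t r"
proof -
  have "c j k * (m * s) ^ j * (m * t) ^ k * (m * r) ^ (d - j - k) = m ^ d * (c j k * s ^ j * t ^ k * r ^ (d - j - k))"
    if "j \<le> d" "k \<le> d - j" for j k
  proof -
    have "m ^ d = m ^ j * m ^ k * m ^ (d - j - k)" using that by (simp add: power_add[symmetric])
    then show ?thesis by (simp add: power_mult_distrib)
  qed
  then show ?thesis unfolding ternary_def sum_distrib_left by (intro sum.cong refl) auto
qed

lemma ternary_0_1: "ternary d c 0 1 0 = c 0 d"
proof -
  have "(\<Sum>j\<le>d. c j (d - j) * 0 ^ j * 1 ^ (d - j)) = (\<Sum>j\<in>{0}. c j (d - j) * 0 ^ j * 1 ^ (d - j))"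
    by (rule sum.mono_neutral_right) auto
  then show ?thesis unfolding ternary_at_0 by simp
qed

context frame
begin

text \<open>The vector written \<open>w y\<close> before: the section is \<open>dot3 x (dir d cA cB y)\<close>.\<close>

definition dir :: "nat \<Rightarrow> (nat \<Rightarrow> nat \<Rightarrow> complex) \<Rightarrow> (nat \<Rightarrow> nat \<Rightarrow> complex) \<Rightarrow> complex^3 \<Rightarrow> complex^3"
  where "dir d cA cB y =
    ternary d cA (dot3 (cnj3 u0) y) (dot3 (cnj3 u1) y) (dot3 (cnj3 u2) y) *s u0 +
    ternary d cB (dot3 (cnj3 u0) y) (dot3 (cnj3 u1) y) (dot3 (cnj3 u2) y) *s u1"

lemma dir_yvec: "dir d cA cB (yvec s t r) = yvec (ternary d cA s t r) (ternary d cB s t r) 0"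
  unfolding dir_def dot3_yvec by (simp add: yvec_def)

lemma poly_map_dir: "poly_map (dir d cA cB)"
  unfolding poly_map_def
proof (intro conjI allI impI)
  show "continuous_on UNIV (dir d cA cB)"
    unfolding dir_def ternary_def by (intro continuous_intros)
  show "poly_curve (\<lambda>u. dir d cA cB (\<gamma> u))" if "poly_curve \<gamma>" for \<gamma>
    unfolding dir_def
    by (intro poly_curve_add poly_curve_scale poly_fun_ternary poly_fun_dot3 poly_curve_const that)
qed

text \<open>A common zero of the two forms with \<open>s \<noteq> 0\<close> lies on a line \<open>(1 : t : e)\<close> on which their resultant
  vanishes. The resultant is a polynomial in \<open>e\<close> that is nonzero at \<open>e = 0\<close>, so there are finitely many
  such lines. Neither they nor the line \<open>s = 0\<close> are contained in the zero set, because \<open>(0 : 1 : 0)\<close> is not a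
  common zero. The other degenerate points satisfy \<open>r = 0\<close> and \<open>s * B = t * A\<close>, and if this held
  identically, it would be a syzygy of degree \<open>1 < d\<close>.\<close>

lemma dir_degenerate_finite:
  assumes d: "d \<ge> 2" and res: "res d (top_poly d cA 0) (top_poly d cB 0) \<noteq> 0"
  shows "\<exists>K. finite K \<and> 0 \<notin> K \<and>
    (\<forall>y. y \<noteq> 0 \<longrightarrow> cross y (dir d cA cB y) = 0 \<longrightarrow> (\<exists>k\<in>K. \<exists>c. y = c *s k))"
proof -
  define E where "E = {e. res d (top_poly d cA e) (top_poly d cB e) = 0}"
  have "finite E" unfolding E_def
    by (rule poly_fun_zeros_finite[where g = "\<lambda>e. res d (top_poly d cA e) (top_poly d cB e)", OF poly_fun_res res])
       (rule poly_fun_coeff_top_poly)+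
  have nz: "cA 0 d \<noteq> 0 \<or> cB 0 d \<noteq> 0"
    using res_common_infinity[of d "top_poly d cA 0" "top_poly d cB 0"] res d degree_top_poly
    by (auto simp: coeff_top_poly_top)
  define T where "T e = {t. poly (top_poly d cA e) t = 0 \<and> poly (top_poly d cB e) t = 0}" for e
  have "finite (T e)" for e
  proof -
    have "top_poly d cA e \<noteq> 0 \<or> top_poly d cB e \<noteq> 0"
      using nz coeff_top_poly_top[of d cA e] coeff_top_poly_top[of d cB e] by auto
    then have "finite {t. poly (top_poly d cA e) t = 0} \<or> finite {t. poly (top_poly d cB e) t = 0}"
      using poly_roots_finite by blast
    then show ?thesis unfolding T_def by (auto elim: rev_finite_subset)
  qed
  define R where "R = {r. ternary d cA 0 1 r = 0 \<and> ternary d cB 0 1 r = 0}"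
  have "finite R"
  proof -
    have pf: "poly_fun (\<lambda>r. ternary d c 0 1 r)" for c by (intro poly_fun_ternary poly_fun_const poly_fun_id)
    have "finite {r. ternary d cA 0 1 r = 0} \<or> finite {r. ternary d cB 0 1 r = 0}"
      using nz poly_fun_zeros_finite[OF pf, of _ 0] by (auto simp: ternary_0_1)
    then show ?thesis unfolding R_def by (auto elim: rev_finite_subset)
  qed
  define Q where "Q = {t. poly (top_poly d cB 0 - [:0, 1:] * top_poly d cA 0) t = 0}"
  have "finite Q" unfolding Q_def
  proof (rule poly_roots_finite, rule notI)
    assume "top_poly d cB 0 - [:0, 1:] * top_poly d cA 0 = 0"
    then have "(- [:0, 1:]) * top_poly d cA 0 + 1 * top_poly d cB 0 = 0" by simp
    then have "res d (top_poly d cA 0) (top_poly d cB 0) = 0"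
      using d by (intro res_zero_if_syzygy[of "- [:0, 1:]" d 1]) auto
    with res show False by simp
  qed
  define K where "K = (\<Union>e\<in>E. (\<lambda>t. yvec 1 t e) ` T e) \<union> (\<lambda>r. yvec 0 1 r) ` R \<union>
     (\<lambda>t. yvec 1 t 0) ` Q \<union> {yvec 0 0 1, yvec 0 1 0}"
  have "finite K" unfolding K_def
    using \<open>finite E\<close> \<open>\<And>e. finite (T e)\<close> \<open>finite R\<close> \<open>finite Q\<close> by simp
  moreover have "0 \<notin> K" unfolding K_def by (auto simp: yvec_eq_0 dest!: sym[of 0])
  moreover have "\<exists>k\<in>K. \<exists>c. y = c *s k" if y: "y \<noteq> 0" "cross y (dir d cA cB y) = 0" for y
  proof -
    obtain s t r where str: "y = yvec s t r" using yvec_coords by blast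
    define \<alpha> where "\<alpha> = ternary d cA s t r"
    define \<beta> where "\<beta> = ternary d cB s t r"
    have w: "dir d cA cB y = yvec \<alpha> \<beta> 0" unfolding str dir_yvec \<alpha>_def \<beta>_def ..
    have hom: "ternary d c s t r = s ^ d * poly (top_poly d c (r / s)) (t / s)" if "s \<noteq> 0" for c
      using ternary_scale[of d c s 1 "t / s" "r / s"] that by (simp add: poly_top_poly)
    have ys: "y = s *s yvec 1 (t / s) (r / s)" if "s \<noteq> 0"
      unfolding str scale_yvec using that by simp
    show ?thesis
    proof (cases "\<alpha> = 0 \<and> \<beta> = 0")
      case True
      consider "s \<noteq> 0" | "s = 0" "t \<noteq> 0" | "s = 0" "t = 0" by blast
      then show ?thesis
      proof cases
        case 1
        have z: "poly (top_poly d cA (r / s)) (t / s) = 0" "poly (top_poly d cB (r / s)) (t / s) = 0"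
          using True 1 hom[OF 1] unfolding \<alpha>_def \<beta>_def by auto
        then have "r / s \<in> E" unfolding E_def
          using d by (auto intro: res_common_root degree_top_poly)
        moreover have "t / s \<in> T (r / s)" using z by (simp add: T_def)
        ultimately have "yvec 1 (t / s) (r / s) \<in> K" unfolding K_def by blast
        with ys[OF 1] show ?thesis by blast
      next
        case 2
        have "ternary d c 0 1 (r / t) = 0" if "ternary d c s t r = 0" for c
          using ternary_scale[of d c t 0 1 "r / t"] 2 that by simp
        then have "r / t \<in> R" using True by (simp add: R_def \<alpha>_def \<beta>_def)
        then have "yvec 0 1 (r / t) \<in> K" unfolding K_def by blast
        moreover have "y = t *s yvec 0 1 (r / t)" unfolding str scale_yvec using 2 by simp
        ultimately show ?thesis by blast
      next
        case 3
        then have "y = r *s yvec 0 0 1" unfolding str scale_yvec by simp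
        then show ?thesis unfolding K_def by blast
      qed
    next
      case False
      then have "yvec \<alpha> \<beta> 0 \<noteq> 0" by (auto simp: yvec_eq_0)
      then obtain k where "y = k *s yvec \<alpha> \<beta> 0" using cross_zero_imp y(2) w by metis
      then have k: "s = k * \<alpha>" "t = k * \<beta>" "r = 0" unfolding str scale_yvec yvec_eq_iff by auto
      show ?thesis
      proof (cases "s = 0")
        case True
        then have "y = t *s yvec 0 1 0" unfolding str scale_yvec using k(3) by simp
        then show ?thesis unfolding K_def by blast
      next
        case s: False
        have "s * \<beta> = t * \<alpha>" using k by simp
        then have "s * poly (top_poly d cB 0) (t / s) = t * poly (top_poly d cA 0) (t / s)"
          using hom[OF s] s k(3) unfolding \<alpha>_def \<beta>_def by simp
        then have "t / s \<in> Q" unfolding Q_def using s by (simp add: field_simps)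
        then have "yvec 1 (t / s) 0 \<in> K" unfolding K_def by blast
        with ys[OF s] k(3) show ?thesis by auto
      qed
    qed
  qed
  ultimately show ?thesis by blast
qed

lemma irreducible_if_res_nonzero:
  assumes d: "d \<ge> 2" and res: "res d (top_poly d cA 0) (top_poly d cB 0) \<noteq> 0"
    and f: "\<And>a b c s t r. (xvec a b c, yvec s t r) \<in> flag_cone \<Longrightarrow>
      f (xvec a b c, yvec s t r) = a * ternary d cA s t r + b * ternary d cB s t r"
  shows "irreducible_set (zero_locus f)"
proof -
  obtain K where K: "finite K" "0 \<notin> K"
    "\<And>y. y \<noteq> 0 \<Longrightarrow> cross y (dir d cA cB y) = 0 \<Longrightarrow> \<exists>k\<in>K. \<exists>c. y = c *s k"
    using dir_degenerate_finite[OF d res] by blast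
  show ?thesis
  proof (rule irreducible_surface[OF poly_map_dir K])
    fix x y assume xy: "(x, y) \<in> flag_cone"
    obtain a b c where x: "x = xvec a b c" using xvec_coords by blast
    obtain s t r where y: "y = yvec s t r" using yvec_coords by blast
    show "f (x, y) = dot3 x (dir d cA cB y)"
      using f xy unfolding x y dir_yvec dot3_xvec_yvec by simp
  qed
qed

end

section \<open>The linear system of a union of fibers\<close>

text \<open>The coordinates \<open>(l0 i : l1 i)\<close> describe the point in which the fiber \<open>i\<close> meets the line.\<close>

locale fibers_on_line = frame +
  fixes d :: nat and A :: "(cp2 \<times> cp2) set" and I :: "'i set" and l0 l1 :: "'i \<Rightarrow> complex"
  assumes d: "d \<ge> 2" and I: "finite I" "card I = d + 2"
    and distinct: "\<And>i j. i \<in> I \<Longrightarrow> j \<in> I \<Longrightarrow> i \<noteq> j \<Longrightarrow> l0 i * l1 j - l1 i * l0 j \<noteq> 0"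
    and A: "\<And>a b c s t r. (xvec a b c, yvec s t r) \<in> flag_cone \<Longrightarrow>
      pt (xvec a b c, yvec s t r) \<in> A \<longleftrightarrow> (\<exists>i\<in>I. a * l1 i = b * l0 i \<and> s * cnj (l1 i) = t * cnj (l0 i))"
begin

definition V :: "((complex^3) \<times> (complex^3) \<Rightarrow> complex) set"
  where "V = ideal_sections A 1 d"

definition represents :: "((complex^3) \<times> (complex^3) \<Rightarrow> complex) \<Rightarrow>
    (nat \<Rightarrow> nat \<Rightarrow> complex) \<Rightarrow> (nat \<Rightarrow> nat \<Rightarrow> complex) \<Rightarrow> bool"
  where "represents f cA cB \<longleftrightarrow> (\<forall>a b c s t r. (xvec a b c, yvec s t r) \<in> flag_cone \<longrightarrow>
    f (xvec a b c, yvec s t r) = a * ternary d cA s t r + b * ternary d cB s t r)"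

text \<open>The fiber \<open>i\<close> contains the point with \<open>X = (0 : 0 : 1)\<close> and \<open>Y\<close> the conjugate of \<open>(l0 i : l1 i : 0)\<close>;
  these are the zeros that \<open>section_formula\<close> asks for.\<close>

lemma V_represented: "f \<in> V \<Longrightarrow> \<exists>cA cB. represents f cA cB"
proof -
  assume "f \<in> V"
  then have f: "f \<in> sections 1 d" "\<And>z. z \<in> flag_cone \<Longrightarrow> pt z \<in> A \<Longrightarrow> f z = 0"
    unfolding V_def ideal_sections_def by auto
  have z: "f (xvec 0 0 c, yvec (cnj (l0 i)) (cnj (l1 i)) 0) = 0" if "i \<in> I" for i c
  proof (cases "(xvec 0 0 c, yvec (cnj (l0 i)) (cnj (l1 i)) 0) \<in> flag_cone")
    case True
    then show ?thesis using f(2) A[OF True] that by (auto simp: mult.commute)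
  qed (rule section_zero_off_cone[OF f(1)])
  have np: "cnj (l0 i) * cnj (l1 j) \<noteq> cnj (l0 j) * cnj (l1 i)" if "i \<in> I" "j \<in> I" "i \<noteq> j" for i j
  proof
    assume "cnj (l0 i) * cnj (l1 j) = cnj (l0 j) * cnj (l1 i)"
    then have "cnj (l0 i * l1 j) = cnj (l0 j * l1 i)" by simp
    then have "l0 i * l1 j = l0 j * l1 i" using complex_cnj_cancel_iff by blast
    then show False using distinct[OF that] by (simp add: mult.commute)
  qed
  show ?thesis unfolding represents_def
    by (rule section_formula[where p = "\<lambda>i. cnj (l0 i)" and q = "\<lambda>i. cnj (l1 i)", OF f(1) I(1)])
       (use I(2) np z in \<open>simp_all\<close>)
qed

lemma represents_chart:
  assumes "represents f cA cB"
  shows "f (xvec 1 0 (- s), yvec s t 1) = poly2 d cA s t" "f (xvec 0 1 (- t), yvec s t 1) = poly2 d cB s t"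
proof -
  have "(xvec 1 0 (- s), yvec s t 1) \<in> flag_cone" "(xvec 0 1 (- t), yvec s t 1) \<in> flag_cone"
    by (simp_all add: cone_iff)
  with assms show "f (xvec 1 0 (- s), yvec s t 1) = poly2 d cA s t" "f (xvec 0 1 (- t), yvec s t 1) = poly2 d cB s t"
    unfolding represents_def by (simp_all add: ternary_1)
qed

lemma represents_unique:
  assumes "represents f cA cB" "represents f cA' cB'" "j + k \<le> d"
  shows "cA j k = cA' j k" "cB j k = cB' j k"
proof -
  have "poly2 d cA s t = poly2 d cA' s t" "poly2 d cB s t = poly2 d cB' s t" for s t
    using represents_chart(1)[OF assms(1), of s t] represents_chart(1)[OF assms(2), of s t]
      represents_chart(2)[OF assms(1), of t s] represents_chart(2)[OF assms(2), of t s] by simp_all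
  then show "cA j k = cA' j k" "cB j k = cB' j k" using poly2_unique[OF _ assms(3)] by blast+
qed

definition coeffs_of :: "((complex^3) \<times> (complex^3) \<Rightarrow> complex) \<Rightarrow> (nat \<Rightarrow> nat \<Rightarrow> complex) \<times> (nat \<Rightarrow> nat \<Rightarrow> complex)"
  where "coeffs_of f = (SOME c. represents f (fst c) (snd c))"

lemma coeffs_of: "f \<in> V \<Longrightarrow> represents f (fst (coeffs_of f)) (snd (coeffs_of f))"
proof -
  assume "f \<in> V"
  then have "\<exists>c. represents f (fst c) (snd c)" using V_represented by simp
  then show ?thesis unfolding coeffs_of_def by (rule someI_ex)
qed

lemma ternary_linear:
  "ternary d (\<lambda>j k. c j k + e j k) s t r = ternary d c s t r + ternary d e s t r"
  "ternary d (\<lambda>j k. m * c j k) s t r = m * ternary d c s t r"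
   apply (simp add: ternary_def sum.distrib distrib_right del: diff_diff_left)
  apply (simp add: ternary_def sum_distrib_left mult_ac del: diff_diff_left)
  done

lemma represents_add:
  "represents f cA cB \<Longrightarrow> represents g eA eB \<Longrightarrow>
    represents (f + g) (\<lambda>j k. cA j k + eA j k) (\<lambda>j k. cB j k + eB j k)"
  unfolding represents_def ternary_linear by (simp add: algebra_simps)

lemma represents_scale:
  "represents f cA cB \<Longrightarrow> represents (cscale m f) (\<lambda>j k. m * cA j k) (\<lambda>j k. m * cB j k)"
  unfolding represents_def ternary_linear by (simp add: cscale_def algebra_simps)

lemma coeffs_of_eq:
  assumes "represents f cA cB" "j + k \<le> d"
  shows "fst (coeffs_of f) j k = cA j k" "snd (coeffs_of f) j k = cB j k"
proof -
  have "\<exists>c. represents f (fst c) (snd c)" using assms(1) by (intro exI[of _ "(cA, cB)"]) simp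
  then have "represents f (fst (coeffs_of f)) (snd (coeffs_of f))" unfolding coeffs_of_def by (rule someI_ex)
  from represents_unique[OF this assms] show "fst (coeffs_of f) j k = cA j k" "snd (coeffs_of f) j k = cB j k" .
qed

text \<open>The coefficients are unique in the range \<open>j + k \<le> d\<close>, hence linear functions of the section there,
  whatever the choice made for the other indices.\<close>

definition resultant :: "((complex^3) \<times> (complex^3) \<Rightarrow> complex) \<Rightarrow> complex"
  where "resultant f = res d (top_poly d (fst (coeffs_of f)) 0) (top_poly d (snd (coeffs_of f)) 0)"

lemma homogeneous_resultant: "homogeneous_on V (2 * d) resultant"
proof -
  have coef: "homogeneous_on V 1 (\<lambda>f. fst (coeffs_of f) j k)" "homogeneous_on V 1 (\<lambda>f. snd (coeffs_of f) j k)"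
    if jk: "j + k \<le> d" for j k
  proof -
    note * = coeffs_of_eq[OF represents_add[OF coeffs_of coeffs_of] jk]
      coeffs_of_eq[OF represents_scale[OF coeffs_of] jk]
    show "homogeneous_on V 1 (\<lambda>f. fst (coeffs_of f) j k)"
      by (rule homogeneous_on.linear) (use * in simp_all)
    show "homogeneous_on V 1 (\<lambda>f. snd (coeffs_of f) j k)"
      by (rule homogeneous_on.linear) (use * in simp_all)
  qed
  show ?thesis unfolding resultant_def[abs_def]
  proof (rule homogeneous_on_res)
    fix i assume i: "i \<le> d"
    show "homogeneous_on V 1 (\<lambda>f. coeff (top_poly d (fst (coeffs_of f)) 0) i)"
      "homogeneous_on V 1 (\<lambda>f. coeff (top_poly d (snd (coeffs_of f)) 0) i)"
      unfolding coeff_top_poly_0[OF i] using coef[of "d - i" i] i by simp_all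
  qed (rule degree_top_poly)+
qed

lemma irreducible_if_resultant_nonzero:
  assumes "f \<in> V" "resultant f \<noteq> 0"
  shows "irreducible_set (zero_locus f)"
  using irreducible_if_res_nonzero[OF d assms(2)[unfolded resultant_def]] coeffs_of[OF assms(1)]
  unfolding represents_def by blast

lemma V_finite_dimensional: "\<exists>W. finite W \<and> V \<subseteq> cfun.span W"
proof -
  define m where "m h j k = on_cone (\<lambda>z. dot3 (fst z) h * dot3 (cnj3 u0) (snd z) ^ j * dot3 (cnj3 u1) (snd z) ^ k
      * dot3 (cnj3 u2) (snd z) ^ (d - j - k))" for h j k
  define W where "W = (\<lambda>(h, j, k). m h j k) ` ({u0, u1} \<times> {..d} \<times> {..d})"
  have mW: "m h j k \<in> W" if "h \<in> {u0, u1}" "j \<le> d" "k \<le> d" for h j k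
    unfolding W_def using that by (intro image_eqI[of _ _ "(h, j, k)"]) auto
  have "f \<in> cfun.span W" if "f \<in> V" for f
  proof -
    obtain cA cB where c: "represents f cA cB" using V_represented \<open>f \<in> V\<close> by blast
    have off: "f z = 0" if "z \<notin> flag_cone" for z
      using \<open>f \<in> V\<close> section_zero_off_cone[OF _ that] unfolding V_def ideal_sections_def by blast
    let ?g = "\<lambda>c h. \<Sum>j\<le>d. \<Sum>k\<le>d - j. cscale (c j k) (m h j k)"
    have app: "sum F J z = (\<Sum>j\<in>J. F j z)" for J :: "nat set" and F :: "nat \<Rightarrow> (complex^3) \<times> (complex^3) \<Rightarrow> complex" and z
      by (induction J rule: infinite_finite_induct) auto
    have "f z = (?g cA u0 + ?g cB u1) z" for z
    proof (cases "z \<in> flag_cone")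
      case True
      obtain a b c' where x: "fst z = xvec a b c'" using xvec_coords by blast
      obtain s t r where y: "snd z = yvec s t r" using yvec_coords by blast
      have z: "z = (xvec a b c', yvec s t r)" using x y by (metis prod.collapse)
      have g: "?g e h z = dot3 (fst z) h * ternary d e s t r" for e h
      proof -
        have "?g e h z = (\<Sum>j\<le>d. \<Sum>k\<le>d - j. dot3 (fst z) h * (e j k * s ^ j * t ^ k * r ^ (d - j - k)))"
          unfolding app cscale_def m_def on_cone_def y dot3_yvec using True
          by (intro sum.cong refl) (simp only: if_True mult_ac)
        then show ?thesis unfolding ternary_def sum_distrib_left .
      qed
      have "(?g cA u0 + ?g cB u1) z = ?g cA u0 z + ?g cB u1 z" by (rule plus_fun_apply)
      also have "\<dots> = a * ternary d cA s t r + b * ternary d cB s t r"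
        unfolding g x dot3_xvec ..
      also have "\<dots> = f z" using c True unfolding z represents_def by metis
      finally show ?thesis by (rule sym)
    next
      case False
      then show ?thesis by (simp add: off app m_def on_cone_def cscale_def)
    qed
    then have "f = ?g cA u0 + ?g cB u1" by (rule ext)
    also have "\<dots> \<in> cfun.span W"
      by (intro cfun.span_add cfun.span_sum cfun.span_scale cfun.span_base mW) auto
    finally show ?thesis .
  qed
  then show ?thesis by (intro exI[of _ W]) (auto simp: W_def)
qed

end

text \<open>Two of the fibers are singled out as the points \<open>0\<close> and \<open>\<infinity>\<close> of the line.\<close>

locale marked_fibers_on_line = fibers_on_line +
  fixes a b :: 'a
  assumes ab: "a \<in> I" "b \<in> I" "a \<noteq> b"
begin

definition br :: "'a \<Rightarrow> 'a \<Rightarrow> complex"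
  where "br i j = l0 i * l1 j - l1 i * l0 j"

lemma br_nonzero: "i \<in> I \<Longrightarrow> j \<in> I \<Longrightarrow> i \<noteq> j \<Longrightarrow> br i j \<noteq> 0"
  unfolding br_def by (rule distinct)

definition ratio :: "'a \<Rightarrow> complex"
  where "ratio c = cnj (br c a) / cnj (br c b)"

definition T :: "complex set"
  where "T = ratio ` (I - {a, b})"

text \<open>The difference of two ratios has, up to conjugation and sign, the numerator
  \<open>br c c' * br a b\<close>, by the Pluecker relation.\<close>

lemma ratio_inj: "inj_on ratio (I - {a, b})"
proof (rule inj_onI, rule ccontr)
  fix c c' assume c: "c \<in> I - {a, b}" "c' \<in> I - {a, b}" "ratio c = ratio c'" "c \<noteq> c'"
  then have nz: "br c b \<noteq> 0" "br c' b \<noteq> 0" using br_nonzero ab by auto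
  then have "cnj (br c a) * cnj (br c' b) = cnj (br c' a) * cnj (br c b)"
    using c(3) unfolding ratio_def by (simp add: field_simps)
  then have "cnj (br c a * br c' b) = cnj (br c' a * br c b)" by simp
  then have "br c a * br c' b = br c' a * br c b" using complex_cnj_cancel_iff by blast
  then have "br c a * br c' b - br c' a * br c b = 0" by simp
  moreover have "br c a * br c' b - br c' a * br c b = br c c' * br a b"
    unfolding br_def by (simp add: algebra_simps)
  ultimately show False using br_nonzero c ab by auto
qed

lemma T: "finite T" "card T = d" "0 \<notin> T"
proof -
  show "finite T" unfolding T_def using I by simp
  show "card T = d" unfolding T_def card_image[OF ratio_inj] using I ab by (simp add: card_Diff_subset)
  show "0 \<notin> T"
  proof
    assume "0 \<in> T"
    then obtain c where "c \<in> I" "c \<noteq> a" "c \<noteq> b" "ratio c = 0" unfolding T_def by force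
    then show False using br_nonzero[of c a] br_nonzero[of c b] ab unfolding ratio_def by simp
  qed
qed

lemma T_nonempty: "T \<noteq> {}" using T d by auto

text \<open>Linear forms that vanish at the points \<open>a\<close> and \<open>b\<close>, on the side of \<open>x\<close> and, conjugated, of \<open>y\<close>.\<close>

definition \<xi>a :: "complex^3 \<Rightarrow> complex" where "\<xi>a x = dot3 x u0 * l1 a - dot3 x u1 * l0 a"
definition \<xi>b :: "complex^3 \<Rightarrow> complex" where "\<xi>b x = dot3 x u0 * l1 b - dot3 x u1 * l0 b"
definition \<eta>a :: "complex^3 \<Rightarrow> complex" where "\<eta>a y = dot3 (cnj3 u0) y * cnj (l1 a) - dot3 (cnj3 u1) y * cnj (l0 a)"
definition \<eta>b :: "complex^3 \<Rightarrow> complex" where "\<eta>b y = dot3 (cnj3 u0) y * cnj (l1 b) - dot3 (cnj3 u1) y * cnj (l0 b)"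

text \<open>The form \<open>G u\<close> is \<open>\<zeta> * U\<close>, and \<open>H w\<close> is \<open>\<sigma> * W\<close>, where \<open>U\<close> and \<open>W\<close> are the homogenizations of \<open>u\<close> and \<open>w\<close> to degree
  \<open>d - 1\<close>. The factors \<open>\<zeta>\<close> and \<open>\<sigma>\<close> make a member vanish on the fibers \<open>b\<close> and \<open>a\<close>.\<close>

definition G :: "complex poly \<Rightarrow> complex \<Rightarrow> complex \<Rightarrow> complex"
  where "G u \<sigma> \<zeta> = (\<Sum>k<d. coeff u k * \<sigma> ^ k * \<zeta> ^ (d - k))"

definition H :: "complex poly \<Rightarrow> complex \<Rightarrow> complex \<Rightarrow> complex"
  where "H w \<sigma> \<zeta> = (\<Sum>k<d. coeff w k * \<sigma> ^ (k + 1) * \<zeta> ^ (d - 1 - k))"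

definition member :: "complex poly \<Rightarrow> (complex^3) \<times> (complex^3) \<Rightarrow> complex"
  where "member u = on_cone (\<lambda>z. \<xi>a (fst z) * G u (\<eta>a (snd z)) (\<eta>b (snd z))
     - \<xi>b (fst z) * H (conj_interpolant T u) (\<eta>a (snd z)) (\<eta>b (snd z)))"

lemma G_dehomogenize: "degree u < d \<Longrightarrow> \<zeta> \<noteq> 0 \<Longrightarrow> G u \<sigma> \<zeta> = \<zeta> ^ d * poly u (\<sigma> / \<zeta>)"
  unfolding G_def poly_sum_below sum_distrib_left
  by (intro sum.cong) (auto simp: power_divide power_diff)

lemma H_dehomogenize:
  assumes "degree w < d" "\<zeta> \<noteq> 0"
  shows "H w \<sigma> \<zeta> = \<zeta> ^ d * (\<sigma> / \<zeta> * poly w (\<sigma> / \<zeta>))"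
proof -
  have "coeff w k * \<sigma> ^ (k + 1) * \<zeta> ^ (d - 1 - k) = \<zeta> ^ d * (\<sigma> / \<zeta> * (coeff w k * (\<sigma> / \<zeta>) ^ k))" if "k < d" for k
  proof -
    have "\<zeta> ^ d = \<zeta> ^ (d - 1 - k) * \<zeta> ^ (k + 1)" using that by (simp add: power_add[symmetric] del: power_Suc)
    then show ?thesis using assms(2) by (simp add: power_divide)
  qed
  then show ?thesis unfolding H_def poly_sum_below[OF assms(1)] sum_distrib_left by (intro sum.cong) auto
qed

lemma GH_scale: "G u (m * \<sigma>) (m * \<zeta>) = m ^ d * G u \<sigma> \<zeta>" "H w (m * \<sigma>) (m * \<zeta>) = m ^ d * H w \<sigma> \<zeta>"
proof -
  have "coeff u k * (m * \<sigma>) ^ k * (m * \<zeta>) ^ (d - k) = m ^ d * (coeff u k * \<sigma> ^ k * \<zeta> ^ (d - k))" if "k < d" for k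
  proof -
    have "m ^ d = m ^ k * m ^ (d - k)" using that by (simp add: power_add[symmetric])
    then show ?thesis by (simp add: power_mult_distrib)
  qed
  then show "G u (m * \<sigma>) (m * \<zeta>) = m ^ d * G u \<sigma> \<zeta>" unfolding G_def sum_distrib_left by (intro sum.cong) auto
  have "coeff w k * (m * \<sigma>) ^ (k + 1) * (m * \<zeta>) ^ (d - 1 - k) = m ^ d * (coeff w k * \<sigma> ^ (k + 1) * \<zeta> ^ (d - 1 - k))" if "k < d" for k
  proof -
    have "m ^ d = m ^ (k + 1) * m ^ (d - 1 - k)" using that by (simp add: power_add[symmetric] del: power_Suc)
    then show ?thesis by (simp add: power_mult_distrib)
  qed
  then show "H w (m * \<sigma>) (m * \<zeta>) = m ^ d * H w \<sigma> \<zeta>" unfolding H_def sum_distrib_left by (intro sum.cong) auto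
qed

lemma G_zero_right: "G u \<sigma> 0 = 0"
  unfolding G_def by (intro sum.neutral) auto

lemma H_zero_left: "H w 0 \<zeta> = 0"
  unfolding H_def by (intro sum.neutral) auto

lemma H_zero_right: "H w \<sigma> 0 = coeff w (d - 1) * \<sigma> ^ d"
proof -
  have "H w \<sigma> 0 = (\<Sum>k\<in>{d - 1}. coeff w k * \<sigma> ^ (k + 1) * 0 ^ (d - 1 - k))"
    unfolding H_def using d by (intro sum.mono_neutral_right) auto
  then show ?thesis using d by simp
qed

lemma bihomogeneous_member:
  "bihomogeneous 1 d (\<lambda>z. \<xi>a (fst z) * G u (\<eta>a (snd z)) (\<eta>b (snd z)) - \<xi>b (fst z) * H w (\<eta>a (snd z)) (\<eta>b (snd z)))"
proof -
  have cm: "bihomogeneous p q (\<lambda>z. m * P z)" if "bihomogeneous p q P" for m p q P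
    using bihomogeneous_mult[OF bihomogeneous_const that, of m] by simp
  have X: "bihomogeneous 1 0 (\<lambda>z. dot3 (fst z) u0 * m - dot3 (fst z) u1 * n)" for m n
    using bihomogeneous_add[OF cm[OF bihomogeneous_linear(1)[of u0], of m] cm[OF bihomogeneous_linear(1)[of u1], of "- n"]]
    by (simp add: mult.commute)
  have Y: "bihomogeneous 0 1 (\<lambda>z. dot3 (cnj3 u0) (snd z) * m - dot3 (cnj3 u1) (snd z) * n)" for m n
    using bihomogeneous_add[OF cm[OF bihomogeneous_linear(2)[of "cnj3 u0"], of m] cm[OF bihomogeneous_linear(2)[of "cnj3 u1"], of "- n"]]
    by (simp add: mult.commute)
  have ab: "bihomogeneous 1 0 (\<lambda>z. \<xi>a (fst z))" "bihomogeneous 1 0 (\<lambda>z. \<xi>b (fst z))"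
    "bihomogeneous 0 1 (\<lambda>z. \<eta>a (snd z))" "bihomogeneous 0 1 (\<lambda>z. \<eta>b (snd z))"
    unfolding \<xi>a_def \<xi>b_def \<eta>a_def \<eta>b_def by (rule X Y)+
  have mono: "bihomogeneous 0 d (\<lambda>z. m * \<eta>a (snd z) ^ p * \<eta>b (snd z) ^ q)" if "p + q = d" for m p q
    using bihomogeneous_mult[OF cm[OF bihomogeneous_power[OF ab(3), of p], of m] bihomogeneous_power[OF ab(4), of q]] that
    by simp
  have "bihomogeneous 0 d (\<lambda>z. G u (\<eta>a (snd z)) (\<eta>b (snd z)))" "bihomogeneous 0 d (\<lambda>z. H w (\<eta>a (snd z)) (\<eta>b (snd z)))"
    unfolding G_def H_def by (intro bihomogeneous_sum mono; simp)+
  then have "bihomogeneous (1 + 0) (0 + d) (\<lambda>z. \<xi>a (fst z) * G u (\<eta>a (snd z)) (\<eta>b (snd z)) + (- 1) * (\<xi>b (fst z) * H w (\<eta>a (snd z)) (\<eta>b (snd z))))"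
    by (intro bihomogeneous_add bihomogeneous_mult ab cm)
  then show ?thesis by simp
qed

text \<open>On the fiber \<open>i\<close> the linear forms take conjugate values on the two sides, and vanishing becomes the
  interpolation condition at \<open>ratio i\<close>.\<close>

lemma member_in_V:
  assumes u: "degree u < d"
  shows "member u \<in> V"
proof -
  let ?w = "conj_interpolant T u"
  have w: "degree ?w < d" using conj_interpolant(1)[OF T(1) T_nonempty T(3), of u] T(2) by simp
  have "member u z = 0" if z: "z \<in> flag_cone" "pt z \<in> A" for z
  proof -
    obtain p q c where x: "fst z = xvec p q c" using xvec_coords by blast
    obtain s t r where y: "snd z = yvec s t r" using yvec_coords by blast
    have z': "z = (xvec p q c, yvec s t r)" using x y by (metis prod.collapse)
    obtain i where i: "i \<in> I" "p * l1 i = q * l0 i" "s * cnj (l1 i) = t * cnj (l0 i)"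
      using A z unfolding z' by blast
    have li: "l0 i \<noteq> 0 \<or> l1 i \<noteq> 0"
    proof -
      obtain j where "j \<in> I" "j \<noteq> i" using ab by metis
      then show ?thesis using distinct[of i j] i(1) by auto
    qed
    have par: "\<exists>e. p = e * m \<and> q = e * n" if "p * n = q * m" "m \<noteq> 0 \<or> n \<noteq> 0" for p q m n :: complex
    proof (cases "m = 0")
      case True
      then show ?thesis using that by (intro exI[of _ "q / n"]) auto
    next
      case False
      then show ?thesis using that by (intro exI[of _ "p / m"]) (auto simp: field_simps)
    qed
    obtain e where e: "p = e * l0 i" "q = e * l1 i" using par[OF i(2)] li by blast
    obtain g where g: "s = g * cnj (l0 i)" "t = g * cnj (l1 i)" using par[OF i(3)] li by auto
    have vals: "\<xi>a (fst z) = e * br i a" "\<xi>b (fst z) = e * br i b"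
      "\<eta>a (snd z) = g * cnj (br i a)" "\<eta>b (snd z) = g * cnj (br i b)"
      unfolding x y \<xi>a_def \<xi>b_def \<eta>a_def \<eta>b_def dot3_xvec dot3_yvec e g br_def by (simp_all add: algebra_simps)
    have "br i a * G u (cnj (br i a)) (cnj (br i b)) = br i b * H ?w (cnj (br i a)) (cnj (br i b))"
    proof -
      consider "i = a" | "i = b" | "i \<in> I - {a, b}" using i(1) by blast
      then show ?thesis
      proof cases
        case 1
        then have "br i a = 0" by (simp add: br_def)
        then show ?thesis by (simp add: H_zero_left)
      next
        case 2
        then have "br i b = 0" by (simp add: br_def)
        then show ?thesis by (simp add: G_zero_right)
      next
        case 3
        then have nz: "br i b \<noteq> 0" using br_nonzero ab by auto
        have t: "ratio i \<in> T" using 3 by (simp add: T_def)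
        have "ratio i * poly ?w (ratio i) = cnj (ratio i) * poly u (ratio i)"
          by (rule conj_interpolant(2)[OF T(1) T_nonempty T(3) t])
        moreover have "br i b * cnj (ratio i) = br i a" unfolding ratio_def using nz by simp
        moreover have r: "cnj (br i a) / cnj (br i b) = ratio i" by (simp add: ratio_def)
        ultimately show ?thesis
          using nz unfolding G_dehomogenize[OF u, of "cnj (br i b)"] H_dehomogenize[OF w, of "cnj (br i b)"]
          by (simp add: G_dehomogenize[OF u] H_dehomogenize[OF w] r)
      qed
    qed
    then show ?thesis
      unfolding member_def on_cone_def vals GH_scale by (simp add: mult_ac)
  qed
  then show ?thesis
    unfolding V_def ideal_sections_def using bihomogeneous_section[OF bihomogeneous_member, of u ?w]
    by (auto simp: member_def)
qed

text \<open>Evaluating where \<open>\<xi>b = 0\<close> recovers \<open>u\<close>.\<close>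

lemma ex_test_point: "\<exists>z\<in>flag_cone. \<forall>u. degree u < d \<longrightarrow> member u z = poly u \<sigma>"
proof -
  define \<delta> where "\<delta> = br b a"
  have \<delta>: "\<delta> \<noteq> 0" unfolding \<delta>_def using br_nonzero ab by blast
  define p where "p = l0 b / \<delta>"
  define q where "q = l1 b / \<delta>"
  define s where "s = (\<sigma> * cnj (l0 b) - cnj (l0 a)) / cnj \<delta>"
  define t where "t = (\<sigma> * cnj (l1 b) - cnj (l1 a)) / cnj \<delta>"
  define z where "z = (xvec p q (- (p * s + q * t)), yvec s t 1)"
  have xi: "p * l1 a - q * l0 a = 1" "p * l1 b - q * l0 b = 0"
  proof -
    have "p * l1 a - q * l0 a = (l0 b * l1 a - l1 b * l0 a) / \<delta>"
      unfolding p_def q_def by (simp add: diff_divide_distrib)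
    also have "l0 b * l1 a - l1 b * l0 a = \<delta>" by (simp add: \<delta>_def br_def)
    finally show "p * l1 a - q * l0 a = 1" using \<delta> by simp
    show "p * l1 b - q * l0 b = 0" unfolding p_def q_def by simp
  qed
  have c\<delta>: "cnj \<delta> = cnj (l0 b) * cnj (l1 a) - cnj (l1 b) * cnj (l0 a)"
    by (simp add: \<delta>_def br_def)
  have c\<delta>0: "cnj \<delta> \<noteq> 0" using \<delta> by simp
  have eta: "s * cnj (l1 a) - t * cnj (l0 a) = \<sigma>" "s * cnj (l1 b) - t * cnj (l0 b) = 1"
  proof -
    have "s * cnj (l1 a) - t * cnj (l0 a) = \<sigma> * cnj \<delta> / cnj \<delta>"
      unfolding s_def t_def c\<delta> by (simp add: diff_divide_distrib[symmetric] algebra_simps)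
    then show "s * cnj (l1 a) - t * cnj (l0 a) = \<sigma>" using c\<delta>0 by simp
    have "s * cnj (l1 b) - t * cnj (l0 b) = cnj \<delta> / cnj \<delta>"
      unfolding s_def t_def c\<delta> by (simp add: diff_divide_distrib[symmetric] algebra_simps)
    then show "s * cnj (l1 b) - t * cnj (l0 b) = 1" using c\<delta>0 by simp
  qed
  have "z \<in> flag_cone"
    unfolding z_def cone_iff using xi(1) by auto
  moreover have "member u z = poly u \<sigma>" if "degree u < d" for u
    using \<open>z \<in> flag_cone\<close> G_dehomogenize[OF that one_neq_zero, of \<sigma>]
    unfolding member_def on_cone_def z_def \<xi>a_def \<xi>b_def \<eta>a_def \<eta>b_def fst_conv snd_conv dot3_xvec dot3_yvec xi eta
    by simp
  ultimately show ?thesis by blast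
qed

lemma dim_V: "cfun.dim V \<ge> d"
proof -
  define F where "F k = member (monom 1 k)" for k
  have deg: "degree (monom (1::complex) k) < d" if "k < d" for k
    using that by (simp add: degree_monom_eq)
  have tp: "\<exists>z. \<forall>k<d. F k z = \<sigma> ^ k" for \<sigma>
    using ex_test_point[of \<sigma>] deg unfolding F_def by (fastforce simp: poly_monom)
  have inj: "inj_on F {..<d}"
  proof (rule inj_onI)
    fix k k' assume k: "k \<in> {..<d}" "k' \<in> {..<d}" "F k = F k'"
    obtain z where "\<forall>k<d. F k z = 2 ^ k" using tp by blast
    then have "(2::complex) ^ k = 2 ^ k'" using k by (metis lessThan_iff)
    then have "of_nat (2 ^ k) = (of_nat (2 ^ k') :: complex)" by simp
    then have "(2::nat) ^ k = 2 ^ k'" by (simp only: of_nat_eq_iff)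
    then show "k = k'" by simp
  qed
  have app: "sum f J z = (\<Sum>j\<in>J. f j z)" for J :: "nat set" and f :: "nat \<Rightarrow> (complex^3) \<times> (complex^3) \<Rightarrow> complex" and z
    by (induction J rule: infinite_finite_induct) auto
  have "cfun.independent (F ` {..<d})"
  proof (rule cfun.independent_if_scalars_zero)
    fix c v assume s: "(\<Sum>v\<in>F ` {..<d}. cscale (c v) v) = 0" and v: "v \<in> F ` {..<d}"
    have s': "(\<Sum>k<d. cscale (c (F k)) (F k)) = 0" using s unfolding sum.reindex[OF inj] by simp
    have "(\<Sum>k\<le>d - 1. c (F k) * \<sigma> ^ k) = 0" for \<sigma>
    proof -
      obtain z where z: "\<forall>k<d. F k z = \<sigma> ^ k" using tp by blast
      have "(\<Sum>k<d. c (F k) * \<sigma> ^ k) = (\<Sum>k<d. cscale (c (F k)) (F k) z)"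
        by (rule sum.cong) (use z in \<open>auto simp: cscale_def\<close>)
      also have "\<dots> = (\<Sum>k<d. cscale (c (F k)) (F k)) z" by (rule app[symmetric])
      also have "\<dots> = 0" unfolding s' by simp
      finally show ?thesis using d by (cases d) (auto simp: lessThan_Suc_atMost)
    qed
    then have "\<forall>k\<le>d - 1. c (F k) = 0" using polyfun_eq_0[of "\<lambda>k. c (F k)" "d - 1"] by blast
    then show "c v = 0" using v by auto
  qed simp
  moreover have "F ` {..<d} \<subseteq> V" unfolding F_def using deg member_in_V by auto
  moreover obtain B where B: "B \<subseteq> V" "cfun.independent B" "V \<subseteq> cfun.span B" "card B = cfun.dim V"
    using cfun.basis_exists by blast
  moreover obtain W where W: "finite W" "V \<subseteq> cfun.span W" using V_finite_dimensional by blast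
  ultimately have "finite B" using cfun.independent_span_bound[OF W(1) B(2)] by blast
  then have "card (F ` {..<d}) \<le> card B"
    using cfun.independent_span_bound[OF \<open>finite B\<close> \<open>cfun.independent (F ` {..<d})\<close>] \<open>F ` {..<d} \<subseteq> V\<close> B(3) by blast
  then show ?thesis using B(4) by (simp add: card_image[OF inj])
qed

text \<open>A member involves \<open>Y0\<close> and \<open>Y1\<close> only, so its two forms are read off in the chart. A common zero is a
  common zero of \<open>G u\<close> and \<open>H w\<close>, because \<open>\<xi>a\<close> and \<open>\<xi>b\<close> are independent; the two hypotheses exclude it
  at \<open>\<zeta> = 0\<close> and at \<open>\<zeta> \<noteq> 0\<close>.\<close>

lemma resultant_member_nonzero:
  assumes u: "degree u < d" and top: "coeff (conj_interpolant T u) (d - 1) \<noteq> 0"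
    and cop: "\<And>t. poly u t = 0 \<Longrightarrow> t * poly (conj_interpolant T u) t \<noteq> 0"
  shows "resultant (member u) \<noteq> 0"
proof -
  let ?w = "conj_interpolant T u"
  have w: "degree ?w < d" using conj_interpolant(1)[OF T(1) T_nonempty T(3), of u] T(2) by simp
  define cA where "cA = fst (coeffs_of (member u))"
  define cB where "cB = snd (coeffs_of (member u))"
  have rep: "represents (member u) cA cB" unfolding cA_def cB_def by (rule coeffs_of[OF member_in_V[OF u]])
  define \<sigma> where "\<sigma> s t = s * cnj (l1 a) - t * cnj (l0 a)" for s t
  define \<zeta> where "\<zeta> s t = s * cnj (l1 b) - t * cnj (l0 b)" for s t
  have member: "member u (xvec p q c, yvec s t r) =
      (p * l1 a - q * l0 a) * G u (\<sigma> s t) (\<zeta> s t) - (p * l1 b - q * l0 b) * H ?w (\<sigma> s t) (\<zeta> s t)"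
    if "(xvec p q c, yvec s t r) \<in> flag_cone" for p q c s t r
    using that unfolding member_def on_cone_def \<xi>a_def \<xi>b_def \<eta>a_def \<eta>b_def fst_conv snd_conv dot3_xvec dot3_yvec \<sigma>_def \<zeta>_def
    by simp
  have chart: "poly2 d cA s t = l1 a * G u (\<sigma> s t) (\<zeta> s t) - l1 b * H ?w (\<sigma> s t) (\<zeta> s t)"
    "poly2 d cB s t = - (l0 a * G u (\<sigma> s t) (\<zeta> s t)) + l0 b * H ?w (\<sigma> s t) (\<zeta> s t)" for s t
    unfolding represents_chart[OF rep, symmetric]
    by (subst member, simp add: cone_iff, simp)+
  have hom: "ternary d c s t 0 = g s t"
    if g: "\<And>s t. poly2 d c s t = g s t" "\<And>m s t. g (m * s) (m * t) = m ^ d * g s t" for c g s t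
  proof -
    have "ternary d c s t r = g s t" if "r \<noteq> 0" for r
      using g(2)[of r "s / r" "t / r"] that by (simp add: ternary_dehomogenize g(1))
    moreover have "continuous_on UNIV (\<lambda>r. ternary d c s t r)"
      by (intro holomorphic_on_imp_continuous_on poly_fun_holomorphic poly_fun_ternary poly_fun_const poly_fun_id)
    ultimately show ?thesis using continuous_eq_at_0[of "\<lambda>r. ternary d c s t r" "\<lambda>r. g s t"] by simp
  qed
  have \<sigma>\<zeta>: "\<sigma> (m * s) (m * t) = m * \<sigma> s t" "\<zeta> (m * s) (m * t) = m * \<zeta> s t" for m s t
    unfolding \<sigma>_def \<zeta>_def by (simp_all add: algebra_simps)
  have formA: "ternary d cA s t 0 = l1 a * G u (\<sigma> s t) (\<zeta> s t) - l1 b * H ?w (\<sigma> s t) (\<zeta> s t)" for s t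
    by (rule hom[OF chart(1)]) (simp add: \<sigma>\<zeta> GH_scale algebra_simps)
  have formB: "ternary d cB s t 0 = - (l0 a * G u (\<sigma> s t) (\<zeta> s t)) + l0 b * H ?w (\<sigma> s t) (\<zeta> s t)" for s t
    by (rule hom[OF chart(2)]) (simp add: \<sigma>\<zeta> GH_scale algebra_simps)
  have ba: "br b a \<noteq> 0" using br_nonzero ab by blast
  have no_zero: "s = 0 \<and> t = 0" if z: "ternary d cA s t 0 = 0" "ternary d cB s t 0 = 0" for s t
  proof -
    let ?G = "G u (\<sigma> s t) (\<zeta> s t)" and ?H = "H ?w (\<sigma> s t) (\<zeta> s t)"
    have "l0 b * (l1 a * ?G - l1 b * ?H) + l1 b * (- (l0 a * ?G) + l0 b * ?H) = br b a * ?G"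
      "l0 a * (l1 a * ?G - l1 b * ?H) + l1 a * (- (l0 a * ?G) + l0 b * ?H) = br b a * ?H"
      unfolding br_def by (simp_all add: algebra_simps)
    then have GH: "?G = 0" "?H = 0" using z ba unfolding formA formB by auto
    have \<zeta>0: "\<zeta> s t = 0"
    proof (rule ccontr)
      assume nz: "\<zeta> s t \<noteq> 0"
      have "poly u (\<sigma> s t / \<zeta> s t) = 0" using GH(1) nz by (simp add: G_dehomogenize[OF u])
      moreover have "\<sigma> s t / \<zeta> s t * poly ?w (\<sigma> s t / \<zeta> s t) = 0"
        using GH(2) nz unfolding H_dehomogenize[OF w nz] by simp
      ultimately show False using cop by blast
    qed
    have "\<sigma> s t = 0" using GH(2) top d unfolding \<zeta>0 H_zero_right by simp
    have "cnj (br b a) * s = cnj (l0 b) * \<sigma> s t - cnj (l0 a) * \<zeta> s t"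
      "cnj (br b a) * t = cnj (l1 b) * \<sigma> s t - cnj (l1 a) * \<zeta> s t"
      unfolding br_def \<sigma>_def \<zeta>_def by (simp_all add: algebra_simps)
    with \<zeta>0 \<open>\<sigma> s t = 0\<close> ba show ?thesis by simp
  qed
  show ?thesis
    unfolding resultant_def cA_def[symmetric] cB_def[symmetric]
  proof (rule res_nonzero)
    show "poly (top_poly d cB 0) t \<noteq> 0" if "poly (top_poly d cA 0) t = 0" for t
      using that no_zero[of 1 t] by (auto simp: poly_top_poly)
    show "coeff (top_poly d cA 0) d \<noteq> 0 \<or> coeff (top_poly d cB 0) d \<noteq> 0"
      using no_zero[of 0 1] by (auto simp: coeff_top_poly_top ternary_0_1)
  qed (use d degree_top_poly in auto)
qed

lemma general_member:
  assumes c: "c1 \<in> I - {a, b}" "c2 \<in> I - {a, b}" and nc: "ratio c1 * cnj (ratio c2) \<noteq> cnj (ratio c1) * ratio c2"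
  shows "h0_ideal A 1 d \<ge> d" "general_member_irreducible (ideal_sections A 1 d)"
proof -
  show "h0_ideal A 1 d \<ge> d" using dim_V unfolding h0_ideal_def V_def .
  define Z where "Z = {f \<in> V - {0}. resultant f = 0}"
  have "closed_in_system V Z"
    unfolding closed_in_system_def Z_def using homogeneous_resultant by (intro exI[of _ "{resultant}"]) auto
  moreover have "Z \<noteq> V - {0}"
  proof -
    have "ratio c1 \<in> T" "ratio c2 \<in> T" using c by (auto simp: T_def)
    from ex_coprime_conj_interpolant[OF T(1,2) d T(3) this nc] obtain u where
      u: "degree u < d" "coeff (conj_interpolant T u) (d - 1) \<noteq> 0"
        "\<And>t. poly u t = 0 \<Longrightarrow> t * poly (conj_interpolant T u) t \<noteq> 0" by blast
    have "member u \<noteq> 0"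
    proof
      assume "member u = 0"
      then have "poly u 0 = 0" using ex_test_point[of 0] u(1) by auto
      then show False using u(3)[of 0] by simp
    qed
    then show ?thesis
      using member_in_V[OF u(1)] resultant_member_nonzero[OF u] unfolding Z_def by blast
  qed
  moreover have "\<forall>f\<in>V - {0} - Z. irreducible_set (zero_locus f)"
    using irreducible_if_resultant_nonzero unfolding Z_def by blast
  ultimately show "general_member_irreducible (ideal_sections A 1 d)"
    unfolding general_member_irreducible_def V_def by blast
qed

end

section \<open>Twistor fibers\<close>

lemma cnj3_eq_0 [simp]: "cnj3 x = 0 \<longleftrightarrow> x = 0"
  by (auto simp: vec3_eq_iff)

lemma twistor_fiber_iff:
  assumes "(x, y) \<in> flag_cone" "v \<noteq> 0"
  shows "pt (x, y) \<in> twistor_fiber (abs_cp2 v) \<longleftrightarrow> dot3 x (cnj3 v) = 0 \<and> dot3 v y = 0"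
proof -
  have "pt (x, y) \<in> flag" using assms(1) flag_eq by blast
  moreover have "x \<noteq> 0" "y \<noteq> 0" using assms(1) by (auto simp: flag_cone_def)
  ultimately show ?thesis
    using assms(2) by (simp add: twistor_fiber_def pt_Pair cnj_cp2_abs incident_abs)
qed

lemma twistor_direction_nonzero:
  assumes "(x, y) \<in> flag_cone"
  shows "cross y (cnj3 x) \<noteq> 0"
proof
  assume "cross y (cnj3 x) = 0"
  then obtain k where k: "y = k *s cnj3 x" using cross_zero_imp[of y "cnj3 x"] assms by (auto simp: flag_cone_def)
  have c: "x \<noteq> 0" "y \<noteq> 0" "dot3 x y = 0" using assms by (auto simp: flag_cone_def)
  have "dot3 x y = k * dot3 x (cnj3 x)" unfolding k by simp
  then have "k = 0" using c by (simp add: dot3_cnj3_eq_0)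
  then show False using k c(2) by simp
qed

text \<open>The equations of the fiber over \<open>q\<close> say that \<open>q\<close> is orthogonal to \<open>y\<close> and to \<open>cnj x\<close>, and these are
  independent because \<open>x\<close> is orthogonal to \<open>y\<close>, not to \<open>cnj x\<close>.\<close>

lemma twistor_fiber_through:
  assumes "(x, y) \<in> flag_cone"
  shows "pt (x, y) \<in> twistor_fiber q \<longleftrightarrow> q = abs_cp2 (cross y (cnj3 x))"
proof -
  obtain v where v: "v \<noteq> 0" "q = abs_cp2 v" using abs_cp2_surj by blast
  have n: "cross y (cnj3 x) \<noteq> 0" by (rule twistor_direction_nonzero[OF assms])
  have c: "dot3 x (cnj3 v) = 0 \<longleftrightarrow> dot3 v (cnj3 x) = 0"
  proof -
    have "dot3 v (cnj3 x) = cnj (dot3 x (cnj3 v))" by (simp add: dot3_expand mult.commute)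
    then show ?thesis by (metis complex_cnj_zero_iff)
  qed
  have "pt (x, y) \<in> twistor_fiber q \<longleftrightarrow> dot3 v y = 0 \<and> dot3 v (cnj3 x) = 0"
    unfolding v(2) twistor_fiber_iff[OF assms v(1)] c by blast
  also have "\<dots> \<longleftrightarrow> (\<exists>k. k \<noteq> 0 \<and> v = k *s cross y (cnj3 x))"
  proof
    assume "dot3 v y = 0 \<and> dot3 v (cnj3 x) = 0"
    then obtain k where "v = k *s cross y (cnj3 x)" using orthogonal_to_both n by blast
    then show "\<exists>k. k \<noteq> 0 \<and> v = k *s cross y (cnj3 x)" using v(1) by (intro exI[of _ k]) auto
  qed auto
  also have "\<dots> \<longleftrightarrow> q = abs_cp2 (cross y (cnj3 x))"
    unfolding v(2) using abs_cp2_eq_iff[OF n v(1)] by metis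
  finally show ?thesis .
qed

lemma twistor_fiber_subset: "twistor_fiber q \<subseteq> flag"
  by (auto simp: twistor_fiber_def)

lemma twistor_fibers_meet_imp_eq:
  assumes "p \<in> twistor_fiber q" "p \<in> twistor_fiber q'"
  shows "q = q'"
proof -
  obtain x y where "(x, y) \<in> flag_cone" "p = pt (x, y)"
    using assms(1) twistor_fiber_subset flag_eq by fastforce
  then show ?thesis using assms twistor_fiber_through by metis
qed

section \<open>Unitary frames exist\<close>

lemma unit_multiple:
  assumes "v \<noteq> 0"
  shows "\<exists>c. c \<noteq> 0 \<and> dot3 (cnj3 (c *s v)) (c *s v) = 1"
proof -
  define r where "r = (cmod (v $ 1))\<^sup>2 + (cmod (v $ 2))\<^sup>2 + (cmod (v $ 3))\<^sup>2"
  have r: "dot3 (cnj3 v) v = complex_of_real r"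
    unfolding r_def dot3_expand by (simp add: complex_norm_square mult.commute del: of_real_power)
  have "dot3 (cnj3 v) v \<noteq> 0" using assms dot3_cnj3_eq_0[of v] by (simp add: dot3_commute)
  then have "r \<noteq> 0" unfolding r by auto
  moreover have "r \<ge> 0" unfolding r_def by simp
  ultimately have "r > 0" by simp
  define c where "c = complex_of_real (1 / sqrt r)"
  have "cnj3 (c *s v) = c *s cnj3 v" by (simp add: vec3_eq_iff c_def)
  then have "dot3 (cnj3 (c *s v)) (c *s v) = c * c * complex_of_real r"
    using r by simp
  also have "\<dots> = complex_of_real (1 / sqrt r * (1 / sqrt r) * r)"
    unfolding c_def by (simp only: of_real_mult)
  also have "1 / sqrt r * (1 / sqrt r) * r = 1" using \<open>r > 0\<close> by (simp add: field_simps)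
  finally show ?thesis using \<open>r > 0\<close> by (intro exI[of _ c]) (simp add: c_def)
qed

text \<open>The conjugate of \<open>a \<times> b\<close> is orthogonal to \<open>a\<close> and \<open>b\<close> in the Hermitian sense.\<close>

lemma ex_frame:
  assumes "m \<noteq> 0"
  shows "\<exists>u0 u1 u2 c. frame u0 u1 u2 \<and> c \<noteq> 0 \<and> u2 = c *s m"
proof -
  obtain c where c: "c \<noteq> 0" "dot3 (cnj3 (c *s m)) (c *s m) = 1" using unit_multiple[OF assms] by blast
  define u2 where "u2 = c *s m"
  have u2: "dot3 (cnj3 u2) u2 = 1" using c by (simp add: u2_def)
  have "u2 \<noteq> 0" using u2 by auto
  then have "cross u2 (axis 1 1) \<noteq> 0 \<or> cross u2 (axis 2 1) \<noteq> 0" by (auto simp: vec3_eq_iff axis_def)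
  then obtain p where p: "cross u2 p \<noteq> 0" by blast
  obtain k where k: "dot3 (cnj3 (k *s cnj3 (cross u2 p))) (k *s cnj3 (cross u2 p)) = 1"
    using unit_multiple[of "cnj3 (cross u2 p)"] p by auto
  define u0 where "u0 = k *s cnj3 (cross u2 p)"
  have cc: "cnj3 (a *s cnj3 v) = cnj a *s v" for a v by (simp add: vec3_eq_iff)
  have cs: "cnj3 (a *s v) = cnj a *s cnj3 v" for a v by (simp add: vec3_eq_iff)
  have u0: "dot3 (cnj3 u0) u0 = 1" using k by (simp add: u0_def)
  have u02: "dot3 (cnj3 u0) u2 = 0" unfolding u0_def cc by simp
  have "cross u0 u2 \<noteq> 0"
  proof
    assume "cross u0 u2 = 0"
    then obtain l where l: "u0 = l *s u2" using cross_zero_imp \<open>u2 \<noteq> 0\<close> by blast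
    then have "cnj l = 0" using u02 u2 by (simp add: cs)
    then show False using l u0 by simp
  qed
  then obtain k' where k': "dot3 (cnj3 (k' *s cnj3 (cross u0 u2))) (k' *s cnj3 (cross u0 u2)) = 1"
    using unit_multiple[of "cnj3 (cross u0 u2)"] by auto
  define u1 where "u1 = k' *s cnj3 (cross u0 u2)"
  have "dot3 (cnj3 u1) u0 = 0" "dot3 (cnj3 u1) u2 = 0" unfolding u1_def cc by simp_all
  moreover have "dot3 (cnj3 u0) u1 = cnj (dot3 (cnj3 u1) u0)" by (simp add: dot3_expand mult.commute)
  ultimately have "frame u0 u1 u2"
    using u0 u2 k' u02 by unfold_locales (simp_all add: u1_def[symmetric])
  then show ?thesis using c(1) u2_def by blast
qed

section \<open>Real polynomials\<close>

definition complex_poly :: "nat \<Rightarrow> ((nat \<Rightarrow> (complex^3) \<times> (complex^3)) \<Rightarrow> complex) \<Rightarrow> bool"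
  where "complex_poly n F \<longleftrightarrow> real_poly n (\<lambda>v. Re (F v)) \<and> real_poly n (\<lambda>v. Im (F v))"

lemma real_poly_minus: "real_poly n g \<Longrightarrow> real_poly n (\<lambda>v. - g v)"
  using real_poly.mult[OF real_poly.const[of n "- 1"], of g] by simp

lemma real_poly_diff: "real_poly n g \<Longrightarrow> real_poly n h \<Longrightarrow> real_poly n (\<lambda>v. g v - h v)"
  using real_poly.add[OF _ real_poly_minus, of n g h] by simp

lemma complex_poly_diff: "complex_poly n F \<Longrightarrow> complex_poly n F' \<Longrightarrow> complex_poly n (\<lambda>v. F v - F' v)"
  unfolding complex_poly_def by (simp add: real_poly_diff)

lemma complex_poly_mult: "complex_poly n F \<Longrightarrow> complex_poly n F' \<Longrightarrow> complex_poly n (\<lambda>v. F v * F' v)"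
  unfolding complex_poly_def by (simp add: real_poly_diff real_poly.add real_poly.mult)

lemma complex_poly_cnj: "complex_poly n F \<Longrightarrow> complex_poly n (\<lambda>v. cnj (F v))"
  unfolding complex_poly_def by (simp add: real_poly_minus)

lemma complex_poly_coord: "i < n \<Longrightarrow> complex_poly n (\<lambda>v. dot3 (fst (v i)) u)"
proof -
  assume i: "i < n"
  have c: "(r *\<^sub>R x) $ j = complex_of_real r * x $ j" for r and x :: "complex^3" and j
    by (simp add: scaleR_conv_of_real[where 'a = complex])
  have s: "dot3 (r *\<^sub>R x) u = complex_of_real r * dot3 x u" for r x
    unfolding dot3_expand c by (simp add: algebra_simps)
  have "linear (\<lambda>z :: (complex^3) \<times> (complex^3). Re (dot3 (fst z) u))"
    "linear (\<lambda>z :: (complex^3) \<times> (complex^3). Im (dot3 (fst z) u))"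
    by (rule linearI; simp add: s)+
  then show ?thesis unfolding complex_poly_def using i
    by (auto intro: real_poly.coord[of i n "\<lambda>z. Re (dot3 (fst z) u)"] real_poly.coord[of i n "\<lambda>z. Im (dot3 (fst z) u)"])
qed

section \<open>Fibers that meet a line\<close>

context frame
begin

definition line :: "(cp2 \<times> cp2) set"
  where "line = {z \<in> flag. snd z = abs_cp2 u2}"

definition on_line :: "(complex^3) \<times> (complex^3) \<Rightarrow> bool"
  where "on_line z \<longleftrightarrow> z \<in> flag_cone \<and> pt z \<in> line"

definition bracket :: "(complex^3) \<times> (complex^3) \<Rightarrow> (complex^3) \<times> (complex^3) \<Rightarrow> complex"
  where "bracket z z' = dot3 (fst z) u0 * dot3 (fst z') u1 - dot3 (fst z) u1 * dot3 (fst z') u0"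

text \<open>The imaginary part of the cross-ratio of four points of the line, multiplied by the squared modulus
  of its denominator. It vanishes when the points lie on a circle or are not distinct.\<close>

definition concyclicity where "concyclicity z1 z2 z3 z4 =
    Im (bracket z3 z1 * bracket z4 z2 * cnj (bracket z3 z2 * bracket z4 z1))"

lemma u2_nonzero: "u2 \<noteq> 0"
  using unit(3) by auto

lemma on_line_iff: "on_line (x, y) \<longleftrightarrow> (\<exists>a b t. x = xvec a b 0 \<and> y = yvec 0 0 t \<and> t \<noteq> 0 \<and> (a \<noteq> 0 \<or> b \<noteq> 0))"
proof
  assume h: "on_line (x, y)"
  then have c: "(x, y) \<in> flag_cone" and e: "abs_cp2 u2 = abs_cp2 y"
    unfolding on_line_def line_def by (auto simp: pt_Pair)
  have "y \<noteq> 0" "x \<noteq> 0" "dot3 x y = 0" using c by (auto simp: flag_cone_def)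
  then obtain t where t: "t \<noteq> 0" "y = t *s u2" using e abs_cp2_eq_iff[OF u2_nonzero] by blast
  then have y: "y = yvec 0 0 t" by (simp add: yvec_def)
  obtain a b c where x: "x = xvec a b c" using xvec_coords by blast
  have "c = 0" using \<open>dot3 x y = 0\<close> t(1) unfolding x y dot3_xvec_yvec by simp
  then show "\<exists>a b t. x = xvec a b 0 \<and> y = yvec 0 0 t \<and> t \<noteq> 0 \<and> (a \<noteq> 0 \<or> b \<noteq> 0)"
    using x y t(1) \<open>x \<noteq> 0\<close> by (auto simp: xvec_eq_0)
next
  assume "\<exists>a b t. x = xvec a b 0 \<and> y = yvec 0 0 t \<and> t \<noteq> 0 \<and> (a \<noteq> 0 \<or> b \<noteq> 0)"
  then obtain a b t where h: "x = xvec a b 0" "y = yvec 0 0 t" "t \<noteq> 0" "a \<noteq> 0 \<or> b \<noteq> 0" by blast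
  then have c: "(x, y) \<in> flag_cone" by (simp add: cone_iff)
  have "y = t *s u2" using h(2) by (simp add: yvec_def)
  moreover have "y \<noteq> 0" using c by (simp add: flag_cone_def)
  ultimately have "abs_cp2 u2 = abs_cp2 y" using abs_cp2_eq_iff[OF u2_nonzero] h(3) by blast
  moreover have "pt (x, y) \<in> flag" using c flag_eq by blast
  ultimately show "on_line (x, y)" using c unfolding on_line_def line_def by (simp add: pt_Pair)
qed

lemma line_eq: "line = pt ` {z. on_line z}"
proof (rule Set.set_eqI, rule iffI)
  fix p assume p: "p \<in> line"
  then obtain z where "z \<in> flag_cone" "p = pt z" using flag_eq unfolding line_def by blast
  then show "p \<in> pt ` {z. on_line z}" using p unfolding on_line_def by blast
qed (auto simp: on_line_def)

lemma proportional_if_bracket_zero: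
  fixes a b a' b' :: complex
  assumes "a * b' = b * a'" "a \<noteq> 0 \<or> b \<noteq> 0" "a' \<noteq> 0 \<or> b' \<noteq> 0"
  shows "\<exists>k. k \<noteq> 0 \<and> a' = k * a \<and> b' = k * b"
proof (cases "a = 0")
  case True
  then show ?thesis using assms by (intro exI[of _ "b' / b"]) auto
next
  case False
  have "a' \<noteq> 0"
  proof
    assume "a' = 0"
    then show False using assms False by auto
  qed
  with False assms show ?thesis by (intro exI[of _ "a' / a"]) (auto simp: field_simps)
qed

lemma bracket_zero_iff:
  assumes "on_line z" "on_line z'"
  shows "bracket z z' = 0 \<longleftrightarrow> pt z = pt z'"
proof -
  obtain a b t where z: "z = (xvec a b 0, yvec 0 0 t)" "t \<noteq> 0" "a \<noteq> 0 \<or> b \<noteq> 0"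
    using assms(1) on_line_iff[of "fst z" "snd z"] by (metis prod.collapse)
  obtain a' b' t' where z': "z' = (xvec a' b' 0, yvec 0 0 t')" "t' \<noteq> 0" "a' \<noteq> 0 \<or> b' \<noteq> 0"
    using assms(2) on_line_iff[of "fst z'" "snd z'"] by (metis prod.collapse)
  have br: "bracket z z' = a * b' - b * a'" unfolding bracket_def z z' by (simp add: dot3_xvec)
  show ?thesis
  proof
    assume "bracket z z' = 0"
    then have "a * b' = b * a'" unfolding br by simp
    then obtain k where k: "k \<noteq> 0" "a' = k * a" "b' = k * b"
      using proportional_if_bracket_zero z(3) z'(3) by blast
    have "xvec a' b' 0 = k *s xvec a b 0" "yvec 0 0 t' = (t' / t) *s yvec 0 0 t"
      using k z(2) by (simp_all add: scale_xvec scale_yvec)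
    moreover have "k \<noteq> 0" "t' / t \<noteq> 0" using k z z' by auto
    moreover have "xvec a b 0 \<noteq> 0" "yvec 0 0 t \<noteq> 0" "xvec a' b' 0 \<noteq> 0" "yvec 0 0 t' \<noteq> 0"
      using z z' by (auto simp: xvec_eq_0 yvec_eq_0)
    ultimately show "pt z = pt z'"
      unfolding z(1) z'(1) pt_Pair using abs_cp2_eq_iff by (metis Pair_inject)
  next
    assume "pt z = pt z'"
    then obtain s where "xvec a' b' 0 = s *s xvec a b 0"
      using pt_eqD[of "xvec a b 0" "yvec 0 0 t" "xvec a' b' 0" "yvec 0 0 t'"] assms
      unfolding z(1) z'(1) on_line_def by auto
    then have "a' = s * a" "b' = s * b" unfolding scale_xvec xvec_eq_iff by auto
    then show "bracket z z' = 0" unfolding br by simp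
  qed
qed

text \<open>If the fiber over \<open>q\<close> meets the line at \<open>(a' : b')\<close>, then \<open>q\<close> is \<open>(cnj b' : - cnj a' : 0)\<close> in the
  conjugate frame, and the two equations of a twistor fiber become conjugate to each other.\<close>

lemma fiber_through_line_point:
  assumes z: "on_line z" and q: "pt z \<in> twistor_fiber q" and c: "(xvec a b c, yvec s t r) \<in> flag_cone"
  shows "pt (xvec a b c, yvec s t r) \<in> twistor_fiber q \<longleftrightarrow>
    a * dot3 (fst z) u1 = b * dot3 (fst z) u0 \<and> s * cnj (dot3 (fst z) u1) = t * cnj (dot3 (fst z) u0)"
proof -
  obtain a' b' t' where z': "z = (xvec a' b' 0, yvec 0 0 t')" "t' \<noteq> 0" "a' \<noteq> 0 \<or> b' \<noteq> 0"
    using z on_line_iff[of "fst z" "snd z"] by (metis prod.collapse)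
  define v where "v = xvec (cnj b') (- cnj a') 0"
  have v: "v \<noteq> 0" using z'(3) by (auto simp: v_def xvec_eq_0)
  have cv: "cnj3 v = yvec b' (- a') 0" by (simp add: v_def cnj3_xvec)
  have zc: "(xvec a' b' 0, yvec 0 0 t') \<in> flag_cone" using z z'(1) by (simp add: on_line_def)
  have "pt z \<in> twistor_fiber (abs_cp2 v)"
    unfolding z'(1) twistor_fiber_iff[OF zc v] cv unfolding v_def dot3_xvec_yvec by simp
  then have "q = abs_cp2 v" using q twistor_fibers_meet_imp_eq by blast
  then show ?thesis
    using twistor_fiber_iff[OF c v] unfolding cv unfolding v_def dot3_xvec_yvec z'(1) fst_conv dot3_xvec
    by (simp add: mult.commute)
qed

lemma twistor_fiber_line_unique:
  assumes z: "on_line z" "on_line z'" and q: "pt z \<in> twistor_fiber q" "pt z' \<in> twistor_fiber q"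
  shows "pt z = pt z'"
proof -
  obtain a b t where z': "z' = (xvec a b 0, yvec 0 0 t)"
    using z(2) on_line_iff[of "fst z'" "snd z'"] by (metis prod.collapse)
  have "(xvec a b 0, yvec 0 0 t) \<in> flag_cone" using z(2) z' by (simp add: on_line_def)
  from fiber_through_line_point[OF z(1) q(1) this] q(2)
  have "a * dot3 (fst z) u1 = b * dot3 (fst z) u0" unfolding z' by blast
  then have "bracket z z' = 0" unfolding bracket_def z' by (simp add: dot3_xvec mult.commute)
  then show ?thesis using bracket_zero_iff z by blast
qed

text \<open>Rescaling the coordinates multiplies the value by a positive real number.\<close>

lemma concyclicity_scale:
  assumes z: "on_line z1" "on_line z2" "on_line z3" "on_line z4"
    and w: "on_line w1" "on_line w2" "on_line w3" "on_line w4"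
    and e: "pt z1 = pt w1" "pt z2 = pt w2" "pt z3 = pt w3" "pt z4 = pt w4"
  shows "concyclicity z1 z2 z3 z4 = 0 \<longleftrightarrow> concyclicity w1 w2 w3 w4 = 0"
proof -
  have "\<exists>k. k \<noteq> 0 \<and> (\<forall>i. dot3 (fst w) i = k * dot3 (fst z) i)" if "on_line z" "on_line w" "pt z = pt w" for z w
    using pt_eqD[of "fst z" "snd z" "fst w" "snd w"] that by (auto simp: on_line_def)
  then obtain k1 k2 k3 k4 where k: "k1 \<noteq> 0" "k2 \<noteq> 0" "k3 \<noteq> 0" "k4 \<noteq> 0"
    and d: "\<And>i. dot3 (fst w1) i = k1 * dot3 (fst z1) i" "\<And>i. dot3 (fst w2) i = k2 * dot3 (fst z2) i"
    "\<And>i. dot3 (fst w3) i = k3 * dot3 (fst z3) i" "\<And>i. dot3 (fst w4) i = k4 * dot3 (fst z4) i"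
    using z w e by metis
  define W where "W = bracket z3 z1 * bracket z4 z2 * cnj (bracket z3 z2 * bracket z4 z1)"
  have "bracket w3 w1 * bracket w4 w2 * cnj (bracket w3 w2 * bracket w4 w1)
     = ((k1 * k2 * k3 * k4) * cnj (k1 * k2 * k3 * k4)) * W"
    unfolding bracket_def d W_def by (simp add: algebra_simps)
  also have "(k1 * k2 * k3 * k4) * cnj (k1 * k2 * k3 * k4) = complex_of_real ((cmod (k1 * k2 * k3 * k4))\<^sup>2)"
    by (simp only: complex_norm_square)
  finally have "concyclicity w1 w2 w3 w4 = Im (complex_of_real ((cmod (k1 * k2 * k3 * k4))\<^sup>2) * W)"
    unfolding concyclicity_def by (rule arg_cong)
  then have "concyclicity w1 w2 w3 w4 = (cmod (k1 * k2 * k3 * k4))\<^sup>2 * concyclicity z1 z2 z3 z4"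
    unfolding concyclicity_def W_def[symmetric] by (simp del: of_real_power of_real_mult)
  moreover have "(cmod (k1 * k2 * k3 * k4))\<^sup>2 \<noteq> 0" using k by simp
  ultimately show ?thesis by simp
qed

text \<open>The unions whose points of intersection with the line lie on one circle.\<close>

definition exceptional :: "nat \<Rightarrow> (cp2 \<times> cp2) set set"
  where "exceptional n = {A \<in> twistor_unions n line. \<forall>z1 z2 z3 z4. on_line z1 \<and> on_line z2 \<and> on_line z3 \<and> on_line z4 \<longrightarrow>
    pt z1 \<in> A \<longrightarrow> pt z2 \<in> A \<longrightarrow> pt z3 \<in> A \<longrightarrow> pt z4 \<in> A \<longrightarrow> concyclicity z1 z2 z3 z4 = 0}"

text \<open>Four fibers through points that are not on a circle are taken as \<open>a\<close>, \<open>b\<close>, \<open>c1\<close>, \<open>c2\<close>. That the cross-ratio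
  is not real means that the ratios of \<open>c1\<close> and \<open>c2\<close> have different conjugation quotients.\<close>

lemma general_union:
  assumes "d \<ge> 2" and union: "A \<in> twistor_unions (d + 2) line" and general: "A \<notin> exceptional (d + 2)"
  shows "h0_ideal A 1 d \<ge> d \<and> general_member_irreducible (ideal_sections A 1 d)"
proof -
  have "\<exists>\<C>. A = \<Union>\<C> \<and> \<C> \<subseteq> range twistor_fiber \<and> finite \<C> \<and> card \<C> = d + 2 \<and>
    pairwise disjnt \<C> \<and> (\<forall>C\<in>\<C>. C \<inter> line \<noteq> {})"
    using union unfolding twistor_unions_def mem_Collect_eq .
  then obtain \<C> where \<C>: "A = \<Union>\<C>" "\<C> \<subseteq> range twistor_fiber" "finite \<C>" "card \<C> = d + 2"
    "\<forall>C\<in>\<C>. C \<inter> line \<noteq> {}" by (elim exE conjE)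
  have "\<exists>z. on_line z \<and> pt z \<in> C" if "C \<in> \<C>" for C
  proof -
    obtain p where "p \<in> C" "p \<in> line" using bspec[OF \<C>(5) \<open>C \<in> \<C>\<close>] by blast
    then show ?thesis unfolding line_eq by blast
  qed
  then have "\<forall>C\<in>\<C>. \<exists>z. on_line z \<and> pt z \<in> C" by blast
  from bchoice[OF this] obtain z where z': "\<forall>C\<in>\<C>. on_line (z C) \<and> pt (z C) \<in> C" by blast
  have z: "on_line (z C)" "pt (z C) \<in> C" if "C \<in> \<C>" for C using z' that by blast+
  define l0 where "l0 C = dot3 (fst (z C)) u0" for C
  define l1 where "l1 C = dot3 (fst (z C)) u1" for C
  have br: "l0 C * l1 C' - l1 C * l0 C' = bracket (z C) (z C')" for C C'
    by (simp add: l0_def l1_def bracket_def)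
  have same: "C = C'" if "C \<in> \<C>" "C' \<in> \<C>" "p \<in> C" "p \<in> C'" for C C' p
  proof -
    have "C \<in> range twistor_fiber" "C' \<in> range twistor_fiber" using that(1,2) \<C>(2) by blast+
    then obtain q q' where "C = twistor_fiber q" "C' = twistor_fiber q'" by blast
    then show ?thesis using twistor_fibers_meet_imp_eq[of p q q'] that(3,4) by blast
  qed
  interpret fibers_on_line u0 u1 u2 d A \<C> l0 l1
  proof
    show "2 \<le> d" "finite \<C>" "card \<C> = d + 2" by fact+
    show "l0 C * l1 C' - l1 C * l0 C' \<noteq> 0" if "C \<in> \<C>" "C' \<in> \<C>" "C \<noteq> C'" for C C'
    proof
      assume "l0 C * l1 C' - l1 C * l0 C' = 0"
      then have "pt (z C) = pt (z C')"
        unfolding br bracket_zero_iff[OF z(1)[OF that(1)] z(1)[OF that(2)]] .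
      then have "pt (z C) \<in> C'" using z(2)[OF that(2)] by simp
      then show False using same[OF that(1,2) z(2)[OF that(1)]] that(3) by blast
    qed
    show "pt (xvec a b c, yvec s t r) \<in> A \<longleftrightarrow> (\<exists>C\<in>\<C>. a * l1 C = b * l0 C \<and> s * cnj (l1 C) = t * cnj (l0 C))"
      if c: "(xvec a b c, yvec s t r) \<in> flag_cone" for a b c s t r
    proof -
      have "pt (xvec a b c, yvec s t r) \<in> C \<longleftrightarrow> a * l1 C = b * l0 C \<and> s * cnj (l1 C) = t * cnj (l0 C)" if "C \<in> \<C>" for C
      proof -
        obtain q where "C = twistor_fiber q" using \<open>C \<in> \<C>\<close> \<C>(2) by blast
        then have "pt (z C) \<in> twistor_fiber q" using z(2)[OF that] by simp
        from fiber_through_line_point[OF z(1)[OF that] this c] show ?thesis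
          unfolding l0_def l1_def \<open>C = twistor_fiber q\<close> .
      qed
      then show ?thesis unfolding \<C>(1) by blast
    qed
  qed
  obtain z1 z2 z3 z4 where zz: "on_line z1" "on_line z2" "on_line z3" "on_line z4"
    "pt z1 \<in> A" "pt z2 \<in> A" "pt z3 \<in> A" "pt z4 \<in> A" "concyclicity z1 z2 z3 z4 \<noteq> 0"
    using union general unfolding exceptional_def by blast
  have point: "\<exists>C\<in>\<C>. pt w = pt (z C)" if "on_line w" "pt w \<in> A" for w
  proof -
    obtain C where C: "C \<in> \<C>" "pt w \<in> C" using \<open>pt w \<in> A\<close> \<C>(1) by blast
    then obtain q where "C = twistor_fiber q" using \<C>(2) by blast
    then have "pt w = pt (z C)" using twistor_fiber_line_unique[OF \<open>on_line w\<close> z(1)[OF C(1)]] z(2)[OF C(1)] C(2) by blast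
    then show ?thesis using C(1) by blast
  qed
  obtain C1 where C1: "C1 \<in> \<C>" "pt z1 = pt (z C1)" using point[OF zz(1,5)] by blast
  obtain C2 where C2: "C2 \<in> \<C>" "pt z2 = pt (z C2)" using point[OF zz(2,6)] by blast
  obtain C3 where C3: "C3 \<in> \<C>" "pt z3 = pt (z C3)" using point[OF zz(3,7)] by blast
  obtain C4 where C4: "C4 \<in> \<C>" "pt z4 = pt (z C4)" using point[OF zz(4,8)] by blast
  note C = C1(1) C2(1) C3(1) C4(1)
  have nc: "concyclicity (z C1) (z C2) (z C3) (z C4) \<noteq> 0"
    using concyclicity_scale[OF zz(1-4) z(1)[OF C(1)] z(1)[OF C(2)] z(1)[OF C(3)] z(1)[OF C(4)] C1(2) C2(2) C3(2) C4(2)] zz(9) by blast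
  have b0: "bracket (z C) (z C) = 0" for C by (simp add: bracket_def)
  have ne: "C3 \<noteq> C1" "C3 \<noteq> C2" "C4 \<noteq> C1" "C4 \<noteq> C2"
  proof -
    show "C3 \<noteq> C1" using nc by (rule contrapos_nn) (simp only: concyclicity_def b0 mult_zero_left zero_complex.sel)
    show "C3 \<noteq> C2" using nc
      by (rule contrapos_nn) (simp only: concyclicity_def b0 mult_zero_left mult_zero_right complex_cnj_zero zero_complex.sel)
    show "C4 \<noteq> C1" using nc
      by (rule contrapos_nn) (simp only: concyclicity_def b0 mult_zero_left mult_zero_right complex_cnj_zero zero_complex.sel)
    show "C4 \<noteq> C2" using nc
      by (rule contrapos_nn) (simp only: concyclicity_def b0 mult_zero_left mult_zero_right zero_complex.sel)
  qed
  have "C1 \<noteq> C2"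
  proof
    assume "C1 = C2"
    then have "concyclicity (z C1) (z C2) (z C3) (z C4) = Im (complex_of_real ((cmod (bracket (z C3) (z C1) * bracket (z C4) (z C1)))\<^sup>2))"
      unfolding concyclicity_def complex_norm_square by (simp only:)
    then show False using nc by (simp only: Im_complex_of_real not_True_eq_False)
  qed
  interpret marked_fibers_on_line u0 u1 u2 d A \<C> l0 l1 C1 C2
    by unfold_locales (fact C(1) C(2) \<open>C1 \<noteq> C2\<close>)+
  have nz: "br C3 C1 \<noteq> 0" "br C3 C2 \<noteq> 0" "br C4 C1 \<noteq> 0" "br C4 C2 \<noteq> 0"
    using br_nonzero C ne by blast+
  have "ratio C3 * cnj (ratio C4) \<noteq> cnj (ratio C3) * ratio C4"
  proof
    assume "ratio C3 * cnj (ratio C4) = cnj (ratio C3) * ratio C4"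
    then have "(cnj (br C3 C1) * br C4 C1) / (cnj (br C3 C2) * br C4 C2) = (br C3 C1 * cnj (br C4 C1)) / (br C3 C2 * cnj (br C4 C2))"
      unfolding ratio_def by (simp del: complex_cnj_mult)
    then have "(cnj (br C3 C1) * br C4 C1) * (br C3 C2 * cnj (br C4 C2)) = (br C3 C1 * cnj (br C4 C1)) * (cnj (br C3 C2) * br C4 C2)"
      using nz by (simp add: frac_eq_eq)
    moreover have "cnj (br C3 C1 * br C4 C2 * cnj (br C3 C2 * br C4 C1))
        = (cnj (br C3 C1) * br C4 C1) * (br C3 C2 * cnj (br C4 C2))" by (simp add: mult_ac)
    moreover have "br C3 C1 * br C4 C2 * cnj (br C3 C2 * br C4 C1)
        = (br C3 C1 * cnj (br C4 C1)) * (cnj (br C3 C2) * br C4 C2)" by (simp add: mult_ac)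
    ultimately have "cnj (br C3 C1 * br C4 C2 * cnj (br C3 C2 * br C4 C1)) = br C3 C1 * br C4 C2 * cnj (br C3 C2 * br C4 C1)"
      by (simp only:)
    then have "br C3 C1 * br C4 C2 * cnj (br C3 C2 * br C4 C1) \<in> \<real>" by (simp only: Reals_cnj_iff)
    then have "Im (br C3 C1 * br C4 C2 * cnj (br C3 C2 * br C4 C1)) = 0"
      by (simp only: complex_is_Real_iff)
    then show False using nc unfolding concyclicity_def br_def br by blast
  qed
  then show ?thesis using general_member[of C3 C4] C ne by blast
qed

lemma fibers_meeting_points:
  assumes v: "\<And>i. i < n \<Longrightarrow> on_line (v i)" "inj_on (\<lambda>i. pt (v i)) {..<n}"
  shows "fibers_meeting ((\<lambda>i. pt (v i)) ` {..<n}) \<in> twistor_unions n line"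
    and "on_line z \<Longrightarrow> pt z \<in> fibers_meeting ((\<lambda>i. pt (v i)) ` {..<n}) \<longleftrightarrow> (\<exists>i<n. pt z = pt (v i))"
proof -
  define B where "B = (\<lambda>i. pt (v i)) ` {..<n}"
  define q where "q i = abs_cp2 (cross (snd (v i)) (cnj3 (fst (v i))))" for i
  have q: "pt (v i) \<in> twistor_fiber p \<longleftrightarrow> p = q i" if "i < n" for i p
    using twistor_fiber_through[of "fst (v i)" "snd (v i)" p] v(1)[OF that] by (simp add: q_def on_line_def)
  define \<C> where "\<C> = {C \<in> range twistor_fiber. C \<inter> B \<noteq> {}}"
  have \<C>: "\<C> = (\<lambda>i. twistor_fiber (q i)) ` {..<n}"
  proof (intro equalityI subsetI)
    fix C assume "C \<in> \<C>"
    then obtain p w where p: "C = twistor_fiber p" "w \<in> C" "w \<in> B" unfolding \<C>_def by blast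
    then obtain i where "i < n" "w = pt (v i)" unfolding B_def by blast
    with p have "i < n" "pt (v i) \<in> twistor_fiber p" by blast+
    with p(1) have "C = twistor_fiber (q i)" "i < n" using q[of i p] by auto
    then show "C \<in> (\<lambda>i. twistor_fiber (q i)) ` {..<n}" by blast
  next
    fix C assume "C \<in> (\<lambda>i. twistor_fiber (q i)) ` {..<n}"
    then obtain i where i: "i < n" "C = twistor_fiber (q i)" by auto
    then have "pt (v i) \<in> C" "pt (v i) \<in> B" using q[OF i(1)] unfolding B_def by blast+
    then show "C \<in> \<C>" using i unfolding \<C>_def by blast
  qed
  have inj: "inj_on (\<lambda>i. twistor_fiber (q i)) {..<n}"
  proof (rule inj_onI)
    fix i j assume ij: "i \<in> {..<n}" "j \<in> {..<n}" "twistor_fiber (q i) = twistor_fiber (q j)"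
    then have "pt (v i) \<in> twistor_fiber (q i)" "pt (v j) \<in> twistor_fiber (q i)" using q by auto
    then have "pt (v i) = pt (v j)" using twistor_fiber_line_unique v(1) ij(1,2) by blast
    then show "i = j" using inj_onD[OF v(2)] ij(1,2) by blast
  qed
  have U: "fibers_meeting B = \<Union>\<C>" unfolding fibers_meeting_def \<C>_def ..
  have "pairwise disjnt \<C>"
    unfolding pairwise_def disjnt_def \<C>_def using twistor_fibers_meet_imp_eq by blast
  moreover have "C \<inter> line \<noteq> {}" if "C \<in> \<C>" for C
  proof -
    obtain i where i: "i < n" "C = twistor_fiber (q i)" using \<open>C \<in> \<C>\<close> unfolding \<C> by blast
    have "pt (v i) \<in> C" using q[OF i(1)] i(2) by blast
    moreover have "pt (v i) \<in> line" using v(1)[OF i(1)] by (simp add: on_line_def)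
    ultimately show ?thesis by blast
  qed
  moreover have "finite \<C>" "card \<C> = n" unfolding \<C> using card_image[OF inj] by auto
  moreover have "\<C> \<subseteq> range twistor_fiber" unfolding \<C>_def by blast
  ultimately have "\<Union>\<C> \<in> twistor_unions n line" unfolding twistor_unions_def by blast
  then show "fibers_meeting ((\<lambda>i. pt (v i)) ` {..<n}) \<in> twistor_unions n line"
    using U unfolding B_def by simp
  show "pt z \<in> fibers_meeting ((\<lambda>i. pt (v i)) ` {..<n}) \<longleftrightarrow> (\<exists>i<n. pt z = pt (v i))" if "on_line z"
  proof
    assume "pt z \<in> fibers_meeting ((\<lambda>i. pt (v i)) ` {..<n})"
    then obtain i where i: "i < n" "pt z \<in> twistor_fiber (q i)" unfolding B_def[symmetric] U \<C> by auto
    then have "pt z = pt (v i)" using twistor_fiber_line_unique[OF that v(1)[OF i(1)] i(2)] q[OF i(1)] by blast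
    then show "\<exists>i<n. pt z = pt (v i)" using i(1) by blast
  next
    assume "\<exists>i<n. pt z = pt (v i)"
    then obtain i where i: "i < n" "pt z = pt (v i)" by blast
    then have "pt z \<in> twistor_fiber (q i)" using q[OF i(1), of "q i"] by simp
    then show "pt z \<in> fibers_meeting ((\<lambda>i. pt (v i)) ` {..<n})"
      unfolding B_def[symmetric] U \<C> using i(1) by blast
  qed
qed

lemma exceptional_iff:
  assumes v: "\<And>i. i < n \<Longrightarrow> on_line (v i)" "inj_on (\<lambda>i. pt (v i)) {..<n}"
  shows "fibers_meeting ((\<lambda>i. pt (v i)) ` {..<n}) \<in> exceptional n \<longleftrightarrow>
    (\<forall>i<n. \<forall>j<n. \<forall>k<n. \<forall>l<n. concyclicity (v i) (v j) (v k) (v l) = 0)"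
  (is "?A \<in> _ \<longleftrightarrow> ?R")
proof
  assume "?A \<in> exceptional n"
  moreover have "pt (v i) \<in> ?A" if "i < n" for i
    using fibers_meeting_points(2)[OF v v(1)[OF that]] that by blast
  ultimately show ?R using v(1) unfolding exceptional_def mem_Collect_eq by (intro allI impI) metis
next
  assume R: ?R
  have "concyclicity z1 z2 z3 z4 = 0"
    if z: "on_line z1" "on_line z2" "on_line z3" "on_line z4" "pt z1 \<in> ?A" "pt z2 \<in> ?A" "pt z3 \<in> ?A" "pt z4 \<in> ?A" for z1 z2 z3 z4
  proof -
    have point: "\<exists>i<n. pt w = pt (v i)" if "on_line w" "pt w \<in> ?A" for w
      using that fibers_meeting_points(2)[OF v that(1)] by blast
    obtain i where i: "i < n" "pt z1 = pt (v i)" using point[OF z(1,5)] by blast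
    obtain j where j: "j < n" "pt z2 = pt (v j)" using point[OF z(2,6)] by blast
    obtain k where k: "k < n" "pt z3 = pt (v k)" using point[OF z(3,7)] by blast
    obtain l where l: "l < n" "pt z4 = pt (v l)" using point[OF z(4,8)] by blast
    show ?thesis
      using concyclicity_scale[OF z(1-4) v(1)[OF i(1)] v(1)[OF j(1)] v(1)[OF k(1)] v(1)[OF l(1)] i(2) j(2) k(2) l(2)]
        R i(1) j(1) k(1) l(1) by blast
  qed
  then show "?A \<in> exceptional n"
    unfolding exceptional_def using fibers_meeting_points(1)[OF v] by blast
qed

lemma real_closed_exceptional: "real_closed n line (exceptional n)"
  unfolding real_closed_def
proof (intro conjI exI)
  let ?G = "(\<lambda>(i, j, k, l) v. concyclicity (v i) (v j) (v k) (v l)) ` ({..<n} \<times> {..<n} \<times> {..<n} \<times> {..<n})"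
  show "exceptional n \<subseteq> twistor_unions n line" unfolding exceptional_def by blast
  show "\<forall>g\<in>?G. real_poly n g"
  proof
    fix g assume "g \<in> ?G"
    then obtain i j k l where g: "g = (\<lambda>v. concyclicity (v i) (v j) (v k) (v l))" "i < n" "j < n" "k < n" "l < n" by auto
    have "complex_poly n (\<lambda>v. bracket (v i) (v j))" if "i < n" "j < n" for i j
      unfolding bracket_def using that by (intro complex_poly_diff complex_poly_mult complex_poly_coord)
    then have "complex_poly n (\<lambda>v. bracket (v k) (v i) * bracket (v l) (v j) * cnj (bracket (v k) (v j) * bracket (v l) (v i)))"
      using g by (intro complex_poly_mult complex_poly_cnj) auto
    then show "real_poly n g" unfolding g(1) concyclicity_def complex_poly_def by blast
  qed
  show "\<forall>v. (\<forall>i<n. v i \<in> flag_cone \<and> pt (v i) \<in> line) \<and> inj_on (\<lambda>i. pt (v i)) {..<n} \<longrightarrow>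
      (fibers_meeting ((\<lambda>i. pt (v i)) ` {..<n}) \<in> exceptional n \<longleftrightarrow> (\<forall>g\<in>?G. g v = 0))"
  proof (intro allI impI, elim conjE)
    fix v assume v: "\<forall>i<n. v i \<in> flag_cone \<and> pt (v i) \<in> line" "inj_on (\<lambda>i. pt (v i)) {..<n}"
    then have "\<And>i. i < n \<Longrightarrow> on_line (v i)" by (simp add: on_line_def)
    from exceptional_iff[OF this v(2)]
    show "fibers_meeting ((\<lambda>i. pt (v i)) ` {..<n}) \<in> exceptional n \<longleftrightarrow> (\<forall>g\<in>?G. g v = 0)" by auto
  qed
qed

text \<open>The points \<open>\<i>, 1, 2, \<dots>\<close> of the line: \<open>1, 2, 3\<close> lie on the real circle, \<open>\<i>\<close> does not.\<close>

lemma exceptional_proper: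
  assumes "n \<ge> 4"
  shows "exceptional n \<noteq> twistor_unions n line"
proof -
  define \<tau> where "\<tau> i = (if i = 0 then \<i> else of_nat i)" for i :: nat
  define v where "v i = (xvec 1 (\<tau> i) 0, yvec 0 0 1)" for i
  have on: "on_line (v i)" for i
    unfolding v_def on_line_iff by (rule exI[of _ 1], rule exI[of _ "\<tau> i"], rule exI[of _ 1]) simp
  have br: "bracket (v i) (v j) = \<tau> j - \<tau> i" for i j
    by (simp add: bracket_def v_def dot3_xvec)
  have inj: "inj_on (\<lambda>i. pt (v i)) {..<n}"
  proof (rule inj_onI)
    fix i j assume "pt (v i) = pt (v j)"
    then have "\<tau> i = \<tau> j" using bracket_zero_iff[OF on on, of i j] br by simp
    moreover have "\<i> \<noteq> of_nat m" for m
    proof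
      assume "\<i> = of_nat m"
      then have "Im \<i> = Im (of_nat m)" by (rule arg_cong)
      then show False by simp
    qed
    ultimately show "i = j" unfolding \<tau>_def by (auto split: if_splits dest: sym)
  qed
  have "concyclicity (v 1) (v 3) (v 0) (v 2) \<noteq> 0"
    unfolding concyclicity_def br by (simp add: \<tau>_def)
  moreover have "1 < n" "3 < n" "0 < n" "2 < n" using assms by auto
  ultimately have "fibers_meeting ((\<lambda>i. pt (v i)) ` {..<n}) \<notin> exceptional n"
    unfolding exceptional_iff[of n v, OF on inj] by blast
  then show ?thesis using fibers_meeting_points(1)[of n v, OF on inj] by blast
qed

end

theorem theorem3p8:
  fixes d :: nat and L :: "(cp2 \<times> cp2) set"
  assumes "d \<ge> 2" and "bidegree_1_0_curve L"
  shows "\<exists>E. real_closed (d + 2) L E \<and> E \<noteq> twistor_unions (d + 2) L \<and>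
    (\<forall>A \<in> twistor_unions (d + 2) L - E.
      h0_ideal A 1 d \<ge> d \<and> general_member_irreducible (ideal_sections A 1 d))"
proof -
  obtain m where L: "L = {z \<in> flag. snd z = m}" using assms(2) unfolding bidegree_1_0_curve_def by blast
  obtain m0 where m0: "m0 \<noteq> 0" "m = abs_cp2 m0" using abs_cp2_surj by blast
  obtain u0 u1 u2 c where u: "frame u0 u1 u2" "c \<noteq> 0" "u2 = c *s m0" using ex_frame[OF m0(1)] by blast
  interpret frame u0 u1 u2 by (rule u(1))
  have "abs_cp2 m0 = abs_cp2 u2" using abs_cp2_eq_iff[OF m0(1) u2_nonzero] u(2,3) by blast
  then have "L = line" unfolding L line_def m0(2) by simp
  then show ?thesis
    using real_closed_exceptional[of "d + 2"] exceptional_proper[of "d + 2"] general_union[OF assms(1)] assms(1)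
    by (intro exI[of _ "exceptional (d + 2)"]) auto
qed

end
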